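(* Let $0<\alpha<\tfrac12$, and let $V_{\alpha,\flat}$, $\hat F_{\alpha,\flat}$, $D=D_1\cup D_2$, $\psi$, $V_1=\{(x,y):0\le x\le1,\ -\infty\le y\le0\}$ and the planar Farey map $\hat F$ on $V_1$ be as defined in the context. Then $D=V_1$, and for a.e. $(x,y)\in V_1$, $$\big(\psi^{-1}\circ\hat F_{\alpha,\flat}\circ\psi\big)(x,y)=\hat F(x,y).$$ In other words, for any $0<\alpha<\tfrac12$, $(V_{\alpha,\flat},\hat\mu_{\alpha,\flat},\hat F_{\alpha,\flat})$ is metrically isomorphic to $(V_1,\hat\mu_1,\hat F)$ by the isomorphism $\psi:V_1\to V_{\alpha,\flat}$, where $\hat\mu_{\alpha,\flat}$ and $\hat\mu_1$ are the measures with density $\dfrac{dx\,dy}{(x-y)^2}$ on $V_{\alpha,\flat}$ and on $V_1$, respectively.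
   Context: Planar Farey map on $V_1$: $\hat F(x,y)=\left(\frac{x}{1-x},\frac{y}{1-y}\right)$ if $0\le x<\frac12$ and $\hat F(x,y)=\left(\frac{1-x}{x},\frac{1-y}{y}\right)$ if $\frac12\le x\le1$. The planar map $\hat F_{\alpha,\flat}$ on $V_{\alpha,\flat}$: $\hat F_{\alpha,\flat}(x,y)=\left(-\frac{1+2x}{x},-\frac{1+2y}{y}\right)$ if $\alpha-1\le x<-\frac12$; $\left(-\frac{x}{1+x},-\frac{y}{1+y}\right)$ if $-\frac12\le x<0$; $\left(\frac{x}{1-x},\frac{y}{1-y}\right)$ if $0\le x<\frac12$; $\left(\frac{1-2x}{x},\frac{1-2y}{y}\right)$ if $\frac12\le x\le\frac1{1+\alpha}$; $\left(\frac{1-x}{x},\frac{1-y}{y}\right)$ if $\frac1{1+\alpha}<x\le1$. (Usual conventions at $y=-\infty$.) The domain $\Omega_\alpha$: for $x\in[\alpha-1,\alpha)$, $x\ne0$, put $b(x)=\lfloor \frac1{|x|}+1-\alpha\rfloor$ and let $\hat G_\alpha(x,y)=\left(-\frac1x-b(x),\frac1{b(x)-y}\right)$ for $x<0$ and $\hat G_\alpha(x,y)=\left(\frac1x-b(x),\frac1{b(x)+y}\right)$ for $x>0$. $\Omega_\alpha\subset[\alpha-1,\alpha]\times[0,1]$ is the closure of $\{\hat G_\alpha^n(x,0): x\in[\alpha-1,\alpha),\ n\ge0\}$ (over all $n$ for which the iterate is defined). (It is known that $\hat G_\alpha$ is bijective on $\Omega_\alpha$ except for a set of Lebesgue measure $0$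 and is a natural extension of the $\alpha$-continued fraction map.) Put $\Omega_\alpha^*=\{(x,y):(x,-\frac1y)\in\Omega_\alpha\}$. Let $k_0$ be the integer with $\frac1{k_0+\alpha}\le\alpha<\frac1{k_0-1+\alpha}$. Cylinders: $\Omega^*_{\alpha,k_0,+}=\{(x,y)\in\Omega^*_\alpha:\frac1{k_0+\alpha}<x<\alpha\}$; $\Omega^*_{\alpha,k,+}=\{(x,y)\in\Omega^*_\alpha:\frac1{k+\alpha}<x\le\frac1{k-1+\alpha}\}$ for $k>k_0$; $\Omega^*_{\alpha,k,+}=\emptyset$ for $2\le k<k_0$; $\Omega^*_{\alpha,2,-}=\{(x,y)\in\Omega^*_\alpha:\alpha-1<x\le-\frac1{2+\alpha}\}$; $\Omega^*_{\alpha,k,-}=\{(x,y)\in\Omega^*_\alpha:-\frac1{k-1+\alpha}<x\le-\frac1{k+\alpha}\}$ for $k\ge3$. Put $\hat\Omega_{\alpha,k,-}=\{(x,y):(-\frac1x,-\frac1y)\in\Omega^*_{\alpha,k,-}\}$ and $\hat\Omega_{\alpha,k,+}=\{(x,y):(\frac1x,\frac1y)\in\Omega^*_{\alpha,k,+}\}$. For $j\ge1$ put $$\Upsilon_{\alpha,j}=\bigcup_{k\ge j+1}\big(\hat\Omega_{\alpha,k,-}-(k-j,k-j)\big)\cup\bigcup_{k\ge j+1}\big(\hat\Omega_{\alpha,k,+}-(k-j,k-j)\big),$$ $\Upsilon_\alpha=\bigcup_{j\ge1}\Upsilon_{\alpha,j}$, $(\Upsilon_\alpha)^{-1}=\{(x,y):(\frac1x,\frac1y)\in\Upsilon_\alpha\}$,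 $V_\alpha=\Omega^*_\alpha\cup(\Upsilon_\alpha)^{-1}$, and $V_{\alpha,\flat}=\{(x,y)\in V_\alpha:x\le1\}$. Let $V_{\alpha,-}=\{(x,y)\in V_{\alpha,\flat}:x<0\}$, $V_{\alpha,+}=\{(x,y)\in V_{\alpha,\flat}:x\ge0\}$, $D_1=V_{\alpha,-}+(1,1)$, $D_2=V_{\alpha,+}\setminus D_1$, $D=D_1\cup D_2$ (by definition $D\subset V_1$). Define $\psi$ on $D$ by $\psi(x,y)=(x-1,y-1)$ if $(x,y)\in D_1$ and $\psi(x,y)=(x,y)$ if $(x,y)\in D_2$.
   Formalization: "D = V_1" is proved as: D is contained in V_1 and V_1 \ D has Lebesgue measure zero; literal equality fails, since e.g. (0,0) lies in V_1 but not in D. *)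

theory Defs
  imports "HOL-Analysis.Analysis"
begin

section \<open>Points with second coordinate at infinity\<close>

text \<open>
  Second coordinates live in the reals extended by one point at infinity, written
  \<open>-\<infinity>\<close>.  They are modelled as extended reals; the value \<open>+\<infinity>\<close> is not used as a
  coordinate, and since \<open>mob\<close> keeps it fixed it belongs to none of the sets below.
  \<open>mob a b c d y\<close> is \<open>(a y + b) / (c y + d)\<close>, with the usual value \<open>a / c\<close> at infinity and
  value \<open>-\<infinity>\<close> at the pole.
\<close>

definition mob :: "real \<Rightarrow> real \<Rightarrow> real \<Rightarrow> real \<Rightarrow> ereal \<Rightarrow> ereal" where
  "mob a b c d y =
     (if y = \<infinity> then \<infinity>
      else if y = -\<infinity> then (if c = 0 then -\<infinity> else ereal (a / c))
      else if c * real_of_ereal y + d = 0 then -\<infinity>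
      else ereal ((a * real_of_ereal y + b) / (c * real_of_ereal y + d)))"

definition shift :: "real \<Rightarrow> (real \<times> ereal) set \<Rightarrow> (real \<times> ereal) set" where
  "shift c S = (\<lambda>(x, y). (x + c, y + ereal c)) ` S"

section \<open>The Farey map and its domain\<close>

definition V1 :: "(real \<times> ereal) set" where
  "V1 = {(x, y). 0 \<le> x \<and> x \<le> 1 \<and> -\<infinity> \<le> y \<and> y \<le> 0}"

definition Farey :: "real \<times> ereal \<Rightarrow> real \<times> ereal" where
  "Farey = (\<lambda>(x, y).
     if x < 1/2 then (x / (1 - x), mob 1 0 (-1) 1 y)
     else ((1 - x) / x, mob (-1) 1 1 0 y))"

section \<open>The natural extension of the alpha-continued fraction map\<close>

definition digit :: "real \<Rightarrow> real \<Rightarrow> int" where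
  "digit \<alpha> x = \<lfloor>1 / \<bar>x\<bar> + 1 - \<alpha>\<rfloor>"

text \<open>Only meaningful for nonzero first coordinate.\<close>

definition Gauss_ext :: "real \<Rightarrow> real \<times> real \<Rightarrow> real \<times> real" where
  "Gauss_ext \<alpha> = (\<lambda>(x, y).
     if x < 0 then (- 1 / x - real_of_int (digit \<alpha> x), 1 / (real_of_int (digit \<alpha> x) - y))
     else (1 / x - real_of_int (digit \<alpha> x), 1 / (real_of_int (digit \<alpha> x) + y)))"

definition Omega :: "real \<Rightarrow> (real \<times> real) set" where
  "Omega \<alpha> = closure {(Gauss_ext \<alpha> ^^ n) (x, 0) | n x.
     \<alpha> - 1 \<le> x \<and> x < \<alpha> \<and> (\<forall>m<n. fst ((Gauss_ext \<alpha> ^^ m) (x, 0)) \<noteq> 0)}"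

text \<open>\<open>mob 0 (-1) 1 0 y\<close> is \<open>-1/y\<close>, and \<open>mob 0 1 1 0 y\<close> is \<open>1/y\<close>.\<close>

definition Omega_star :: "real \<Rightarrow> (real \<times> ereal) set" where
  "Omega_star \<alpha> = {(x, y). \<exists>t. mob 0 (-1) 1 0 y = ereal t \<and> (x, t) \<in> Omega \<alpha>}"

section \<open>The domain of the alpha-Farey map\<close>

definition k0 :: "real \<Rightarrow> int" where
  "k0 \<alpha> = (THE k. 1 / (real_of_int k + \<alpha>) \<le> \<alpha> \<and> \<alpha> < 1 / (real_of_int k - 1 + \<alpha>))"

definition cyl_plus :: "real \<Rightarrow> int \<Rightarrow> (real \<times> ereal) set" where
  "cyl_plus \<alpha> k =
     (if k < k0 \<alpha> then {}
      else if k = k0 \<alpha> then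
        {(x, y) \<in> Omega_star \<alpha>. 1 / (real_of_int k + \<alpha>) < x \<and> x < \<alpha>}
      else
        {(x, y) \<in> Omega_star \<alpha>.
           1 / (real_of_int k + \<alpha>) < x \<and> x \<le> 1 / (real_of_int k - 1 + \<alpha>)})"

definition cyl_minus :: "real \<Rightarrow> int \<Rightarrow> (real \<times> ereal) set" where
  "cyl_minus \<alpha> k =
     (if k = 2 then
        {(x, y) \<in> Omega_star \<alpha>. \<alpha> - 1 < x \<and> x \<le> - 1 / (2 + \<alpha>)}
      else
        {(x, y) \<in> Omega_star \<alpha>.
           - 1 / (real_of_int k - 1 + \<alpha>) < x \<and> x \<le> - 1 / (real_of_int k + \<alpha>)})"

definition hat_plus :: "real \<Rightarrow> int \<Rightarrow> (real \<times> ereal) set" where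
  "hat_plus \<alpha> k = {(x, y). (1 / x, mob 0 1 1 0 y) \<in> cyl_plus \<alpha> k}"

definition hat_minus :: "real \<Rightarrow> int \<Rightarrow> (real \<times> ereal) set" where
  "hat_minus \<alpha> k = {(x, y). (- 1 / x, mob 0 (-1) 1 0 y) \<in> cyl_minus \<alpha> k}"

definition Upsilon_level :: "real \<Rightarrow> int \<Rightarrow> (real \<times> ereal) set" where
  "Upsilon_level \<alpha> j =
     (\<Union>k\<in>{j + 1..}. shift (- real_of_int (k - j)) (hat_minus \<alpha> k)) \<union>
     (\<Union>k\<in>{j + 1..}. shift (- real_of_int (k - j)) (hat_plus \<alpha> k))"

definition Upsilon :: "real \<Rightarrow> (real \<times> ereal) set" where
  "Upsilon \<alpha> = (\<Union>j\<in>{1..}. Upsilon_level \<alpha> j)"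

definition Upsilon_inv :: "real \<Rightarrow> (real \<times> ereal) set" where
  "Upsilon_inv \<alpha> = {(x, y). (1 / x, mob 0 1 1 0 y) \<in> Upsilon \<alpha>}"

definition V :: "real \<Rightarrow> (real \<times> ereal) set" where
  "V \<alpha> = Omega_star \<alpha> \<union> Upsilon_inv \<alpha>"

definition V_flat :: "real \<Rightarrow> (real \<times> ereal) set" where
  "V_flat \<alpha> = {(x, y) \<in> V \<alpha>. x \<le> 1}"

text \<open>The branches are those on \<open>V_flat \<alpha>\<close>, whose first coordinates lie in \<open>[\<alpha> - 1, 1]\<close>.\<close>

definition Farey_flat :: "real \<Rightarrow> real \<times> ereal \<Rightarrow> real \<times> ereal" where
  "Farey_flat \<alpha> = (\<lambda>(x, y).
     if x < - 1/2 then (- (1 + 2 * x) / x, mob (-2) (-1) 1 0 y)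
     else if x < 0 then (- x / (1 + x), mob (-1) 0 1 1 y)
     else if x < 1/2 then (x / (1 - x), mob 1 0 (-1) 1 y)
     else if x \<le> 1 / (1 + \<alpha>) then ((1 - 2 * x) / x, mob (-2) 1 1 0 y)
     else ((1 - x) / x, mob (-1) 1 1 0 y))"

section \<open>The set D and the map psi\<close>

text \<open>
  \<open>D \<alpha> \<subseteq> V1\<close> holds exactly, but \<open>D \<alpha> = V1\<close> only up to a null set: if \<open>0 \<le> x < \<alpha>\<close> then
  \<open>(x, 0) \<in> V1\<close> is not in \<open>D \<alpha>\<close>, because \<open>D1 \<alpha>\<close> lies over \<open>[\<alpha>, 1)\<close>, second coordinates in
  \<open>Omega_star \<alpha>\<close> are at most \<open>-1\<close>, and those in \<open>Upsilon_inv \<alpha>\<close> are reciprocals of real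
  numbers, hence nonzero.
\<close>

definition V_minus :: "real \<Rightarrow> (real \<times> ereal) set" where
  "V_minus \<alpha> = {(x, y) \<in> V_flat \<alpha>. x < 0}"

definition V_plus :: "real \<Rightarrow> (real \<times> ereal) set" where
  "V_plus \<alpha> = {(x, y) \<in> V_flat \<alpha>. x \<ge> 0}"

definition D1 :: "real \<Rightarrow> (real \<times> ereal) set" where
  "D1 \<alpha> = shift 1 (V_minus \<alpha>)"

definition D2 :: "real \<Rightarrow> (real \<times> ereal) set" where
  "D2 \<alpha> = V_plus \<alpha> - D1 \<alpha>"

definition D :: "real \<Rightarrow> (real \<times> ereal) set" where
  "D \<alpha> = D1 \<alpha> \<union> D2 \<alpha>"

definition psi :: "real \<Rightarrow> real \<times> ereal \<Rightarrow> real \<times> ereal" where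
  "psi \<alpha> = (\<lambda>(x, y). if (x, y) \<in> D1 \<alpha> then (x - 1, y - 1) else (x, y))"

section \<open>Measures and metric isomorphism\<close>

definition plane_lborel :: "(real \<times> ereal) measure" where
  "plane_lborel = distr (lborel :: (real \<times> real) measure) borel (\<lambda>(x, y). (x, ereal y))"

definition mu_hat :: "(real \<times> ereal) set \<Rightarrow> (real \<times> ereal) measure" where
  "mu_hat S = density (restrict_space plane_lborel S)
     (\<lambda>(x, y). ennreal (1 / (x - real_of_ereal y)\<^sup>2))"

definition measure_preserving_map :: "'a measure \<Rightarrow> 'b measure \<Rightarrow> ('a \<Rightarrow> 'b) \<Rightarrow> bool" where
  "measure_preserving_map M N f \<longleftrightarrow> f \<in> M \<rightarrow>\<^sub>M N \<and> distr M N f = N"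

text \<open>
  Isomorphism of measure-preserving systems \<open>(M, T)\<close> and \<open>(N, S)\<close>: off null sets, \<open>T\<close> and \<open>S\<close> are
  self-maps preserving the measures, and \<open>\<phi>\<close> is an invertible measure-preserving conjugacy.
  Invariance of \<open>X\<close> under \<open>T\<close> and of \<open>Y\<close> under \<open>S\<close> is part of measurability
  between the restricted spaces.
\<close>

definition metric_isomorphism ::
  "'a measure \<Rightarrow> ('a \<Rightarrow> 'a) \<Rightarrow> 'b measure \<Rightarrow> ('b \<Rightarrow> 'b) \<Rightarrow> ('a \<Rightarrow> 'b) \<Rightarrow> bool" where
  "metric_isomorphism M T N S \<phi> \<longleftrightarrow>
     (\<exists>X Y. X \<in> sets M \<and> space M - X \<in> null_sets M \<and>
            Y \<in> sets N \<and> space N - Y \<in> null_sets N \<and>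
            measure_preserving_map (restrict_space M X) (restrict_space M X) T \<and>
            measure_preserving_map (restrict_space N Y) (restrict_space N Y) S \<and>
            bij_betw \<phi> X Y \<and>
            measure_preserving_map (restrict_space M X) (restrict_space N Y) \<phi> \<and>
            measure_preserving_map (restrict_space N Y) (restrict_space M X) (inv_into X \<phi>) \<and>
            (\<forall>p\<in>X. \<phi> (T p) = S (\<phi> p)))"

end

theory Submission
  imports Defs
begin

text \<open>
  Write \<open>F\<close> for the planar Farey map and \<open>F\<^sub>\<flat>\<close> for the one on \<open>V_flat \<alpha>\<close>. Translating the points with
  \<open>x < 0\<close> by \<open>(1, 1)\<close> gives a map \<open>\<pi>\<close> from \<open>V_flat \<alpha>\<close> to \<open>V1\<close>, and branch by branch \<open>F\<^sub>\<flat>\<close> equals \<open>F\<close> or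
  \<open>F - (1, 1)\<close>, so \<open>\<pi>\<close> is a semiconjugacy. It remains to see that almost every point has exactly one
  preimage under \<open>\<pi>\<close>.

  Existence: over \<open>(x, -\<infinity>)\<close> there is always a lift, since \<open>Omega \<alpha>\<close> contains all \<open>(x, 0)\<close>. Applying
  \<open>F\<^sup>n\<close> to such points over \<open>F\<^sup>-\<^sup>n(x, y)\<close> gives points of the image of \<open>\<pi>\<close> on the vertical line through \<open>x\<close>
  that converge to \<open>(x, y)\<close>, because the inverse branches contract in \<open>y\<close>; the fibres are closed.

  Uniqueness: the set of points with two lifts is forward invariant under \<open>F\<close>. If such a point has
  \<open>x > 1 / (1 + \<alpha>)\<close>, then \<open>F\<^sub>\<flat>\<close> identifies its lifts, which produces a point of \<open>Omega \<alpha>\<close> with two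
  predecessors under \<open>Gauss_ext \<alpha>\<close>; these form a null set because \<open>Gauss_ext \<alpha>\<close> is piecewise measure
  preserving and onto a set of finite measure. So almost every point with two lifts has a Farey orbit
  that avoids \<open>x > 1 / (1 + \<alpha>)\<close>, hence bounded continued fraction digits; such points form a null set.
\<close>

section \<open>Moebius maps and the invariant measure\<close>

text \<open>\<open>Omega \<alpha>\<close> is given only as a closure of orbits, without an explicit
  shape, so neither covering nor disjointness can be read off from inequalities; both come from its
  forward and backward invariance under \<open>Gauss_ext \<alpha>\<close>. The measure with density
  1 / (x - y)^2 has infinite mass on \<open>V1\<close>, so comparing the masses of \<open>V1\<close>
  and \<open>V_flat \<alpha>\<close> says nothing about points with two lifts. Finite mass is
  available where y \<le> -1, and both mass comparisons take place there: one on
  \<open>Omega_star \<alpha>\<close>, the other for the Gauss map on orbits with bounded digits.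
  Each shows that a map which loses no mass leaves no room for an overlap or for a part outside its
  image.\<close>

lemma image_in_closure:
  fixes f :: "'a::metric_space \<Rightarrow> 'b::metric_space"
  assumes "p \<in> closure A" "isCont f p" "f ` A \<subseteq> B"
  shows "f p \<in> closure B"
proof -
  obtain s where s: "\<And>n. s n \<in> A" "s \<longlonglongrightarrow> p"
    using assms(1) by (auto simp: closure_sequential)
  have "(\<lambda>n. f (s n)) \<longlonglongrightarrow> f p"
    using assms(2) s(2) by (rule isCont_tendsto_compose)
  moreover have "f (s n) \<in> B" for n using s assms(3) by blast
  ultimately show ?thesis
    unfolding closure_sequential by (intro exI[of _ "\<lambda>n. f (s n)"]) simp
qed

lemma closure_UN_finite: "finite I \<Longrightarrow> closure (\<Union>i\<in>I. A i) = (\<Union>i\<in>I. closure (A i))"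
  by (induction I rule: finite_induct) auto

text \<open>The map -1/x is taken rather than 1/x because it is increasing on each half-line, as the
  substitution rule requires. Substitution settles compact intervals away from 0, and these exhaust
  the reals up to one point.\<close>

lemma distr_neg_inverse_lborel:
  "distr (density lborel (\<lambda>x. ennreal (1 / x\<^sup>2))) borel (\<lambda>x. - 1 / x) = (lborel :: real measure)"
  (is "?N = _")
proof (rule measure_eqI)
  fix A :: "real set" assume "A \<in> sets ?N"
  then have A [measurable]: "A \<in> sets borel" by simp
  have eq: "emeasure ?N B = (\<integral>\<^sup>+x. ennreal (1 / x\<^sup>2) * indicator B (- 1 / x) \<partial>lborel)"
    if [measurable]: "B \<in> sets borel" for B
  proof -
    have [measurable]: "(\<lambda>x::real. - 1 / x) -` B \<in> sets borel"
      using measurable_sets[of "\<lambda>x::real. - 1 / x" borel borel B] by simp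
    show ?thesis
      by (subst emeasure_distr) (auto simp: emeasure_density intro!: nn_integral_cong
          split: split_indicator)
  qed
  have piece: "emeasure ?N (A \<inter> {l..u}) = emeasure lborel (A \<inter> {l..u})"
    if lu: "l \<le> u" "0 < l \<or> u < 0" for l u
  proof -
    let ?a = "- 1 / l" and ?b = "- 1 / u"
    have ab: "?a \<le> ?b" using lu by (auto simp: field_simps)
    have nz: "x \<noteq> 0" if "x \<in> {?a..?b}" for x
      using that lu by (auto simp: divide_simps split: if_splits)
    have iff: "- 1 / x \<in> {l..u} \<longleftrightarrow> x \<in> {?a..?b}" if "x \<noteq> 0" for x
    proof -
      have "0 < l \<Longrightarrow> 0 < x \<Longrightarrow> - 1 / x < 0 \<and> - 1 / u < 0" "u < 0 \<Longrightarrow> x < 0 \<Longrightarrow> 0 < - 1 / x \<and> 0 < - 1 / l"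
        using lu by (auto simp: divide_neg_pos divide_neg_neg)
      then have "0 < l \<Longrightarrow> 0 < x \<Longrightarrow> ?thesis" "u < 0 \<Longrightarrow> x < 0 \<Longrightarrow> ?thesis"
        using lu unfolding atLeastAtMost_iff by linarith+
      moreover have "0 < l \<Longrightarrow> x < 0 \<Longrightarrow> ?thesis" "u < 0 \<Longrightarrow> 0 < x \<Longrightarrow> ?thesis"
        using lu by (auto simp: field_simps)
      ultimately show ?thesis using lu that by linarith
    qed
    have "emeasure lborel (A \<inter> {l..u}) = (\<integral>\<^sup>+x. indicator (A \<inter> {l..u}) x \<partial>lborel)"
      by (subst nn_integral_indicator) auto
    also have "\<dots> = (\<integral>\<^sup>+x. ennreal (indicator A x * indicator {- 1 / ?a..- 1 / ?b} x) \<partial>lborel)"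
      using lu by (intro nn_integral_cong) (auto split: split_indicator)
    also have "\<dots> = (\<integral>\<^sup>+x. ennreal (indicator A (- 1 / x) * (1 / x\<^sup>2) * indicator {?a..?b} x) \<partial>lborel)"
    proof (rule nn_integral_substitution[OF _ _ _ _ ab])
      show "((\<lambda>x. - 1 / x) has_real_derivative 1 / x\<^sup>2) (at x)" if "x \<in> {?a..?b}" for x
        using nz[OF that] by (auto intro!: derivative_eq_intros simp: power2_eq_square)
      show "continuous_on {?a..?b} (\<lambda>x. 1 / x\<^sup>2)"
        using nz by (intro continuous_intros) auto
      show "set_borel_measurable borel {- 1 / ?a..- 1 / ?b} (indicator A :: real \<Rightarrow> real)"
        unfolding set_borel_measurable_def by simp
    qed simp
    also have "\<dots> = (\<integral>\<^sup>+x. ennreal (1 / x\<^sup>2) * indicator (A \<inter> {l..u}) (- 1 / x) \<partial>lborel)"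
    proof (rule nn_integral_cong)
      fix x :: real
      show "ennreal (indicator A (- 1 / x) * (1 / x\<^sup>2) * indicator {?a..?b} x) =
          ennreal (1 / x\<^sup>2) * indicator (A \<inter> {l..u}) (- 1 / x)"
        using iff[of x] by (cases "x = 0") (auto split: split_indicator)
    qed
    also have "\<dots> = emeasure ?N (A \<inter> {l..u})" by (subst eq) auto
    finally show ?thesis ..
  qed
  let ?I = "\<lambda>n. A \<inter> {- (real n + 1)..- 1 / (real n + 1)}"
  let ?J = "\<lambda>n. A \<inter> {1 / (real n + 1)..real n + 1}"
  let ?C = "\<lambda>n. ?I n \<union> ?J n"
  have ne: "- 1 / (real n + 1) < 0" "0 < 1 / (real n + 1)" for n by (simp_all add: divide_neg_pos)
  have disj: "?I n \<inter> ?J n = {}" for n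
  proof -
    have False if "x \<in> ?I n" "x \<in> ?J n" for x
      using that ne[of n] unfolding Int_iff atLeastAtMost_iff by linarith
    then show ?thesis by blast
  qed
  have un: "emeasure ?N (?C n) = emeasure lborel (?C n)" for n
  proof -
    have "emeasure ?N (?I n) = emeasure lborel (?I n)" "emeasure ?N (?J n) = emeasure lborel (?J n)"
      by (intro piece; simp add: field_simps)+
    then show ?thesis using plus_emeasure[of "?I n" ?N "?J n"] plus_emeasure[of "?I n" lborel "?J n"] disj[of n]
      by simp
  qed
  have inc: "incseq ?C"
    unfolding incseq_def
  proof (intro allI impI)
    fix m n :: nat assume "m \<le> n"
    then have "1 / (real n + 1) \<le> 1 / (real m + 1)" "real m \<le> real n" by (auto simp: field_simps)
    then show "?C m \<le> ?C n" by auto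
  qed
  have UC: "(\<Union>n. ?C n) = A - {0}"
  proof (intro equalityI subsetI)
    fix x assume x: "x \<in> A - {0}"
    obtain n where n: "max \<bar>x\<bar> (1 / \<bar>x\<bar>) \<le> real n" using real_arch_simple by blast
    then have "1 / (real n + 1) \<le> \<bar>x\<bar>" "\<bar>x\<bar> \<le> real n + 1"
      using x by (auto simp: field_simps)
    then have "x \<in> ?C n" using x by (cases "x < 0") auto
    then show "x \<in> (\<Union>n. ?C n)" by blast
  next
    fix x assume "x \<in> (\<Union>n. ?C n)"
    then obtain n where "x \<in> ?C n" by blast
    then show "x \<in> A - {0}" using ne[of n] by auto
  qed
  have "emeasure ?N (A - {0}) = (SUP n. emeasure ?N (?C n))"
    unfolding UC[symmetric] using inc by (intro SUP_emeasure_incseq[symmetric]) auto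
  also have "\<dots> = (SUP n. emeasure lborel (?C n))" by (simp only: un)
  also have "\<dots> = emeasure lborel (A - {0})"
    unfolding UC[symmetric] using inc by (intro SUP_emeasure_incseq) auto
  finally have "emeasure ?N (A - {0}) = emeasure lborel (A - {0})" .
  moreover have "emeasure ?N (A - {0}) = emeasure ?N A"
  proof (rule emeasure_Diff_null_set)
    \<comment> \<open>The integrand vanishes identically: -1/x = 0 happens only at x = 0, where the
      density 1/0 is 0 by convention.\<close>
    have "emeasure ?N {0} = (\<integral>\<^sup>+x. 0 \<partial>(lborel :: real measure))"
      by (subst eq, simp, intro nn_integral_cong) (auto split: split_indicator)
    then show "{0} \<in> null_sets ?N" by (intro null_setsI) auto
  qed simp
  moreover have "emeasure lborel (A - {0}) = emeasure lborel A"
    by (rule emeasure_Diff_null_set) auto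
  ultimately show "emeasure ?N A = emeasure lborel A" by simp
qed simp

lemma nn_integral_neg_inverse:
  fixes g :: "real \<Rightarrow> ennreal"
  assumes [measurable]: "g \<in> borel_measurable borel"
  shows "(\<integral>\<^sup>+x. ennreal (1 / x\<^sup>2) * g (- 1 / x) \<partial>lborel) = (\<integral>\<^sup>+x. g x \<partial>lborel)"
proof -
  have "(\<integral>\<^sup>+x. g x \<partial>lborel) =
      (\<integral>\<^sup>+x. g x \<partial>distr (density lborel (\<lambda>x. ennreal (1 / x\<^sup>2))) borel (\<lambda>x. - 1 / x))"
    by (simp only: distr_neg_inverse_lborel)
  also have "\<dots> = (\<integral>\<^sup>+x. ennreal (1 / x\<^sup>2) * g (- 1 / x) \<partial>lborel)"
    by (subst nn_integral_distr) (auto simp: nn_integral_density)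
  finally show ?thesis ..
qed

section \<open>The measure dx dy / (x - y)^2 and its invariance under Moebius maps\<close>

definition hyp_measure :: "(real \<times> real) measure" where
  "hyp_measure = density lborel (\<lambda>(x, y). ennreal (1 / (x - y)\<^sup>2))"

lemma hyp_density_measurable [measurable]:
  "(\<lambda>(x, y). ennreal (1 / (x - y)\<^sup>2)) \<in> borel_measurable (borel :: (real \<times> real) measure)"
  unfolding borel_prod[symmetric] by measurable

lemma sets_hyp [simp, measurable_cong]: "sets hyp_measure = sets borel"
  and space_hyp [simp]: "space hyp_measure = UNIV"
  by (simp_all add: hyp_measure_def)

lemma emeasure_hyp:
  assumes [measurable]: "A \<in> sets borel"
  shows "emeasure hyp_measure A =
    (\<integral>\<^sup>+x. \<integral>\<^sup>+y. ennreal (1 / (x - y)\<^sup>2) * indicator A (x, y) \<partial>lborel \<partial>lborel)"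
proof -
  have [measurable]: "A \<in> sets (lborel \<Otimes>\<^sub>M lborel)" using assms unfolding lborel_prod by simp
  have "emeasure hyp_measure A =
      (\<integral>\<^sup>+p. ennreal (1 / (fst p - snd p)\<^sup>2) * indicator A p \<partial>(lborel \<Otimes>\<^sub>M lborel))"
    unfolding hyp_measure_def lborel_prod using hyp_density_measurable assms
    by (subst emeasure_density) (auto simp: split_beta)
  also have "\<dots> = (\<integral>\<^sup>+x. \<integral>\<^sup>+y. ennreal (1 / (x - y)\<^sup>2) * indicator A (x, y) \<partial>lborel \<partial>lborel)"
    by (subst lborel.nn_integral_fst[symmetric]) auto
  finally show ?thesis .
qed

text \<open>Stated with preimages under total functions on the reals, so that compositions need no
  domain conditions. The artificial value 1/0 = 0 at a pole affects only a null set of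
  lines.\<close>

definition preserves :: "(real \<Rightarrow> real) \<Rightarrow> bool" where
  "preserves \<phi> \<longleftrightarrow> \<phi> \<in> borel_measurable borel \<and>
     (\<forall>A\<in>sets borel. emeasure hyp_measure (map_prod \<phi> \<phi> -` A) = emeasure hyp_measure A)"

lemma measurable_map_prod:
  assumes [measurable]: "\<phi> \<in> borel_measurable (borel :: real measure)"
  shows "map_prod \<phi> \<phi> \<in> (borel :: (real \<times> real) measure) \<rightarrow>\<^sub>M (borel :: (real \<times> real) measure)"
  unfolding map_prod_def borel_prod[symmetric] by measurable

lemma vimage_map_prod_sets:
  assumes "\<phi> \<in> borel_measurable (borel :: real measure)" "A \<in> sets (borel :: (real \<times> real) measure)"
  shows "map_prod \<phi> \<phi> -` A \<in> sets borel"
  using measurable_sets[OF measurable_map_prod[OF assms(1)] assms(2)] by simp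

lemma preserves_vimage_sets:
  assumes "preserves \<phi>" "A \<in> sets borel"
  shows "map_prod \<phi> \<phi> -` A \<in> sets borel"
  using vimage_map_prod_sets assms by (simp add: preserves_def)

lemma preserves_emeasure:
  "preserves \<phi> \<Longrightarrow> A \<in> sets borel \<Longrightarrow> emeasure hyp_measure (map_prod \<phi> \<phi> -` A) = emeasure hyp_measure A"
  by (simp add: preserves_def)

lemma preserves_comp:
  assumes "preserves \<phi>" "preserves \<theta>"
  shows "preserves (\<lambda>x. \<phi> (\<theta> x))"
proof -
  have [measurable]: "\<phi> \<in> borel_measurable borel" "\<theta> \<in> borel_measurable borel"
    using assms by (simp_all add: preserves_def)
  have "map_prod (\<lambda>x. \<phi> (\<theta> x)) (\<lambda>x. \<phi> (\<theta> x)) -` A = map_prod \<theta> \<theta> -` (map_prod \<phi> \<phi> -` A)" for A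
    by auto
  then show ?thesis
    using assms preserves_vimage_sets[OF assms(1)] unfolding preserves_def by simp
qed

lemma preserves_add: "preserves (\<lambda>x. x + c)"
  unfolding preserves_def
proof safe
  fix A :: "(real \<times> real) set" assume A [measurable]: "A \<in> sets borel"
  have [measurable]: "A \<in> sets (borel \<Otimes>\<^sub>M borel)" using A unfolding borel_prod .
  have "map_prod (\<lambda>x. x + c) (\<lambda>x. x + c) -` A \<in> sets borel"
    by (rule vimage_map_prod_sets) simp_all
  then have "emeasure hyp_measure (map_prod (\<lambda>x. x + c) (\<lambda>x. x + c) -` A) =
      (\<integral>\<^sup>+x. \<integral>\<^sup>+y. ennreal (1 / (x - y)\<^sup>2) * indicator A (x + c, y + c) \<partial>lborel \<partial>lborel)"
    by (subst emeasure_hyp) (auto intro!: nn_integral_cong split: split_indicator)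
  also have "\<dots> = (\<integral>\<^sup>+x. \<integral>\<^sup>+y. ennreal (1 / ((x + c) - y)\<^sup>2) * indicator A (x + c, y) \<partial>lborel \<partial>lborel)"
  proof (rule nn_integral_cong)
    fix x :: real
    show "(\<integral>\<^sup>+y. ennreal (1 / (x - y)\<^sup>2) * indicator A (x + c, y + c) \<partial>lborel) =
        (\<integral>\<^sup>+y. ennreal (1 / ((x + c) - y)\<^sup>2) * indicator A (x + c, y) \<partial>lborel)"
      by (subst (2) nn_integral_real_affine[where c = 1 and t = c]) (auto simp: add.commute)
  qed
  also have "\<dots> = emeasure hyp_measure A"
    by (subst emeasure_hyp[OF A], subst (2) nn_integral_real_affine[where c = 1 and t = c])
      (auto simp: add.commute)
  finally show "emeasure hyp_measure (map_prod (\<lambda>x. x + c) (\<lambda>x. x + c) -` A) = emeasure hyp_measure A" .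
qed simp

lemma preserves_uminus: "preserves (\<lambda>x. - x)"
  unfolding preserves_def
proof safe
  fix A :: "(real \<times> real) set" assume A [measurable]: "A \<in> sets borel"
  have [measurable]: "A \<in> sets (borel \<Otimes>\<^sub>M borel)" using A unfolding borel_prod .
  have "map_prod uminus uminus -` A \<in> sets borel"
    by (rule vimage_map_prod_sets) simp_all
  then have "emeasure hyp_measure (map_prod uminus uminus -` A) =
      (\<integral>\<^sup>+x. \<integral>\<^sup>+y. ennreal (1 / (x - y)\<^sup>2) * indicator A (- x, - y) \<partial>lborel \<partial>lborel)"
    by (subst emeasure_hyp) (auto intro!: nn_integral_cong split: split_indicator)
  also have "\<dots> = (\<integral>\<^sup>+x. \<integral>\<^sup>+y. ennreal (1 / ((- x) - y)\<^sup>2) * indicator A (- x, y) \<partial>lborel \<partial>lborel)"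
  proof (rule nn_integral_cong)
    fix x :: real
    show "(\<integral>\<^sup>+y. ennreal (1 / (x - y)\<^sup>2) * indicator A (- x, - y) \<partial>lborel) =
        (\<integral>\<^sup>+y. ennreal (1 / ((- x) - y)\<^sup>2) * indicator A (- x, y) \<partial>lborel)"
      by (subst (2) nn_integral_real_affine[where c = "-1" and t = 0])
        (auto simp: power2_commute[of x])
  qed
  also have "\<dots> = emeasure hyp_measure A"
    by (subst emeasure_hyp[OF A], subst (2) nn_integral_real_affine[where c = "-1" and t = 0]) auto
  finally show "emeasure hyp_measure (map_prod uminus uminus -` A) = emeasure hyp_measure A" .
qed simp

lemma preserves_neg_inverse: "preserves (\<lambda>x. - 1 / x)"
  unfolding preserves_def
proof safe
  fix A :: "(real \<times> real) set" assume A [measurable]: "A \<in> sets borel"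
  have [measurable]: "A \<in> sets (borel \<Otimes>\<^sub>M borel)" using A unfolding borel_prod .
  let ?f = "\<lambda>x y. ennreal (1 / (x - y)\<^sup>2) * indicator A (x, y)"
  have "map_prod (\<lambda>x. - 1 / x) (\<lambda>x. - 1 / x) -` A \<in> sets borel"
    by (rule vimage_map_prod_sets) simp_all
  then have "emeasure hyp_measure (map_prod (\<lambda>x. - 1 / x) (\<lambda>x. - 1 / x) -` A) =
      (\<integral>\<^sup>+x. \<integral>\<^sup>+y. ennreal (1 / (x - y)\<^sup>2) * indicator A (- 1 / x, - 1 / y) \<partial>lborel \<partial>lborel)"
    by (subst emeasure_hyp, assumption) (auto intro!: nn_integral_cong split: split_indicator)
  also have "\<dots> = (\<integral>\<^sup>+x. ennreal (1 / x\<^sup>2) * (\<integral>\<^sup>+y. ennreal (1 / y\<^sup>2) * ?f (- 1 / x) (- 1 / y) \<partial>lborel) \<partial>lborel)"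
  proof (rule nn_integral_cong_AE, rule AE_mp[OF AE_lborel_singleton[of 0]], rule AE_I2, rule impI)
    fix x :: real assume x: "x \<noteq> 0"
    have "(\<integral>\<^sup>+y. ennreal (1 / (x - y)\<^sup>2) * indicator A (- 1 / x, - 1 / y) \<partial>lborel) =
        (\<integral>\<^sup>+y. ennreal (1 / x\<^sup>2) * (ennreal (1 / y\<^sup>2) * ?f (- 1 / x) (- 1 / y)) \<partial>lborel)"
    proof (rule nn_integral_cong_AE, rule AE_mp[OF AE_lborel_singleton[of 0]], rule AE_I2, rule impI)
      fix y :: real assume y: "y \<noteq> 0"
      \<comment> \<open>After squaring, the factor (x y)^2 cancels the derivatives 1/x^2 and 1/y^2
        of the two one-dimensional substitutions; this is the whole invariance.\<close>
      have "(- 1 / x) - (- 1 / y) = (x - y) / (x * y)"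
        using x y by (simp add: field_simps)
      then have "1 / (x - y)\<^sup>2 = 1 / x\<^sup>2 * (1 / y\<^sup>2 * (1 / ((- 1 / x) - (- 1 / y))\<^sup>2))"
        using x y by (simp only:) (simp add: power_divide power_mult_distrib)
      then show "ennreal (1 / (x - y)\<^sup>2) * indicator A (- 1 / x, - 1 / y) =
          ennreal (1 / x\<^sup>2) * (ennreal (1 / y\<^sup>2) * ?f (- 1 / x) (- 1 / y))"
        by (simp only: mult.assoc[symmetric]) (simp add: ennreal_mult'[symmetric])
    qed
    also have "\<dots> = ennreal (1 / x\<^sup>2) * (\<integral>\<^sup>+y. ennreal (1 / y\<^sup>2) * ?f (- 1 / x) (- 1 / y) \<partial>lborel)"
      by (subst nn_integral_cmult) auto
    finally show "(\<integral>\<^sup>+y. ennreal (1 / (x - y)\<^sup>2) * indicator A (- 1 / x, - 1 / y) \<partial>lborel) =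
        ennreal (1 / x\<^sup>2) * (\<integral>\<^sup>+y. ennreal (1 / y\<^sup>2) * ?f (- 1 / x) (- 1 / y) \<partial>lborel)" .
  qed
  also have "\<dots> = (\<integral>\<^sup>+x. ennreal (1 / x\<^sup>2) * (\<integral>\<^sup>+y. ?f (- 1 / x) y \<partial>lborel) \<partial>lborel)"
    by (subst nn_integral_neg_inverse) auto
  also have "\<dots> = (\<integral>\<^sup>+x. \<integral>\<^sup>+y. ?f x y \<partial>lborel \<partial>lborel)"
    by (subst nn_integral_neg_inverse[of "\<lambda>x. \<integral>\<^sup>+y. ?f x y \<partial>lborel"]) auto
  also have "\<dots> = emeasure hyp_measure A" by (simp add: emeasure_hyp)
  finally show "emeasure hyp_measure (map_prod (\<lambda>x. - 1 / x) (\<lambda>x. - 1 / x) -` A) = emeasure hyp_measure A" .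
qed simp

lemma preserves_inverse: "preserves (\<lambda>x. 1 / x)"
  using preserves_comp[OF preserves_uminus preserves_neg_inverse] by simp

lemma preserves_diff: "preserves (\<lambda>x. x - c)"
  using preserves_add[of "-c"] by simp

text \<open>The density is positive off the diagonal; only at x = y is it 0, by the convention 1/0 =
  0.\<close>

lemma null_sets_hyp_iff:
  assumes "N \<in> sets borel" "\<And>x y. (x, y) \<in> N \<Longrightarrow> x \<noteq> y"
  shows "emeasure hyp_measure N = 0 \<longleftrightarrow> emeasure lborel N = 0"
proof -
  have "N \<in> null_sets hyp_measure \<longleftrightarrow> (AE p in lborel. p \<in> N \<longrightarrow> (\<lambda>(x, y). ennreal (1 / (x - y)\<^sup>2)) p = 0)"
    unfolding hyp_measure_def using assms(1) hyp_density_measurable by (subst null_sets_density_iff) auto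
  also have "\<dots> \<longleftrightarrow> (AE p in lborel. p \<notin> N)"
    using assms(2) by (intro AE_cong) (auto simp: ennreal_eq_0_iff)
  also have "\<dots> \<longleftrightarrow> N \<in> null_sets lborel"
    using AE_iff_null_sets[of N lborel] assms(1) by simp
  finally show ?thesis using assms(1) by (auto simp: null_sets_def)
qed

text \<open>Integrating over y \<le> -1 leaves 1 / (x + 1), which is bounded because a > -1 keeps
  the strip away from the diagonal point (-1, -1). With a = \<alpha> - 1 this makes the mass of
  \<open>Omega_star \<alpha>\<close> finite.\<close>

lemma emeasure_hyp_strip_finite:
  assumes "-1 < a"
  shows "emeasure hyp_measure ({a..b} \<times> {..-1}) < \<infinity>"
proof -
  have meas: "{a..b} \<times> {..-1} \<in> sets (borel :: (real \<times> real) measure)" by (simp add: borel_prod[symmetric])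
  have "emeasure hyp_measure ({a..b} \<times> {..-1}) =
      (\<integral>\<^sup>+x. (\<integral>\<^sup>+y. ennreal (1 / (x - y)\<^sup>2) * indicator {..-1} y \<partial>lborel) * indicator {a..b} x \<partial>lborel)"
    by (subst emeasure_hyp[OF meas]) (auto intro!: nn_integral_cong split: split_indicator)
  also have "\<dots> \<le> (\<integral>\<^sup>+x. ennreal (1 / (1 + a)) * indicator {a..b} x \<partial>lborel)"
  proof (intro nn_integral_mono)
    fix x :: real
    have "(\<integral>\<^sup>+y. ennreal (1 / (x - y)\<^sup>2) * indicator {..-1} y \<partial>lborel) \<le> ennreal (1 / (1 + a))" if x: "a \<le> x"
    proof -
      have "(\<integral>\<^sup>+y. ennreal (1 / (x - y)\<^sup>2) * indicator {..-1} y \<partial>lborel) =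
          (\<integral>\<^sup>+u. ennreal (1 / (x + u)\<^sup>2) * indicator {1..} u \<partial>lborel)"
        by (subst nn_integral_real_affine[where c = "-1" and t = 0])
          (auto intro!: nn_integral_cong split: split_indicator)
      also have "\<dots> = ennreal (0 - - 1 / (x + 1))"
      proof (rule nn_integral_FTC_atLeast[where F = "\<lambda>u. - 1 / (x + u)" and T = 0])
        show "((\<lambda>u. - 1 / (x + u)) has_real_derivative 1 / (x + u)\<^sup>2) (at u)" if "1 \<le> u" for u
          using that x assms by (auto intro!: derivative_eq_intros simp: power2_eq_square)
        show "((\<lambda>u. - 1 / (x + u)) \<longlongrightarrow> 0) at_top"
          by (intro tendsto_divide_0[OF tendsto_const] filterlim_at_top_imp_at_infinity
              filterlim_tendsto_add_at_top[OF tendsto_const] filterlim_ident)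
      qed auto
      also have "\<dots> \<le> ennreal (1 / (1 + a))"
        using x assms by (intro ennreal_leI) (auto simp: field_simps)
      finally show ?thesis .
    qed
    then show "(\<integral>\<^sup>+y. ennreal (1 / (x - y)\<^sup>2) * indicator {..-1} y \<partial>lborel) * indicator {a..b} x \<le>
        ennreal (1 / (1 + a)) * indicator {a..b} x"
      by (auto split: split_indicator)
  qed
  also have "\<dots> = ennreal (1 / (1 + a)) * emeasure lborel {a..b}"
    by (simp add: nn_integral_cmult_indicator)
  also have "\<dots> < \<infinity>" by (simp add: ennreal_mult_less_top emeasure_lborel_Icc_eq)
  finally show ?thesis .
qed

text \<open>Both mass comparisons end here, with a finite mass a and the mass b that is to be
  excluded.\<close>

lemma ennreal_add_le_imp_zero:
  fixes a b :: ennreal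
  assumes "a + b \<le> a" "a < \<infinity>"
  shows "b = 0"
  using assms ennreal_add_left_cancel_le[of a b 0] by auto

section \<open>The extended plane and the measures \<open>plane_lborel\<close> and
  \<open>mu_hat\<close>\<close>

lemma mob_neg_inverse_ereal: "mob 0 (-1) 1 0 (ereal y) = (if y = 0 then -\<infinity> else ereal (- 1 / y))"
  and mob_inverse_ereal: "mob 0 1 1 0 (ereal y) = (if y = 0 then -\<infinity> else ereal (1 / y))"
  by (simp_all add: mob_def)

lemma shift_iff: "(x, y) \<in> shift c S \<longleftrightarrow> (x - c, y - ereal c) \<in> S"
proof
  assume "(x, y) \<in> shift c S"
  then obtain x' y' where "(x', y') \<in> S" "x = x' + c" "y = y' + ereal c"
    unfolding shift_def by auto
  then show "(x - c, y - ereal c) \<in> S" by (cases y') auto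
next
  assume "(x - c, y - ereal c) \<in> S"
  moreover have "(x, y) = (\<lambda>(x, y). (x + c, y + ereal c)) (x - c, y - ereal c)" by (cases y) auto
  ultimately show "(x, y) \<in> shift c S" unfolding shift_def by blast
qed

lemma borel_mob [measurable]: "mob a b c d \<in> borel_measurable borel"
  unfolding mob_def by measurable

text \<open>Measures are computed in the real plane and transported by \<open>emb\<close>. The line
  at -\<infinity> is outside its range, hence null for \<open>plane_lborel\<close>.\<close>

definition emb :: "real \<times> real \<Rightarrow> real \<times> ereal" where
  "emb = (\<lambda>(x, y). (x, ereal y))"

lemma emb_pair [simp]: "emb (x, y) = (x, ereal y)"
  by (simp add: emb_def)

lemma emb_measurable [measurable]: "emb \<in> borel \<rightarrow>\<^sub>M borel"
  unfolding emb_def borel_prod[symmetric] by measurable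

lemma plane_lborel_emb: "plane_lborel = distr lborel borel emb"
  by (simp add: plane_lborel_def emb_def)

lemma sets_plane [simp]: "sets plane_lborel = sets borel"
  and space_plane [simp]: "space plane_lborel = UNIV"
  by (simp_all add: plane_lborel_def)

lemma vimage_emb_sets: "B \<in> sets borel \<Longrightarrow> emb -` B \<in> sets borel"
  using measurable_sets[OF emb_measurable, of B] by simp

lemma emeasure_plane: "B \<in> sets borel \<Longrightarrow> emeasure plane_lborel B = emeasure lborel (emb -` B)"
  unfolding plane_lborel_emb by (subst emeasure_distr) auto

lemma sets_mu_hat_iff:
  assumes "S \<in> sets borel"
  shows "B \<in> sets (mu_hat S) \<longleftrightarrow> B \<subseteq> S \<and> B \<in> sets borel"
  using assms by (simp add: mu_hat_def sets_restrict_space_iff)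

lemma space_mu_hat [simp]: "space (mu_hat S) = S"
  by (simp add: mu_hat_def space_restrict_space)

lemma emeasure_mu_hat:
  assumes S: "S \<in> sets borel" and B: "B \<in> sets borel" "B \<subseteq> S"
  shows "emeasure (mu_hat S) B = emeasure hyp_measure (emb -` B)"
proof -
  let ?f = "\<lambda>(x, y). ennreal (1 / (x - real_of_ereal y)\<^sup>2)"
  have f [measurable]: "?f \<in> borel_measurable borel"
    unfolding borel_prod[symmetric] by measurable
  have f': "?f \<in> borel_measurable plane_lborel" using f by (simp cong: measurable_cong_sets)
  have "emeasure (mu_hat S) B = (\<integral>\<^sup>+p. ?f p * indicator B p \<partial>restrict_space plane_lborel S)"
    unfolding mu_hat_def using S B f'
    by (intro emeasure_density measurable_restrict_space1) (auto simp: sets_restrict_space_iff)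
  also have "\<dots> = (\<integral>\<^sup>+p. ?f p * indicator B p * indicator S p \<partial>plane_lborel)"
    using S by (intro nn_integral_restrict_space) simp
  also have "\<dots> = (\<integral>\<^sup>+p. ?f p * indicator B p \<partial>plane_lborel)"
    using B by (intro nn_integral_cong) (auto split: split_indicator)
  also have "\<dots> = (\<integral>\<^sup>+p. ?f (emb p) * indicator B (emb p) \<partial>lborel)"
    unfolding plane_lborel_emb using B f by (intro nn_integral_distr) auto
  also have "\<dots> = (\<integral>\<^sup>+p. (case p of (x, y) \<Rightarrow> ennreal (1 / (x - y)\<^sup>2)) * indicator (emb -` B) p \<partial>lborel)"
    by (intro nn_integral_cong) (auto simp: emb_def split: split_indicator)
  also have "\<dots> = emeasure hyp_measure (emb -` B)"
    unfolding hyp_measure_def using vimage_emb_sets[OF B(1)] hyp_density_measurable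
    by (intro emeasure_density[symmetric]) auto
  finally show ?thesis .
qed

lemma sets_restrict_mu_hat_iff:
  assumes "S \<in> sets borel" "X \<in> sets borel" "X \<subseteq> S"
  shows "B \<in> sets (restrict_space (mu_hat S) X) \<longleftrightarrow> B \<subseteq> X \<and> B \<in> sets borel"
  using assms by (subst sets_restrict_space_iff) (auto simp: sets_mu_hat_iff Int_absorb2)

text \<open>\<open>T\<close> need only agree on \<open>X\<close> with a Borel map \<open>T'\<close>.
  This covers the inverse of \<open>psi \<alpha>\<close> given by \<open>inv_into\<close>, which is
  known to equal \<open>unlift\<close> only on the range.\<close>

lemma measure_preserving_mapI:
  assumes S: "S \<in> sets borel" "X \<in> sets borel" "X \<subseteq> S" "S' \<in> sets borel" "Y \<in> sets borel" "Y \<subseteq> S'"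
    and T: "T' \<in> borel \<rightarrow>\<^sub>M borel" "\<And>p. p \<in> X \<Longrightarrow> T p = T' p" "\<And>p. p \<in> X \<Longrightarrow> T p \<in> Y"
    and eq: "\<And>B. B \<in> sets borel \<Longrightarrow> B \<subseteq> Y \<Longrightarrow>
      emeasure hyp_measure (emb -` (X \<inter> T -` B)) = emeasure hyp_measure (emb -` B)"
  shows "measure_preserving_map (restrict_space (mu_hat S) X) (restrict_space (mu_hat S') Y) T"
proof -
  let ?M = "restrict_space (mu_hat S) X" and ?N = "restrict_space (mu_hat S') Y"
  have space: "space ?M = X" "space ?N = Y" using S by (auto simp: space_restrict_space)
  have sM: "B \<in> sets ?M \<longleftrightarrow> B \<subseteq> X \<and> B \<in> sets borel" and sN: "B \<in> sets ?N \<longleftrightarrow> B \<subseteq> Y \<and> B \<in> sets borel" for B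
    using sets_restrict_mu_hat_iff S by blast+
  have pre: "X \<inter> T -` B \<in> sets borel" if "B \<in> sets borel" for B
  proof -
    have "X \<inter> T -` B = X \<inter> T' -` B" using T(2) by auto
    then show ?thesis using measurable_sets[OF T(1) that] S(2) by auto
  qed
  have emM: "emeasure ?M B = emeasure hyp_measure (emb -` B)" if "B \<subseteq> X" "B \<in> sets borel" for B
    using S that by (subst emeasure_restrict_space) (auto simp: sets_mu_hat_iff Int_absorb2 intro!: emeasure_mu_hat)
  have emN: "emeasure ?N B = emeasure hyp_measure (emb -` B)" if "B \<subseteq> Y" "B \<in> sets borel" for B
    using S that by (subst emeasure_restrict_space) (auto simp: sets_mu_hat_iff Int_absorb2 intro!: emeasure_mu_hat)
  have meas: "T \<in> ?M \<rightarrow>\<^sub>M ?N"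
  proof (rule measurableI)
    show "T p \<in> space ?N" if "p \<in> space ?M" for p using that T(3) by (simp add: space)
    show "T -` B \<inter> space ?M \<in> sets ?M" if "B \<in> sets ?N" for B
      using that pre[of B] by (simp add: space sM sN Int_commute)
  qed
  moreover have "distr ?M ?N T = ?N"
  proof (rule measure_eqI)
    fix B assume "B \<in> sets (distr ?M ?N T)"
    then have B: "B \<in> sets ?N" by simp
    then have "emeasure (distr ?M ?N T) B = emeasure ?M (X \<inter> T -` B)"
      using meas by (simp add: emeasure_distr space Int_commute)
    also have "\<dots> = emeasure ?N B"
      using B pre[of B] emM[of "X \<inter> T -` B"] emN[of B] eq[of B] by (simp add: sN)
    finally show "emeasure (distr ?M ?N T) B = emeasure ?N B" .
  qed simp
  ultimately show ?thesis by (simp add: measure_preserving_map_def)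
qed

text \<open>Plain absolute continuity; unlike the equivalence above it applies to sets that meet the
  diagonal, as \<open>V1\<close> does at the origin.\<close>

lemma hyp_null_if_lborel_null:
  assumes "N \<in> sets borel" "emeasure lborel N = 0"
  shows "emeasure hyp_measure N = 0"
proof -
  have "N \<in> null_sets lborel" using assms by auto
  then have "AE p in lborel. p \<notin> N" by (rule AE_not_in)
  then have "N \<in> null_sets hyp_measure"
    unfolding hyp_measure_def using assms(1) hyp_density_measurable
    by (subst null_sets_density_iff) auto
  then show ?thesis by auto
qed

lemma V1_borel: "V1 \<in> sets borel"
proof -
  have V1: "V1 = {0..1} \<times> {..0}" by (auto simp: V1_def)
  show ?thesis unfolding V1 by (simp add: borel_prod[symmetric])
qed

lemma Farey_measurable: "Farey \<in> borel \<rightarrow>\<^sub>M borel"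
  unfolding Farey_def borel_prod[symmetric] by measurable

lemma Farey_flat_measurable: "Farey_flat \<alpha> \<in> borel \<rightarrow>\<^sub>M borel"
  unfolding Farey_flat_def borel_prod[symmetric] by measurable

text \<open>The map \<pi> of the overview, extended to the whole plane so that it is Borel without
  reference to \<open>V_flat \<alpha>\<close>.\<close>

definition unlift :: "real \<times> ereal \<Rightarrow> real \<times> ereal" where
  "unlift = (\<lambda>(x, y). if x < 0 then (x + 1, y + 1) else (x, y))"

lemma unlift_measurable: "unlift \<in> borel \<rightarrow>\<^sub>M borel"
  unfolding unlift_def borel_prod[symmetric] by measurable

section \<open>The natural extension domain\<close>

locale alpha_cf =
  fixes \<alpha> :: real
  assumes \<alpha>_pos: "0 < \<alpha>" and \<alpha>_less_half: "\<alpha> < 1/2"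
begin

text \<open>A countable set that is stable under integral Moebius maps and contains the ends of all cylinders.
  Off \<open>K\<alpha>\<close> no boundary conventions matter.\<close>

definition K\<alpha> :: "real set" where
  "K\<alpha> = range (\<lambda>(a, b, c, d). (of_int a + of_int b * \<alpha>) / (of_int c + of_int d * \<alpha>))"

lemma countable_K: "countable K\<alpha>"
  unfolding K\<alpha>_def by simp

lemma K_I: "(of_int a + of_int b * \<alpha>) / (of_int c + of_int d * \<alpha>) \<in> K\<alpha>"
  unfolding K\<alpha>_def by (rule range_eqI[of _ _ "(a,b,c,d)"]) simp

lemma K_D:
  assumes "x \<in> K\<alpha>"
  shows "\<exists>a b c d. x = (of_int a + of_int b * \<alpha>) / (of_int c + of_int d * \<alpha>)"
  using assms unfolding K\<alpha>_def by auto

lemma of_int_in_K [simp]: "of_int n \<in> K\<alpha>"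
  using K_I[of n 0 1 0] by simp

lemma K_consts [simp]: "0 \<in> K\<alpha>" "1 \<in> K\<alpha>" "1/2 \<in> K\<alpha>" "\<alpha> \<in> K\<alpha>" "1 / (1 + \<alpha>) \<in> K\<alpha>"
  "of_nat k \<in> K\<alpha>"
  using K_I[of 0 0 1 0] K_I[of 1 0 1 0] K_I[of 1 0 2 0] K_I[of 0 1 1 0] K_I[of 1 0 1 1]
    of_int_in_K[of "int k"]
  by simp_all

lemma K_inverse: "1 / x \<in> K\<alpha> \<longleftrightarrow> x \<in> K\<alpha>"
proof -
  have "1 / x \<in> K\<alpha>" if x: "x \<in> K\<alpha>" for x
  proof -
    obtain a b c d where "x = (of_int a + of_int b * \<alpha>) / (of_int c + of_int d * \<alpha>)"
      using K_D[OF x] by blast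
    then have "1 / x = (of_int c + of_int d * \<alpha>) / (of_int a + of_int b * \<alpha>)" by simp
    then show ?thesis by (simp only: K_I)
  qed
  from this[of x] this[of "1/x"] show ?thesis by auto
qed

lemma K_uminus: "- x \<in> K\<alpha> \<longleftrightarrow> x \<in> K\<alpha>"
proof -
  have "- x \<in> K\<alpha>" if x: "x \<in> K\<alpha>" for x
  proof -
    obtain a b c d where "x = (of_int a + of_int b * \<alpha>) / (of_int c + of_int d * \<alpha>)"
      using K_D[OF x] by blast
    moreover have "- (of_int a + of_int b * \<alpha>) = of_int (-a) + of_int (-b) * \<alpha>"
      by (simp add: algebra_simps)
    ultimately have "- x = (of_int (-a) + of_int (-b) * \<alpha>) / (of_int c + of_int d * \<alpha>)"
      by (metis minus_divide_left)
    then show ?thesis by (simp only: K_I)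
  qed
  from this[of x] this[of "-x"] show ?thesis by auto
qed

lemma K_add_int: "x + of_int n \<in> K\<alpha> \<longleftrightarrow> x \<in> K\<alpha>"
proof -
  have "x + of_int n \<in> K\<alpha>" if x: "x \<in> K\<alpha>" for x n
  proof -
    obtain a b c d where eq: "x = (of_int a + of_int b * \<alpha>) / (of_int c + of_int d * \<alpha>)"
      using K_D[OF x] by blast
    show ?thesis
    proof (cases "of_int c + of_int d * \<alpha> = 0")
      case False
      then have "x + of_int n =
          (of_int (a + n * c) + of_int (b + n * d) * \<alpha>) / (of_int c + of_int d * \<alpha>)"
        unfolding eq by (simp add: field_simps)
      then show ?thesis by (simp only: K_I)
    qed (simp add: eq)
  qed
  from this[of x n] this[of "x + of_int n" "-n"] show ?thesis by auto
qed

lemma K_diff_int: "x - of_int n \<in> K\<alpha> \<longleftrightarrow> x \<in> K\<alpha>"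
  using K_add_int[of x "-n"] by simp

lemma K_add_nat: "x + of_nat n \<in> K\<alpha> \<longleftrightarrow> x \<in> K\<alpha>" "of_nat n + x \<in> K\<alpha> \<longleftrightarrow> x \<in> K\<alpha>"
  using K_add_int[of x "int n"] by (simp_all add: add.commute)

lemma K_shift_one: "x + 1 \<in> K\<alpha> \<longleftrightarrow> x \<in> K\<alpha>" "1 + x \<in> K\<alpha> \<longleftrightarrow> x \<in> K\<alpha>"
  "x - 1 \<in> K\<alpha> \<longleftrightarrow> x \<in> K\<alpha>" "1 - x \<in> K\<alpha> \<longleftrightarrow> x \<in> K\<alpha>"
  using K_add_int[of x 1] K_diff_int[of x 1] K_diff_int[of "-x" "-1"]
  by (simp_all add: add.commute K_uminus)

lemma K_add_\<alpha>: "of_int n + \<alpha> \<in> K\<alpha>"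
  using K_add_int[of \<alpha> n] by (simp add: add.commute)

section \<open>Orbits of \<open>Gauss_ext \<alpha>\<close> and their closure\<close>

abbreviation O\<alpha> :: "(real \<times> real) set" where "O\<alpha> \<equiv> Omega \<alpha>"

definition orbits :: "(real \<times> real) set" where
  "orbits = {(Gauss_ext \<alpha> ^^ n) (x, 0) | n x.
     \<alpha> - 1 \<le> x \<and> x < \<alpha> \<and> (\<forall>m<n. fst ((Gauss_ext \<alpha> ^^ m) (x, 0)) \<noteq> 0)}"

lemma Omega_closure: "O\<alpha> = closure orbits"
  unfolding Omega_def orbits_def ..

lemma closed_Omega: "closed O\<alpha>"
  by (simp add: Omega_closure)

lemma base_in_orbits: "\<alpha> - 1 \<le> x \<Longrightarrow> x < \<alpha> \<Longrightarrow> (x, 0) \<in> orbits"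
  unfolding orbits_def by (rule CollectI, rule exI[of _ 0]) auto

lemma base_in_Omega: "\<alpha> - 1 \<le> x \<Longrightarrow> x < \<alpha> \<Longrightarrow> (x, 0) \<in> O\<alpha>"
  unfolding Omega_closure using base_in_orbits closure_subset by blast

lemma orbits_step:
  assumes "p \<in> orbits" "fst p \<noteq> 0"
  shows "Gauss_ext \<alpha> p \<in> orbits"
proof -
  obtain n x where "p = (Gauss_ext \<alpha> ^^ n) (x, 0)" "\<alpha> - 1 \<le> x" "x < \<alpha>"
    "\<forall>m<n. fst ((Gauss_ext \<alpha> ^^ m) (x, 0)) \<noteq> 0"
    using assms(1) unfolding orbits_def by auto
  with assms(2) show ?thesis
    unfolding orbits_def by (auto intro!: exI[of _ "Suc n"] exI[of _ x] simp: less_Suc_eq)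
qed

lemma orbits_induct [consumes 1, case_names base step]:
  assumes "p \<in> orbits"
    and "\<And>x. \<alpha> - 1 \<le> x \<Longrightarrow> x < \<alpha> \<Longrightarrow> P (x, 0)"
    and "\<And>q. q \<in> orbits \<Longrightarrow> fst q \<noteq> 0 \<Longrightarrow> P q \<Longrightarrow> P (Gauss_ext \<alpha> q)"
  shows "P p"
proof -
  obtain n x where p: "p = (Gauss_ext \<alpha> ^^ n) (x, 0)" and x: "\<alpha> - 1 \<le> x" "x < \<alpha>"
    and nz: "\<forall>m<n. fst ((Gauss_ext \<alpha> ^^ m) (x, 0)) \<noteq> 0"
    using assms(1) unfolding orbits_def by auto
  have "(Gauss_ext \<alpha> ^^ m) (x, 0) \<in> orbits \<and> P ((Gauss_ext \<alpha> ^^ m) (x, 0))" if "m \<le> n" for m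
    using that
  proof (induction m)
    case 0
    then show ?case using assms(2) x base_in_orbits by simp
  next
    case (Suc m)
    then show ?case using assms(3) nz orbits_step by simp
  qed
  then show ?thesis using p by auto
qed

lemma digit_eqI:
  assumes "of_int k - 1 + \<alpha> \<le> 1 / \<bar>x\<bar>" "1 / \<bar>x\<bar> < of_int k + \<alpha>"
  shows "digit \<alpha> x = k"
  unfolding digit_def using assms by (intro floor_unique) auto

lemma digit_bounds:
  "of_int (digit \<alpha> x) - 1 + \<alpha> \<le> 1 / \<bar>x\<bar>" "1 / \<bar>x\<bar> < of_int (digit \<alpha> x) + \<alpha>"
  unfolding digit_def by linarith+

lemma digit_bounds_strict:
  assumes "x \<notin> K\<alpha>"
  shows "of_int (digit \<alpha> x) - 1 + \<alpha> < 1 / \<bar>x\<bar>"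
proof -
  have "1 / \<bar>x\<bar> \<notin> K\<alpha>" using assms K_uminus K_inverse by (auto simp: abs_if)
  then have "of_int (digit \<alpha> x) - 1 + \<alpha> \<noteq> 1 / \<bar>x\<bar>"
    using K_add_\<alpha>[of "digit \<alpha> x - 1"] by auto
  then show ?thesis using digit_bounds(1)[of x] by linarith
qed

lemma inverse_one_minus_\<alpha>: "1 + \<alpha> < 1 / (1 - \<alpha>)" 
  using \<alpha>_pos \<alpha>_less_half by (simp add: field_simps)

text \<open>Because \<alpha> < 1/2, the largest absolute value is 1 - \<alpha>, and 1 / (1 -
  \<alpha>) > 1 + \<alpha> puts the floor at 2 or above.\<close>

lemma digit_ge_2:
  assumes "x \<noteq> 0" "\<alpha> - 1 \<le> x" "x \<le> \<alpha>"
  shows "2 \<le> digit \<alpha> x"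
proof -
  have "\<bar>x\<bar> \<le> 1 - \<alpha>" using assms \<alpha>_less_half by auto
  then have "1 / (1 - \<alpha>) \<le> 1 / \<bar>x\<bar>" using assms(1) by (intro divide_left_mono) auto
  then show ?thesis using inverse_one_minus_\<alpha> by (simp add: digit_def le_floor_iff)
qed

lemma Gauss_ext_bounds:
  assumes "fst p \<noteq> 0" "\<alpha> - 1 \<le> fst p" "fst p \<le> \<alpha>" "0 \<le> snd p" "snd p \<le> 1"
  shows "\<alpha> - 1 \<le> fst (Gauss_ext \<alpha> p)" "fst (Gauss_ext \<alpha> p) < \<alpha>"
    "0 < snd (Gauss_ext \<alpha> p)" "snd (Gauss_ext \<alpha> p) \<le> 1"
proof -
  have "2 \<le> real_of_int (digit \<alpha> (fst p))" using digit_ge_2[OF assms(1-3)] by simp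
  then show "\<alpha> - 1 \<le> fst (Gauss_ext \<alpha> p)" "fst (Gauss_ext \<alpha> p) < \<alpha>"
    "0 < snd (Gauss_ext \<alpha> p)" "snd (Gauss_ext \<alpha> p) \<le> 1"
    using assms digit_bounds[of "fst p"]
    by (auto simp: Gauss_ext_def split_beta)
qed

lemma orbits_bounds:
  assumes "p \<in> orbits"
  shows "\<alpha> - 1 \<le> fst p \<and> fst p < \<alpha> \<and> 0 \<le> snd p \<and> snd p \<le> 1"
  using assms
proof (induction rule: orbits_induct)
  case (step q)
  then show ?case using Gauss_ext_bounds[of q] by auto
qed auto

lemma orbits_cases:
  assumes "p \<in> orbits"
  shows "snd p = 0 \<or> (\<exists>q\<in>orbits. fst q \<noteq> 0 \<and> p = Gauss_ext \<alpha> q)"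
  using assms by (induction rule: orbits_induct) auto

lemma Omega_subset: "O\<alpha> \<subseteq> {\<alpha> - 1..\<alpha>} \<times> {0..1}"
  unfolding Omega_closure
proof (rule closure_minimal)
  show "orbits \<subseteq> {\<alpha> - 1..\<alpha>} \<times> {0..1}" using orbits_bounds by force
qed (intro closed_Times closed_atLeastAtMost)

lemma Omega_bounds:
  assumes "(x, t) \<in> O\<alpha>"
  shows "\<alpha> - 1 \<le> x" "x \<le> \<alpha>" "0 \<le> t" "t \<le> 1"
  using assms Omega_subset by auto

lemma Omega_bounds_strict:
  assumes "(x, t) \<in> O\<alpha>" "x \<notin> K\<alpha>"
  shows "\<alpha> - 1 < x" "x < \<alpha>" "x \<noteq> 0"
proof -
  have "x \<noteq> \<alpha>" "x \<noteq> \<alpha> - 1" "x \<noteq> 0" using assms(2) K_shift_one(3)[of \<alpha>] by auto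
  then show "\<alpha> - 1 < x" "x < \<alpha>" "x \<noteq> 0" using Omega_bounds[OF assms(1)] by auto
qed

text \<open>Off \<open>K\<alpha>\<close> the point x is interior to its cylinder, where
  \<open>Gauss_ext \<alpha>\<close> is a single continuous branch; continuity carries the invariance
  from \<open>orbits\<close> to the closure.\<close>

lemma Gauss_ext_Omega:
  assumes "(x, t) \<in> O\<alpha>" "x \<notin> K\<alpha>"
  shows "Gauss_ext \<alpha> (x, t) \<in> O\<alpha>"
proof -
  define k where "k = digit \<alpha> x"
  define s where "s = (if x < 0 then - 1 else 1 :: real)"
  note b = Omega_bounds[OF assms(1)] Omega_bounds_strict[OF assms]
  have k2: "2 \<le> k" using digit_ge_2[of x] b by (simp add: k_def)
  then have k2': "2 \<le> real_of_int k" by simp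
  \<comment> \<open>\<open>U\<close> is the open cylinder of sign s and digit k around x, and
    \<open>f\<close> is the branch of \<open>Gauss_ext \<alpha>\<close> on it.\<close>
  define U where "U = {z. 0 < s * z \<and> 1 / (of_int k + \<alpha>) < s * z \<and> s * z < 1 / (of_int k - 1 + \<alpha>)}"
  define f where "f = (\<lambda>(z, v). (s / z - of_int k, 1 / (of_int k + s * v)) :: real \<times> real)"
  have U_alt: "U = {z. 0 < s * z} \<inter> {z. 1 / (of_int k + \<alpha>) < s * z} \<inter> {z. s * z < 1 / (of_int k - 1 + \<alpha>)}"
    unfolding U_def by auto
  have "open U" unfolding U_alt
    by (intro open_Int open_Collect_less continuous_intros)
  have "s * x = \<bar>x\<bar>" by (auto simp: s_def)
  then have "x \<in> U"
    using digit_bounds(2)[of x] digit_bounds_strict[OF assms(2)] b(7) k2' \<alpha>_pos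
    unfolding U_def k_def[symmetric] mem_Collect_eq \<open>s * x = \<bar>x\<bar>\<close> by (auto simp: field_simps)
  have f_eq: "Gauss_ext \<alpha> p = f p" if "fst p \<in> U" for p
  proof -
    obtain z v where p: "p = (z, v)" by (cases p)
    have "s * z = \<bar>z\<bar>" "z < 0 \<longleftrightarrow> s = -1" "z \<noteq> 0"
      using that unfolding p U_def s_def by (auto split: if_splits)
    moreover have "digit \<alpha> z = k"
      using that calculation k2' \<alpha>_pos unfolding p U_def
      by (intro digit_eqI) (auto simp: field_simps)
    moreover have "s = 1 \<or> s = -1" by (simp add: s_def)
    ultimately show ?thesis unfolding p Gauss_ext_def f_def by auto
  qed
  have "(x, t) \<in> closure (orbits \<inter> U \<times> UNIV)"
    using assms(1) \<open>open U\<close> \<open>x \<in> U\<close> open_Int_closure_subset[of "U \<times> UNIV" orbits]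
    unfolding Omega_closure by (auto simp: open_Times Int_commute)
  moreover have "isCont f (x, t)"
  proof -
    have "of_int k + s * t \<noteq> 0" using k2' b by (auto simp: s_def)
    then show ?thesis unfolding f_def split_beta
      using b by (intro continuous_intros) auto
  qed
  moreover have "f ` (orbits \<inter> U \<times> UNIV) \<subseteq> orbits"
    using orbits_step f_eq by (force simp: U_def)
  ultimately have "f (x, t) \<in> closure orbits" by (rule image_in_closure)
  then show ?thesis using f_eq[of "(x,t)"] \<open>x \<in> U\<close> by (simp add: Omega_closure)
qed

lemma Omega_step:
  assumes "(x, t) \<in> O\<alpha>" "x \<notin> K\<alpha>" 
  shows "x < 0 \<Longrightarrow> of_int k - 1 + \<alpha> < - 1 / x \<Longrightarrow> - 1 / x < of_int k + \<alpha> \<Longrightarrow>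
      (- 1 / x - of_int k, 1 / (of_int k - t)) \<in> O\<alpha>"
    and "0 < x \<Longrightarrow> of_int k - 1 + \<alpha> < 1 / x \<Longrightarrow> 1 / x < of_int k + \<alpha> \<Longrightarrow>
      (1 / x - of_int k, 1 / (of_int k + t)) \<in> O\<alpha>"
proof -
  note g = Gauss_ext_Omega[OF assms]
  show "(- 1 / x - of_int k, 1 / (of_int k - t)) \<in> O\<alpha>"
    if "x < 0" "of_int k - 1 + \<alpha> < - 1 / x" "- 1 / x < of_int k + \<alpha>"
    using g that digit_eqI[of k x] by (simp add: Gauss_ext_def)
  show "(1 / x - of_int k, 1 / (of_int k + t)) \<in> O\<alpha>"
    if "0 < x" "of_int k - 1 + \<alpha> < 1 / x" "1 / x < of_int k + \<alpha>"
    using g that digit_eqI[of k x] by (simp add: Gauss_ext_def)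
qed

text \<open>Backward invariance: digits are bounded where \<open>t\<close> is bounded away from \<open>0\<close>, so near such a
  point \<open>orbits\<close> is a finite union of branch images, and closure commutes with finite unions.\<close>

lemma Omega_predecessor:
  assumes "(a, t) \<in> O\<alpha>" "0 < t"
  shows "\<exists>k::nat. 2 \<le> k \<and> ((- 1 / (of_nat k + a), of_nat k - 1 / t) \<in> O\<alpha> \<or>
           (1 / (of_nat k + a), 1 / t - of_nat k) \<in> O\<alpha>)"
proof -
  \<comment> \<open>If v > t / 2 and v = 1 / (k + s u) with 0 \<le> u \<le> 1, then k \<le> 2 / t +
    1.\<close>
  define N where "N = nat \<lceil>2 / t + 1\<rceil>"
  \<comment> \<open>The inverse branch of sign s and digit k: it solves z = s / x - k and v = 1 / (k
    + s u) for (x, u).\<close>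
  define h where "h = (\<lambda>(s::real, k::nat) (z::real, v::real). (s / (of_nat k + z), s * (1 / v - of_nat k)))"
  define I where "I = {-1, 1 :: real} \<times> {2..N}"
  define A where "A = (\<lambda>i. {p \<in> orbits. t / 2 < snd p \<and> h i p \<in> orbits})"
  have "finite I" by (simp add: I_def)
  have cover: "orbits \<inter> {p. t / 2 < snd p} \<subseteq> (\<Union>i\<in>I. A i)"
  proof safe
    fix z v assume p: "(z, v) \<in> orbits" and v: "t / 2 < snd (z, v)"
    then obtain q where q: "q \<in> orbits" "fst q \<noteq> 0" "(z, v) = Gauss_ext \<alpha> q"
      using orbits_cases[OF p] assms(2) by auto
    obtain x u where q': "q = (x, u)" by (cases q)
    define k where "k = nat (digit \<alpha> x)"
    define s where "s = (if x < 0 then - 1 else 1 :: real)"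
    have b: "\<alpha> - 1 \<le> x" "x < \<alpha>" "0 \<le> u" "u \<le> 1" "x \<noteq> 0" using orbits_bounds[OF q(1)] q(2) q' by auto
    have k2: "2 \<le> k" using digit_ge_2[of x] b by (simp add: k_def)
    have dk: "real_of_int (digit \<alpha> x) = of_nat k" using k2 unfolding k_def by simp
    have zv: "z = s / x - of_nat k" "v = 1 / (of_nat k + s * u)"
      using q(3) b(5) unfolding q' Gauss_ext_def by (auto simp: s_def dk)
    have pos: "0 < of_nat k + s * u" using k2 b by (auto simp: s_def)
    have s2: "s * (s * w) = w" for w by (auto simp: s_def)
    have "h (s, k) (z, v) = q"
      using b(5) by (simp add: h_def q' zv) (simp add: s_def)
    moreover have "k \<le> N"
    proof -
      have "1 / v < 2 / t" using v assms(2) by (simp add: field_simps)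
      moreover have "1 / v = of_nat k + s * u" using zv pos by simp
      moreover have "of_nat k - 1 \<le> of_nat k + s * u" using b by (auto simp: s_def)
      ultimately have "of_nat k \<le> 2 / t + 1" by linarith
      then show ?thesis unfolding N_def by linarith
    qed
    ultimately have "(s, k) \<in> I" "(z, v) \<in> A (s, k)"
      using k2 q(1) p v unfolding I_def A_def by (auto simp: s_def)
    then show "(z, v) \<in> (\<Union>i\<in>I. A i)" by blast
  qed
  have "open {p::real \<times> real. t / 2 < snd p}" by (intro open_Collect_less continuous_intros)
  then have "(a, t) \<in> closure (orbits \<inter> {p. t / 2 < snd p})"
    using assms open_Int_closure_subset[of "{p. t / 2 < snd p}" orbits]
    unfolding Omega_closure by (auto simp: Int_commute)
  then have "(a, t) \<in> closure (\<Union>i\<in>I. A i)" using closure_mono[OF cover] by blast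
  then obtain i where i: "i \<in> I" "(a, t) \<in> closure (A i)"
    using \<open>finite I\<close> by (auto simp: closure_UN_finite)
  obtain s k where sk: "i = (s, k)" "s = -1 \<or> s = 1" "2 \<le> k" using i(1) unfolding I_def by auto
  have "isCont (h i) (a, t)"
  proof -
    have "real k + a \<noteq> 0" using sk(3) Omega_bounds(1)[OF assms(1)] \<alpha>_pos by linarith
    then have "isCont (\<lambda>p. (s / (of_nat k + fst p), s * (1 / snd p - of_nat k))) (a, t)"
      using assms(2) by (intro continuous_intros) auto
    moreover have "h i = (\<lambda>p. (s / (of_nat k + fst p), s * (1 / snd p - of_nat k)))"
      by (simp add: h_def sk(1) split_beta fun_eq_iff)
    ultimately show ?thesis by simp
  qed
  moreover have "h i ` A i \<subseteq> orbits" by (auto simp: A_def)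
  ultimately have "h i (a, t) \<in> O\<alpha>"
    unfolding Omega_closure by (rule image_in_closure[OF i(2)])
  then show ?thesis using sk by (auto simp: h_def)
qed

section \<open>Existence of lifts\<close>

text \<open>\<open>lift_neg\<close> and \<open>lift_pos\<close> describe the points of \<open>V_flat \<alpha>\<close> with \<open>x < 0\<close> and \<open>x > 0\<close>. The index \<open>i\<close> counts
  the steps back to \<open>Omega_star \<alpha>\<close> in the tower \<open>Upsilon \<alpha>\<close>; \<open>i = 0\<close> is \<open>Omega_star \<alpha>\<close> itself. The level \<open>j\<close>
  and the cylinder \<open>k = i + j\<close> are determined by \<open>x\<close>.\<close>

definition lift_neg :: "real \<Rightarrow> real \<Rightarrow> bool" where
  "lift_neg x y \<longleftrightarrow> x < 0 \<and> (x, - 1 / y) \<in> O\<alpha>"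

definition lift_pos :: "real \<Rightarrow> real \<Rightarrow> bool" where
  "lift_pos x y \<longleftrightarrow> (\<exists>i::nat. (1::nat) \<le> i \<and> (- 1 / (1 / x + real i), real i + 1 / y) \<in> O\<alpha>) \<or>
     (\<exists>i::nat. (1 / (1 / x + real i), - 1 / y - real i) \<in> O\<alpha>)"

section \<open>How lifts move under the branches of the Farey map\<close>

lemma lift_posI_minus: "(1::nat) \<le> i \<Longrightarrow> (- 1 / (1 / x + real i), real i + 1 / y) \<in> O\<alpha> \<Longrightarrow> lift_pos x y"
  and lift_posI_plus: "(1 / (1 / x + real i), - 1 / y - real i) \<in> O\<alpha> \<Longrightarrow> lift_pos x y"
  unfolding lift_pos_def by blast+

lemma lift_posI_Omega: "(x, - 1 / y) \<in> O\<alpha> \<Longrightarrow> lift_pos x y"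
  using lift_posI_plus[of x 0 y] by simp

text \<open>The left branch lowers 1/x and 1/y by 1, so raising the index i by 1 leaves the
  witnessing point of \<open>Omega \<alpha>\<close> unchanged.\<close>

lemma lift_pos_step_left:
  assumes "lift_pos x y" "x \<noteq> 0" "y < 0"
  shows "lift_pos (x / (1 - x)) (y / (1 - y))"
proof -
  have eq: "1 / (x / (1 - x)) + real (Suc i) = 1 / x + i" "1 / (y / (1 - y)) = 1 / y - 1"
    "- 1 / (y / (1 - y)) - real (Suc i) = - 1 / y - i" for i
    using assms by (simp_all add: field_simps)
  from assms(1) consider i :: nat where "(1::nat) \<le> i" "(- 1 / (1 / x + real i), real i + 1 / y) \<in> O\<alpha>"
    | i :: nat where "(1 / (1 / x + i), - 1 / y - i) \<in> O\<alpha>"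
    unfolding lift_pos_def by blast
  then show ?thesis
  proof cases
    case 1
    then show ?thesis by (intro lift_posI_minus[of "Suc i"]; (unfold eq)?) (simp_all add: add.commute)
  next
    case 2
    then show ?thesis by (intro lift_posI_plus[of _ "Suc i"]) (simp only: eq)
  qed
qed

text \<open>Subtracting the remaining j completes the branch of \<open>Gauss_ext \<alpha>\<close>
  with digit i + j at the witnessing point. The index i drops out, and the result is the same for
  both signs of the witness.\<close>

lemma lift_pos_step_right_gen:
  assumes "lift_pos x y" "x \<notin> K\<alpha>" "y < 0" "0 < x" "real j - 1 + \<alpha> < 1 / x" "1 / x < real j + \<alpha>"
  shows "(1 / x - real j, - 1 / (1 / y - real j)) \<in> O\<alpha>"
proof -
  have nK: "- 1 / (1 / x + real i) \<notin> K\<alpha>" "1 / (1 / x + real i) \<notin> K\<alpha>" for i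
    using assms(2) by (simp_all add: K_uminus K_inverse K_add_nat)
  have pos: "0 < 1 / (1 / x + real i)" "- 1 / (1 / x + real i) < 0" for i
    using assms(4) by (simp_all add: add_pos_nonneg)
  have m: "1 / (- w) = - 1 / w" for w :: real by simp
  have eq: "1 / (real i + real j - (real i + 1 / y)) = - 1 / (1 / y - real j)"
    "1 / (real i + real j + (- 1 / y - real i)) = - 1 / (1 / y - real j)" for i
    using m[of "1 / y - real j"] by (simp_all add: algebra_simps)
  from assms(1) consider i :: nat where "(1::nat) \<le> i" "(- 1 / (1 / x + real i), real i + 1 / y) \<in> O\<alpha>"
    | i :: nat where "(1 / (1 / x + i), - 1 / y - i) \<in> O\<alpha>"
    unfolding lift_pos_def by blast
  then show ?thesis
  proof cases
    case 1
    then show ?thesis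
      using Omega_step(1)[OF 1(2) nK(1)[of i] pos(2), of "int (i + j)"] assms(5,6) eq by simp
  next
    case 2
    then show ?thesis
      using Omega_step(2)[OF 2 nK(2)[of i] pos(1), of "int (i + j)"] assms(5,6) eq by simp
  qed
qed

text \<open>The case j = 2. Here 1/x < 2, so the image has negative first coordinate: it is the
  Farey image translated by (-1, -1).\<close>

lemma lift_pos_step_middle:
  assumes "lift_pos x y" "x \<notin> K\<alpha>" "y < 0" "1 / 2 < x" "x < 1 / (1 + \<alpha>)"
  shows "lift_neg (1 / x - 1 - 1) (1 / y - 1 - 1)"
proof -
  have "1 + \<alpha> < 1 / x" "1 / x < 2" using assms(4,5) \<alpha>_pos by (simp_all add: field_simps)
  then show ?thesis
    using lift_pos_step_right_gen[OF assms(1-3), of 2] assms(4) \<alpha>_pos by (simp add: lift_neg_def)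
qed

text \<open>The case j = 1. The image lies in \<open>Omega \<alpha>\<close> itself and not merely in
  the tower over it; this is what later turns a double lift into two predecessors of one
  point.\<close>

lemma lift_pos_step_right:
  assumes "lift_pos x y" "x \<notin> K\<alpha>" "y < 0" "1 / (1 + \<alpha>) < x" "x < 1"
  shows "(1 / x - 1, - 1 / (1 / y - 1)) \<in> O\<alpha>"
proof -
  have "0 < x" using assms(4) \<alpha>_pos by (simp add: order.strict_trans1[rotated])
  moreover from this have "1 / x < 1 + \<alpha>" "1 < 1 / x"
    using assms(4,5) \<alpha>_pos by (simp_all add: field_simps)
  moreover from this have "\<alpha> < 1 / x" using \<alpha>_less_half by linarith
  ultimately show ?thesis
    using lift_pos_step_right_gen[OF assms(1-3), of 1] by simp
qed

text \<open>The point x - 1 lies in the negative cylinder of digit 2, since x > \<alpha> gives 1 /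
  (1 - x) > 1 + \<alpha>; the translated Farey branch is that branch of
  \<open>Gauss_ext \<alpha>\<close>.\<close>

lemma lift_neg_step_left:
  assumes "lift_neg (x - 1) (y - 1)" "x \<notin> K\<alpha>" "y < 0" "0 < x" "x < 1 / 2"
  shows "lift_neg (x / (1 - x) - 1) (y / (1 - y) - 1)"
proof -
  have O: "(x - 1, - 1 / (y - 1)) \<in> O\<alpha>" using assms(1) by (simp add: lift_neg_def)
  have x1: "x - 1 \<notin> K\<alpha>" using assms(2) by (simp add: K_shift_one)
  have "\<alpha> < x" using Omega_bounds_strict(1)[OF O x1] by simp
  then have "1 / (1 - \<alpha>) < 1 / (1 - x)" using assms(5) by (simp add: field_simps)
  then have "1 + \<alpha> < 1 / (1 - x)" using inverse_one_minus_\<alpha> by linarith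
  moreover have "1 / (1 - x) < 2" "- 1 / (x - 1) = 1 / (1 - x)"
    using assms(5) by (simp_all add: divide_simps)
  ultimately have "real_of_int 2 - 1 + \<alpha> < - 1 / (x - 1)" "- 1 / (x - 1) < real_of_int 2 + \<alpha>"
    using \<alpha>_pos by simp_all
  then have "(- 1 / (x - 1) - 2, 1 / (2 - (- 1 / (y - 1)))) \<in> O\<alpha>"
    using Omega_step(1)[OF O x1, of 2] assms(5) by simp
  moreover have "- 1 / (x - 1) - 2 = x / (1 - x) - 1"
    "1 / (2 - (- 1 / (y - 1))) = - 1 / (y / (1 - y) - 1)"
    using assms(3,5) by (simp_all add: divide_simps algebra_simps)
  moreover have "x / (1 - x) - 1 < 0" using assms(5) by (simp add: field_simps)
  ultimately show ?thesis by (simp add: lift_neg_def)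
qed

text \<open>The witness does not move. It is reinterpreted as the entry of index 1 in the tower,
  because -1 / (x - 1) = 1 / (1 / x - 1) + 1.\<close>

lemma lift_neg_step_right:
  assumes "lift_neg (x - 1) (y - 1)" "y < 0" "0 < x" "x < 1"
  shows "lift_pos (1 / x - 1) (1 / y - 1)"
proof (rule lift_posI_minus[of 1])
  have "- 1 / (1 / (1 / x - 1) + real 1) = x - 1" "real 1 + 1 / (1 / y - 1) = - 1 / (y - 1)"
    using assms(2-4) by (simp_all add: divide_simps)
  then show "(- 1 / (1 / (1 / x - 1) + real 1), real 1 + 1 / (1 / y - 1)) \<in> O\<alpha>"
    using assms(1) by (simp only: lift_neg_def)
qed simp

text \<open>\<open>lifts x u\<close> says that some point of \<open>V_flat \<alpha>\<close> lies over \<open>(x, -u)\<close>.\<close>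

definition lifts :: "real \<Rightarrow> real \<Rightarrow> bool" where
  "lifts x u \<longleftrightarrow> 0 < u \<and> (lift_pos x (- u) \<or> lift_neg (x - 1) (- u - 1))"

lemma lifts_step_left:
  assumes "lifts x u" "x \<notin> K\<alpha>" "0 < x" "x < 1 / 2"
  shows "lifts (x / (1 - x)) (u / (1 + u))"
  using assms lift_pos_step_left[of x "-u"] lift_neg_step_left[of x "-u"] by (auto simp: lifts_def)

lemma lifts_step_right:
  assumes "lifts x u" "x \<notin> K\<alpha>" "1 / 2 < x" "x < 1"
  shows "lifts (1 / x - 1) (1 + 1 / u)"
proof -
  have u: "0 < u" using assms(1) by (simp add: lifts_def)
  have "x \<noteq> 1 / (1 + \<alpha>)" using assms(2) by auto
  then consider "lift_pos x (-u)" "x < 1 / (1 + \<alpha>)" | "lift_pos x (-u)" "1 / (1 + \<alpha>) < x" | "lift_neg (x - 1) (- u - 1)"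
    using assms(1) by (force simp: lifts_def)
  then have "lift_pos (1 / x - 1) (1 / (- u) - 1) \<or> lift_neg (1 / x - 1 - 1) (1 / (- u) - 1 - 1)"
  proof cases
    case 1
    then show ?thesis using lift_pos_step_middle[of x "-u"] assms u by simp
  next
    case 2
    then show ?thesis using lift_posI_Omega[OF lift_pos_step_right[of x "-u"]] assms u by simp
  next
    case 3
    then show ?thesis using lift_neg_step_right[of x "-u"] assms u by simp
  qed
  moreover have "1 / (- u) - 1 = - (1 + 1 / u)" by simp
  ultimately have "lift_pos (1 / x - 1) (- (1 + 1 / u)) \<or> lift_neg (1 / x - 1 - 1) (- (1 + 1 / u) - 1)"
    by (simp only:)
  moreover have "0 < 1 + 1 / u" using u by (simp add: add_pos_pos)
  ultimately show ?thesis unfolding lifts_def by blast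
qed

text \<open>The starting points of the approximation are taken at y = -1, the image of -\<infinity>
  under the right Farey branch, so that only finite coordinates occur. The witness is (-x / (x + 1),
  0).\<close>

lemma lifts_one:
  assumes "0 < x" "x < 1"
  shows "lifts x 1"
proof -
  have "- 1 / (1 / x + 1) = - (x / (x + 1))" using assms by (simp add: divide_simps)
  moreover have "x / (x + 1) < 1 / 2" "0 < x / (x + 1)" using assms by (simp_all add: field_simps)
  ultimately have "(- 1 / (1 / x + 1), 0) \<in> O\<alpha>"
    using base_in_Omega[of "- 1 / (1 / x + 1)"] \<alpha>_less_half \<alpha>_pos by simp
  then show ?thesis using lift_posI_minus[of 1 x "-1"] by (simp add: lifts_def)
qed

text \<open>The index i of a lift is unbounded in general, but second coordinates of
  \<open>Omega \<alpha>\<close> lie in [0, 1], which forces i \<le> 1 / u + 1. For u \<ge> \<delta>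
  finitely many closed conditions remain.\<close>

lemma closed_lifts:
  assumes "0 < x" "0 < \<delta>"
  shows "closed {u \<in> {\<delta>..}. lifts x u}"
proof -
  define N where "N = nat \<lceil>1 / \<delta> + 1\<rceil>"
  define A where "A = (\<lambda>i::nat. {u \<in> {\<delta>..}. (- 1 / (1 / x + i), i - 1 / u) \<in> O\<alpha>})"
  define B where "B = (\<lambda>i::nat. {u \<in> {\<delta>..}. (1 / (1 / x + i), 1 / u - i) \<in> O\<alpha>})"
  define C where "C = {u \<in> {\<delta>..}. (x - 1, 1 / (u + 1)) \<in> O\<alpha>}"
  have cl: "closed {u \<in> {\<delta>..}. (c, f u) \<in> O\<alpha>}" if "continuous_on {\<delta>..} f" for c and f :: "real \<Rightarrow> real"
  proof -
    have "closed ({\<delta>..} \<inter> (\<lambda>u. (c, f u)) -` O\<alpha>)"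
      using that by (intro continuous_closed_preimage closed_Omega continuous_intros) auto
    then show ?thesis by (simp add: Int_def vimage_def)
  qed
  have m: "1 / (- u - 1) = - (1 / (u + 1))" for u :: real by (simp add: divide_simps)
  have "closed (A i)" "closed (B i)" "closed C" for i
    unfolding A_def B_def C_def using assms(2) by (intro cl continuous_intros; force)+
  moreover have "{u \<in> {\<delta>..}. lifts x u} =
      (\<Union>i\<in>{1..N}. A i) \<union> (\<Union>i\<in>{..N}. B i) \<union> (if x < 1 then C else {})"
  proof (intro equalityI subsetI)
    fix u assume u: "u \<in> {u \<in> {\<delta>..}. lifts x u}"
    have "1 / u \<le> 1 / \<delta>" using u assms by (auto simp: field_simps)
    then have N: "i \<le> N" if "real i \<le> 1 / u + 1" for i using that unfolding N_def by linarith
    from u consider i :: nat where "(1::nat) \<le> i" "(- 1 / (1 / x + real i), real i - 1 / u) \<in> O\<alpha>"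
      | i :: nat where "(1 / (1 / x + i), 1 / u - i) \<in> O\<alpha>" | "x < 1" "(x - 1, 1 / (u + 1)) \<in> O\<alpha>"
      unfolding lifts_def lift_pos_def lift_neg_def using m by auto
    then show "u \<in> (\<Union>i\<in>{1..N}. A i) \<union> (\<Union>i\<in>{..N}. B i) \<union> (if x < 1 then C else {})"
    proof cases
      case 1
      then show ?thesis using N[of i] Omega_bounds(4)[OF 1(2)] u by (auto simp: A_def)
    next
      case 2
      then show ?thesis using N[of i] Omega_bounds(3)[OF 2] u by (auto simp: B_def)
    next
      case 3
      then show ?thesis using u by (simp add: C_def)
    qed
  next
    fix u assume u: "u \<in> (\<Union>i\<in>{1..N}. A i) \<union> (\<Union>i\<in>{..N}. B i) \<union> (if x < 1 then C else {})"
    have "\<delta> \<le> u" using u by (auto simp: A_def B_def C_def split: if_splits)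
    moreover have "lift_pos x (-u) \<or> lift_neg (x - 1) (- u - 1)"
      using u lift_posI_minus[of _ x "-u"] lift_posI_plus[of x _ "-u"]
      by (auto simp: A_def B_def C_def lift_neg_def m split: if_splits)
    ultimately show "u \<in> {u \<in> {\<delta>..}. lifts x u}" using assms(2) by (auto simp: lifts_def)
  qed
  ultimately show ?thesis by (auto intro!: closed_Un closed_UN)
qed

text \<open>Every point \<open>(x, -u)\<close> is an image of points over which a lift exists, under a Moebius map
  \<open>v \<mapsto> (a v + b) / (c v + d)\<close> whose range over \<open>v > 0\<close> has length at most \<open>1 / (c d)\<close>.\<close>

definition approximable :: "nat \<Rightarrow> real \<Rightarrow> real \<Rightarrow> bool" where
  "approximable n x u \<longleftrightarrow> (\<exists>a b c d x' u'. 0 \<le> a \<and> 0 \<le> b \<and> real n + 1 \<le> c \<and> 1 \<le> d \<and>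
     \<bar>a * d - b * c\<bar> = 1 \<and> 0 < x' \<and> x' < 1 \<and> x' \<notin> K\<alpha> \<and> 0 < u' \<and> u' \<notin> K\<alpha> \<and>
     u = (a * u' + b) / (c * u' + d) \<and>
     (\<forall>v>0. lifts x' v \<longrightarrow> lifts x ((a * v + b) / (c * v + d))))"

lemma approximableI:
  assumes "0 \<le> a" "0 \<le> b" "real n + 1 \<le> c" "1 \<le> d" "\<bar>a * d - b * c\<bar> = 1"
    and "0 < x'" "x' < 1" "x' \<notin> K\<alpha>" "0 < u'" "u' \<notin> K\<alpha>"
    and "u = (a * u' + b) / (c * u' + d)"
    and "\<And>v. 0 < v \<Longrightarrow> lifts x' v \<Longrightarrow> lifts x ((a * v + b) / (c * v + d))"
  shows "approximable n x u"
  unfolding approximable_def using assms by blast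

text \<open>The left Farey branch reaches exactly the heights 0 < u < 1 and the right one exactly u
  > 1, so the size of u selects the inverse branch.\<close>

lemma predecessor_left:
  assumes "0 < x" "x < 1" "x \<notin> K\<alpha>" "0 < u" "u < 1" "u \<notin> K\<alpha>"
  obtains x' u' where "0 < x'" "x' < 1" "x' \<notin> K\<alpha>" "0 < u'" "u' \<notin> K\<alpha>" "u = u' / (1 + u')"
    "\<And>v. lifts x' v \<Longrightarrow> lifts x (v / (1 + v))"
proof
  show "x / (1 + x) \<notin> K\<alpha>" "u / (1 - u) \<notin> K\<alpha>"
  proof -
    have "x / (1 + x) = 1 / (1 / x + 1)" "u / (1 - u) = 1 / (1 / u - 1)"
      using assms by (simp_all add: field_simps)
    then show "x / (1 + x) \<notin> K\<alpha>" "u / (1 - u) \<notin> K\<alpha>"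
      using assms by (simp_all only: K_inverse K_shift_one not_False_eq_True)
  qed
  moreover have "1 - x / (1 + x) = 1 / (1 + x)" "x / (1 + x) < 1 / 2" "0 < x / (1 + x)"
    using assms by (simp_all add: field_simps)
  ultimately show "lifts x (v / (1 + v))" if "lifts (x / (1 + x)) v" for v
    using lifts_step_left[OF that] assms by simp
qed (use assms in \<open>auto simp: field_simps\<close>)

lemma predecessor_right:
  assumes "0 < x" "x < 1" "x \<notin> K\<alpha>" "1 < u" "u \<notin> K\<alpha>"
  obtains x' u' where "0 < x'" "x' < 1" "x' \<notin> K\<alpha>" "0 < u'" "u' \<notin> K\<alpha>" "u = 1 + 1 / u'"
    "\<And>v. lifts x' v \<Longrightarrow> lifts x (1 + 1 / v)"
proof
  show K: "1 / (1 + x) \<notin> K\<alpha>" "1 / (u - 1) \<notin> K\<alpha>"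
    using assms by (simp_all only: K_inverse K_shift_one not_False_eq_True)
  show "lifts x (1 + 1 / v)" if "lifts (1 / (1 + x)) v" for v
    using lifts_step_right[OF that K(1)] assms by (simp add: field_simps)
qed (use assms in \<open>auto simp: field_simps\<close>)

text \<open>One more inverse branch multiplies the matrix (a b; c d) from the right by (1 0; 1 1) or
  by (1 1; 1 0). Either way the new c is c + d, which grows by at least 1 since d \<ge> 1, and the
  new d is d or c.\<close>

lemma approximable_Suc:
  assumes "approximable n x u"
  shows "approximable (Suc n) x u"
proof -
  obtain a b c d x' u' where M: "0 \<le> a" "0 \<le> b" "real n + 1 \<le> c" "1 \<le> d" "\<bar>a * d - b * c\<bar> = 1"
    and x': "0 < x'" "x' < 1" "x' \<notin> K\<alpha>" and u': "0 < u'" "u' \<notin> K\<alpha>"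
    and u: "u = (a * u' + b) / (c * u' + d)"
    and l: "\<And>v. 0 < v \<Longrightarrow> lifts x' v \<Longrightarrow> lifts x ((a * v + b) / (c * v + d))"
    using assms unfolding approximable_def by blast
  have "u' \<noteq> 1" using u'(2) by auto
  then consider "u' < 1" | "1 < u'" by linarith
  then show ?thesis
  proof cases
    case 1
    obtain x'' u'' where *: "0 < x''" "x'' < 1" "x'' \<notin> K\<alpha>" "0 < u''" "u'' \<notin> K\<alpha>" "u' = u'' / (1 + u'')"
      "\<And>v. lifts x'' v \<Longrightarrow> lifts x' (v / (1 + v))"
      using predecessor_left[OF x' u'(1) 1 u'(2)] by blast
    have eq: "(a * (v / (1 + v)) + b) / (c * (v / (1 + v)) + d) = ((a + b) * v + b) / ((c + d) * v + d)"
      if "0 < v" for v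
    proof -
      have "a * (v / (1 + v)) + b = ((a + b) * v + b) / (1 + v)"
        "c * (v / (1 + v)) + d = ((c + d) * v + d) / (1 + v)"
        using that by (simp_all add: field_simps)
      then show ?thesis using that by simp
    qed
    have "lifts x (((a + b) * v + b) / ((c + d) * v + d))" if "0 < v" "lifts x'' v" for v
      using l[of "v / (1 + v)"] *(7)[OF that(2)] that(1) eq[OF that(1)] by simp
    moreover have "\<bar>(a + b) * d - b * (c + d)\<bar> = 1" using M(5) by (simp add: algebra_simps)
    moreover have "u = ((a + b) * u'' + b) / ((c + d) * u'' + d)" using u *(6) eq[OF *(4)] by simp
    ultimately show ?thesis
      using M(1-4) *(1-5) by (intro approximableI[of "a + b" b _ "c + d" d x'' u'']) auto
  next
    case 2
    obtain x'' u'' where *: "0 < x''" "x'' < 1" "x'' \<notin> K\<alpha>" "0 < u''" "u'' \<notin> K\<alpha>" "u' = 1 + 1 / u''"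
      "\<And>v. lifts x'' v \<Longrightarrow> lifts x' (1 + 1 / v)"
      using predecessor_right[OF x' 2 u'(2)] by blast
    have eq: "(a * (1 + 1 / v) + b) / (c * (1 + 1 / v) + d) = ((a + b) * v + a) / ((c + d) * v + c)"
      if "0 < v" for v
    proof -
      have "a * (1 + 1 / v) + b = ((a + b) * v + a) / v"
        "c * (1 + 1 / v) + d = ((c + d) * v + c) / v"
        using that by (simp_all add: field_simps)
      then show ?thesis using that by simp
    qed
    have "lifts x (((a + b) * v + a) / ((c + d) * v + c))" if "0 < v" "lifts x'' v" for v
      using l[of "1 + 1 / v"] *(7)[OF that(2)] that(1) eq[OF that(1)] by (simp add: add_pos_pos)
    moreover have "\<bar>(a + b) * c - a * (c + d)\<bar> = 1" using M(5) by (simp add: algebra_simps abs_minus_commute)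
    moreover have "u = ((a + b) * u'' + a) / ((c + d) * u'' + c)" using u *(6) eq[OF *(4)] by simp
    ultimately show ?thesis
      using M(1-4) *(1-5) by (intro approximableI[of "a + b" a _ "c + d" c x'' u'']) auto
  qed
qed

lemma approximable_lifts:
  assumes "\<And>n. approximable n x u" "0 < x" "0 < u"
  shows "lifts x u"
proof -
  have "u \<in> closure {w \<in> {u / 2..}. lifts x w}"
    unfolding closure_approachable
  proof (intro allI impI)
    fix e :: real assume "0 < e"
    \<comment> \<open>This n makes the error 1 / c smaller than both e and u / 2. The second bound
      keeps the approximant at heights \<ge> u / 2, where closedness is available.\<close>
    obtain n :: nat where n: "1 / e + 2 / u < real n" using reals_Archimedean2 by blast
    obtain a b c d x' u' where M: "0 \<le> a" "0 \<le> b" "real n + 1 \<le> c" "1 \<le> d" "\<bar>a * d - b * c\<bar> = 1"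
      and x': "0 < x'" "x' < 1" "x' \<notin> K\<alpha>" and u': "0 < u'" "u' \<notin> K\<alpha>"
      and u: "u = (a * u' + b) / (c * u' + d)"
      and l: "\<And>v. 0 < v \<Longrightarrow> lifts x' v \<Longrightarrow> lifts x ((a * v + b) / (c * v + d))"
      using assms(1)[of n] unfolding approximable_def by blast
    have c: "0 < c" "0 < d" using M by linarith+
    \<comment> \<open>The image of v = 1, a height at which every x' has a lift.\<close>
    let ?w = "(a + b) / (c + d)"
    have "lifts x ?w" using l[of 1] lifts_one[OF x'(1,2)] by simp
    have pos: "0 < c * u' + d" using c u' by (simp add: add_pos_pos)
    have "?w - u = (a * d - b * c) * (1 - u') / ((c + d) * (c * u' + d))"
      using c pos unfolding u by (simp add: field_simps)
    then have "\<bar>?w - u\<bar> = \<bar>1 - u'\<bar> / ((c + d) * (c * u' + d))"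
      using M(5) c pos by (simp add: abs_mult)
    also have "\<dots> \<le> 1 / c"
    proof -
      have "\<bar>1 - u'\<bar> * c \<le> (1 + u') * c" using u' c by (intro mult_right_mono) auto
      also have "\<dots> \<le> (1 + u') * (c * d)" using u' c M(4) by (intro mult_left_mono) auto
      also have "\<dots> \<le> (c + d) * (c * u' + d)" using u' c by (simp add: algebra_simps)
      finally show ?thesis using c pos by (simp add: pos_divide_le_eq pos_le_divide_eq)
    qed
    also have "\<dots> < 1 / (1 / e + 2 / u)"
    proof -
      have "0 < 1 / e + 2 / u" using \<open>0 < e\<close> assms(3) by (simp add: add_pos_pos)
      then show ?thesis using n M(3) by (intro divide_strict_left_mono) (auto intro!: mult_pos_pos)
    qed
    finally have lt: "\<bar>?w - u\<bar> < 1 / (1 / e + 2 / u)" .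
    have "1 / (1 / e + 2 / u) \<le> 1 / (1 / e)" "1 / (1 / e + 2 / u) \<le> 1 / (2 / u)"
      using \<open>0 < e\<close> assms(3) by (intro divide_left_mono; simp add: add_pos_pos)+
    with lt have "\<bar>?w - u\<bar> < e" "\<bar>?w - u\<bar> < u / 2" using \<open>0 < e\<close> assms(3) by simp_all
    moreover from this have "u / 2 \<le> ?w" by linarith
    ultimately show "\<exists>w\<in>{w \<in> {u / 2..}. lifts x w}. dist w u < e"
      using \<open>lifts x ?w\<close> by (intro bexI[of _ ?w]) (auto simp: dist_real_def)
  qed
  then show ?thesis using closed_lifts[of x "u / 2"] assms(2,3) by (simp add: closure_closed)
qed

lemma lifts_if_approximable:
  assumes "approximable 0 x u" "0 < x" "0 < u"
  shows "lifts x u"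
proof (rule approximable_lifts[OF _ assms(2,3)])
  show "approximable n x u" for n
    by (induction n) (use assms(1) approximable_Suc in auto)
qed

lemma lifts_all_less_one:
  assumes "0 < x" "x < 1" "x \<notin> K\<alpha>" "0 < u" "u < 1" "u \<notin> K\<alpha>"
  shows "lifts x u"
proof (rule lifts_if_approximable[OF _ assms(1,4)])
  obtain x' u' where "0 < x'" "x' < 1" "x' \<notin> K\<alpha>" "0 < u'" "u' \<notin> K\<alpha>" "u = u' / (1 + u')"
    "\<And>v. lifts x' v \<Longrightarrow> lifts x (v / (1 + v))"
    using predecessor_left[OF assms] by blast
  then show "approximable 0 x u"
    by (intro approximableI[of 1 0 _ 1 1 x' u']) (auto simp: add.commute)
qed

lemma lifts_all:
  assumes "0 < x" "x < 1" "x \<notin> K\<alpha>" "0 < u" "u \<notin> K\<alpha>"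
  shows "lifts x u"
proof (cases "u < 1")
  case True
  then show ?thesis using lifts_all_less_one assms by blast
next
  case False
  then have "1 < u" using assms(5) by (cases "u = 1") auto
  then obtain x' u' where 1: "0 < x'" "x' < 1" "x' \<notin> K\<alpha>" "0 < u'" "u' \<notin> K\<alpha>" "u = 1 + 1 / u'"
    "\<And>v. lifts x' v \<Longrightarrow> lifts x (1 + 1 / v)"
    using predecessor_right[OF assms(1-3) _ assms(5)] by blast
  show ?thesis
  proof (cases "u' < 1")
    case True
    then show ?thesis using lifts_all_less_one[OF 1(1-4) True 1(5)] 1(6,7) by blast
  next
    case False
    then have "1 < u'" using 1(5) by (cases "u' = 1") auto
    then obtain x'' u'' where 2: "0 < x''" "x'' < 1" "x'' \<notin> K\<alpha>" "0 < u''" "u'' \<notin> K\<alpha>" "u' = 1 + 1 / u''"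
      "\<And>v. lifts x'' v \<Longrightarrow> lifts x' (1 + 1 / v)"
      using predecessor_right[OF 1(1-3) _ 1(5)] by blast
    have eq: "1 + 1 / (1 + 1 / v) = (2 * v + 1) / (v + 1)" if "0 < v" for v :: real
      using that by (simp add: divide_simps)
    show ?thesis
    proof (rule lifts_if_approximable[OF _ assms(1,4)])
      have "lifts x ((2 * v + 1) / (1 * v + 1))" if "0 < v" "lifts x'' v" for v
        using 1(7)[OF 2(7)[OF that(2)]] eq[OF that(1)] by simp
      then show "approximable 0 x u"
        using 2(1-6) 1(6) eq[OF 2(4)] by (intro approximableI[of 2 1 _ 1 1 x'' u'']) simp_all
    qed
  qed
qed

section \<open>Uniqueness of lifts\<close>

lemma K_borel [measurable]: "K\<alpha> \<in> sets borel"
  using countable_K by (rule sets.countable[rotated]) simp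

lemma Omega_borel [measurable]: "O\<alpha> \<in> sets borel"
  using closed_Omega by simp

text \<open>The generic points of \<open>Omega_star \<alpha>\<close> of sign s and digit k. With y =
  -1/t, both coordinates of \<open>Gauss_ext \<alpha>\<close> become the same Moebius map z
  \<mapsto> s / z - k, so that \<open>hyp_measure\<close> is the invariant measure.\<close>

definition branch_dom :: "real \<Rightarrow> nat \<Rightarrow> (real \<times> real) set" where
  "branch_dom s k = {(x, y). x \<notin> K\<alpha> \<and> y \<notin> K\<alpha> \<and> y < 0 \<and> 0 < s * x \<and> (x, - 1 / y) \<in> O\<alpha> \<and>
     real k - 1 + \<alpha> < s / x \<and> s / x < real k + \<alpha>}"

text \<open>The image of the branch, written as a preimage under the inverse branch so that
  \<open>preserves\<close> applies to it directly.\<close>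

definition branch_img :: "real \<Rightarrow> nat \<Rightarrow> (real \<times> real) set" where
  "branch_img s k = map_prod (\<lambda>x. s / (real k + x)) (\<lambda>x. s / (real k + x)) -` branch_dom s k"

lemma pair_borel_eq: "sets (borel \<Otimes>\<^sub>M borel) = sets (borel :: (real \<times> real) measure)"
  by (simp only: borel_prod)

lemma branch_dom_borel [measurable]: "branch_dom s k \<in> sets borel"
proof -
  have [measurable]: "O\<alpha> \<in> sets (borel \<Otimes>\<^sub>M borel)" using Omega_borel unfolding pair_borel_eq .
  have "{p \<in> space (borel \<Otimes>\<^sub>M borel). fst p \<notin> K\<alpha> \<and> snd p \<notin> K\<alpha> \<and> snd p < 0 \<and> 0 < s * fst p \<and>
      (fst p, - 1 / snd p) \<in> O\<alpha> \<and> real k - 1 + \<alpha> < s / fst p \<and> s / fst p < real k + \<alpha>} \<in> sets (borel \<Otimes>\<^sub>M borel)"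
    (is "?S \<in> _") by measurable
  moreover have "?S = branch_dom s k" by (auto simp: branch_dom_def space_pair_measure)
  ultimately show ?thesis by (simp only: pair_borel_eq)
qed

lemma preserves_branch:
  assumes "s = 1 \<or> s = -1"
  shows "preserves (\<lambda>x. s / (real k + x))"
  using assms preserves_comp[OF preserves_inverse preserves_add[of "real k"]]
    preserves_comp[OF preserves_neg_inverse preserves_add[of "real k"]]
  by (auto simp: add.commute)

lemma branch_img_borel: "s = 1 \<or> s = -1 \<Longrightarrow> branch_img s k \<in> sets borel"
  unfolding branch_img_def by (intro preserves_vimage_sets preserves_branch branch_dom_borel)

text \<open>The domains for different k are disjoint by their first coordinates, while nothing is
  known yet about overlaps of the images; hence subadditivity on one side and additivity on the
  other.\<close>

lemma emeasure_branch_img_le: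
  assumes "s = 1 \<or> s = -1"
  shows "emeasure hyp_measure (\<Union>k. branch_img s k) \<le> emeasure hyp_measure (\<Union>k. branch_dom s k)"
proof -
  have "emeasure hyp_measure (\<Union>k. branch_img s k) \<le> (\<Sum>k. emeasure hyp_measure (branch_img s k))"
    using branch_img_borel[OF assms] by (intro emeasure_subadditive_countably) auto
  also have "\<dots> = (\<Sum>k. emeasure hyp_measure (branch_dom s k))"
    unfolding branch_img_def by (simp add: preserves_emeasure[OF preserves_branch[OF assms]])
  also have "\<dots> = emeasure hyp_measure (\<Union>k. branch_dom s k)"
  proof (rule suminf_emeasure)
    show "disjoint_family (branch_dom s)"
    proof (unfold disjoint_family_on_def, intro ballI impI)
      fix k l :: nat assume "k \<noteq> l"
      then have "real k + 1 \<le> real l \<or> real l + 1 \<le> real k" by linarith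
      then show "branch_dom s k \<inter> branch_dom s l = {}" unfolding branch_dom_def by auto
    qed
  qed auto
  finally show ?thesis .
qed

text \<open>This is \<open>Omega_predecessor\<close> in the coordinate y = -1/t.\<close>

lemma branch_dom_subset_img: "(\<Union>k. branch_dom (-1) k) \<union> (\<Union>k. branch_dom 1 k) \<subseteq> (\<Union>k. branch_img (-1) k) \<union> (\<Union>k. branch_img 1 k)"
proof
  fix p assume "p \<in> (\<Union>k. branch_dom (-1) k) \<union> (\<Union>k. branch_dom 1 k)"
  then obtain a b where p: "p = (a, b)" and ab: "a \<notin> K\<alpha>" "b \<notin> K\<alpha>" "b < 0" "(a, - 1 / b) \<in> O\<alpha>"
    by (auto simp: branch_dom_def)
  obtain k :: nat where k: "2 \<le> k" and "(- 1 / (real k + a), real k + b) \<in> O\<alpha> \<or>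
      (1 / (real k + a), - b - real k) \<in> O\<alpha>"
    using Omega_predecessor[OF ab(4)] ab(3) by (auto simp: zero_less_divide_iff)
  then obtain s :: real where s: "s = 1 \<or> s = -1" and O: "(s / (real k + a), - s * (real k + b)) \<in> O\<alpha>"
    by (metis (no_types, opaque_lifting) add.commute minus_add_distrib minus_minus mult_1 mult_minus1 uminus_add_conv_diff)
  have b: "\<alpha> - 1 < a" "a < \<alpha>" using Omega_bounds_strict[OF ab(4,1)] by auto
  have ka: "0 < real k + a" using k b \<alpha>_pos by linarith
  have nK: "real k + a \<notin> K\<alpha>" "real k + b \<notin> K\<alpha>" using ab by (simp_all add: K_add_nat)
  \<comment> \<open>Equality with 0 would put \<open>real k + b\<close> into
    \<open>K\<alpha>\<close>.\<close>
  have kb: "0 < - s * (real k + b)"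
    using Omega_bounds(3)[OF O] nK(2) s by (auto simp: less_le)
  have "s / (real k + a) \<notin> K\<alpha>" "s / (real k + b) \<notin> K\<alpha>"
    using s nK by (auto simp: K_inverse K_uminus)
  moreover have "- 1 / (s / (real k + b)) = - s * (real k + b)" "s / (s / (real k + a)) = real k + a"
    "0 < s * (s / (real k + a))" "s / (real k + b) < 0"
    using s ka kb by (auto simp: divide_less_0_iff zero_less_divide_iff)
  ultimately have "(s / (real k + a), s / (real k + b)) \<in> branch_dom s k"
    unfolding branch_dom_def mem_Collect_eq prod.case using O b by (simp only: simp_thms) linarith
  then have "p \<in> branch_img s k" by (simp add: branch_img_def p)
  then show "p \<in> (\<Union>k. branch_img (-1) k) \<union> (\<Union>k. branch_img 1 k)" using s by auto
qed

text \<open>The images of the two halves \<open>x < 0\<close> and \<open>x > 0\<close> cover their union, which has finite measure, and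
  neither is larger than its half; so they cannot overlap in positive measure.\<close>

lemma collisions_null: "emeasure hyp_measure ((\<Union>k. branch_img (-1) k) \<inter> (\<Union>k. branch_img 1 k)) = 0"
proof -
  let ?M = "emeasure hyp_measure"
  let ?A = "\<lambda>s. \<Union>k. branch_dom s k" and ?I = "\<lambda>s. \<Union>k. branch_img s k"
  have [measurable]: "?I (-1) \<in> sets borel" "?I 1 \<in> sets borel" using branch_img_borel by auto
  have "?A (-1) \<inter> ?A 1 = {}" unfolding branch_dom_def by auto
  then have "?M (?A (-1)) + ?M (?A 1) = ?M (?A (-1) \<union> ?A 1)"
    by (intro plus_emeasure) auto
  also have "\<dots> \<le> ?M (?I (-1) \<union> ?I 1)"
    using branch_dom_subset_img by (intro emeasure_mono) auto
  finally have 1: "?M (?A (-1)) + ?M (?A 1) \<le> ?M (?I (-1) \<union> ?I 1)" .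
  have "?A (-1) \<union> ?A 1 \<subseteq> {\<alpha> - 1..\<alpha>} \<times> {..-1}"
  proof
    fix p assume "p \<in> ?A (-1) \<union> ?A 1"
    then obtain x y where p: "p = (x, y)" and "y < 0" "(x, - 1 / y) \<in> O\<alpha>" by (auto simp: branch_dom_def)
    then show "p \<in> {\<alpha> - 1..\<alpha>} \<times> {..-1}"
      using Omega_bounds[of x "- 1 / y"] by (auto simp: field_simps)
  qed
  then have "?M (?A (-1) \<union> ?A 1) \<le> ?M ({\<alpha> - 1..\<alpha>} \<times> {..-1})"
    by (intro emeasure_mono) (auto simp: borel_prod[symmetric])
  also have "\<dots> < \<infinity>" using \<alpha>_pos by (intro emeasure_hyp_strip_finite) simp
  finally have fin: "?M (?A (-1) \<union> ?A 1) < \<infinity>" .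
  have "?M (?I (-1) \<union> ?I 1) + ?M (?I (-1) \<inter> ?I 1) = ?M (?I (-1)) + ?M (?I 1)"
    by (intro emeasure_Un_Int[symmetric]) auto
  also have "\<dots> \<le> ?M (?A (-1)) + ?M (?A 1)"
    by (intro add_mono emeasure_branch_img_le) auto
  also note 1
  finally have le: "?M (?I (-1) \<union> ?I 1) + ?M (?I (-1) \<inter> ?I 1) \<le> ?M (?I (-1) \<union> ?I 1)" .
  have "?M (?I (-1) \<union> ?I 1) \<le> ?M (?I (-1)) + ?M (?I 1)" by (intro emeasure_subadditive) auto
  also have "\<dots> \<le> ?M (?A (-1)) + ?M (?A 1)" by (intro add_mono emeasure_branch_img_le) auto
  also have "\<dots> < \<infinity>" using fin \<open>?M (?A (-1)) + ?M (?A 1) = ?M (?A (-1) \<union> ?A 1)\<close> by simp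
  finally have "?M (?I (-1) \<union> ?I 1) < \<infinity>" .
  with le show ?thesis by (rule ennreal_add_le_imp_zero)
qed

section \<open>Points with two lifts and the Farey map on generic points\<close>

definition generic :: "(real \<times> real) set" where
  "generic = {(x, y). 0 < x \<and> x < 1 \<and> y < 0 \<and> x \<notin> K\<alpha> \<and> y \<notin> K\<alpha>}"

definition double_lifts :: "(real \<times> real) set" where
  "double_lifts = {(x, y) \<in> generic. lift_pos x y \<and> lift_neg (x - 1) (y - 1)}"

definition Farey_fst :: "real \<Rightarrow> real" where
  "Farey_fst x = (if x < 1/2 then x / (1 - x) else 1 / x - 1)"

definition Farey_real :: "real \<times> real \<Rightarrow> real \<times> real" where
  "Farey_real = (\<lambda>(x, y). if x < 1/2 then (x / (1 - x), y / (1 - y)) else (1 / x - 1, 1 / y - 1))"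

lemma fst_Farey_real: "fst (Farey_real p) = Farey_fst (fst p)"
  by (simp add: Farey_real_def Farey_fst_def split_beta)

lemma fst_Farey_real_funpow: "fst ((Farey_real ^^ n) p) = (Farey_fst ^^ n) (fst p)"
  by (induction n) (simp_all add: fst_Farey_real)

lemma K_mobius: "x / (1 - x) \<in> K\<alpha> \<longleftrightarrow> x \<in> K\<alpha>" if "x \<noteq> 1"
proof (cases "x = 0")
  case False
  then have "x / (1 - x) = 1 / (1 / x - 1)" using that by (simp add: field_simps)
  then show ?thesis by (simp add: K_inverse K_shift_one)
qed simp

lemma Farey_fst_bounds:
  assumes "0 < x" "x < 1" "x \<notin> K\<alpha>"
  shows "0 < Farey_fst x" "Farey_fst x < 1" "Farey_fst x \<notin> K\<alpha>"
proof -
  have "x \<noteq> 1/2" using assms(3) K_consts(3) by metis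
  then show "0 < Farey_fst x" "Farey_fst x < 1" using assms by (auto simp: Farey_fst_def field_simps)
  show "Farey_fst x \<notin> K\<alpha>" using assms by (simp add: Farey_fst_def K_mobius K_inverse K_shift_one)
qed

lemma Farey_real_generic:
  assumes "p \<in> generic"
  shows "Farey_real p \<in> generic"
proof -
  obtain x y where p: "p = (x, y)" by (cases p)
  have g: "0 < x" "x < 1" "y < 0" "x \<notin> K\<alpha>" "y \<notin> K\<alpha>" using assms by (auto simp: generic_def p)
  have "y / (1 - y) < 0" "1 / y - 1 < 0" using g(3) by (auto simp: divide_less_0_iff field_simps)
  moreover have "y / (1 - y) \<notin> K\<alpha>" "1 / y - 1 \<notin> K\<alpha>"
    using g(3,5) by (simp_all add: K_mobius K_inverse K_shift_one)
  ultimately show ?thesis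
    using Farey_fst_bounds[OF g(1,2,4)] by (cases "x < 1 / 2") (simp_all add: generic_def Farey_real_def Farey_fst_def p)
qed

lemma generic_borel [measurable]: "generic \<in> sets borel"
proof -
  have "{p \<in> space (borel \<Otimes>\<^sub>M borel). 0 < fst p \<and> fst p < 1 \<and> snd p < 0 \<and> fst p \<notin> K\<alpha> \<and> snd p \<notin> K\<alpha>}
      \<in> sets (borel \<Otimes>\<^sub>M borel)"
    (is "?S \<in> _") by measurable
  moreover have "?S = generic" by (auto simp: generic_def space_pair_measure)
  ultimately show ?thesis by (simp only: pair_borel_eq)
qed

lemma double_lifts_borel [measurable]: "double_lifts \<in> sets borel"
proof -
  have [measurable]: "O\<alpha> \<in> sets (borel \<Otimes>\<^sub>M borel)" "generic \<in> sets (borel \<Otimes>\<^sub>M borel)"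
    using Omega_borel generic_borel unfolding pair_borel_eq .
  have "{p \<in> space (borel \<Otimes>\<^sub>M borel). p \<in> generic \<and> lift_pos (fst p) (snd p) \<and> lift_neg (fst p - 1) (snd p - 1)}
      \<in> sets (borel \<Otimes>\<^sub>M borel)"
    (is "?S \<in> _") unfolding lift_pos_def lift_neg_def by measurable
  moreover have "?S = double_lifts" by (auto simp: double_lifts_def space_pair_measure)
  ultimately show ?thesis by (simp only: pair_borel_eq)
qed

lemma Farey_fst_measurable [measurable]: "Farey_fst \<in> borel_measurable borel"
  unfolding Farey_fst_def by measurable

lemma Farey_real_measurable [measurable]: "Farey_real \<in> borel \<rightarrow>\<^sub>M borel"
  unfolding Farey_real_def borel_prod[symmetric] by measurable

lemma Farey_real_funpow_measurable [measurable]: "Farey_real ^^ n \<in> borel \<rightarrow>\<^sub>M borel"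
  by (induction n) (auto intro: measurable_comp)

lemma preserves_left: "preserves (\<lambda>x. 1 / (1 / x - 1))"
  by (intro preserves_comp[OF preserves_inverse] preserves_comp[OF preserves_diff] preserves_inverse)

lemma preserves_right: "preserves (\<lambda>x. 1 / x - c)"
  by (intro preserves_comp[OF preserves_diff] preserves_inverse)

lemma Farey_real_eq:
  assumes "(x, y) \<in> generic"
  shows "Farey_real (x, y) = (if x < 1/2 then (1 / (1 / x - 1), 1 / (1 / y - 1)) else (1 / x - 1, 1 / y - 1))"
  using assms by (auto simp: Farey_real_def generic_def field_simps)

lemma Farey_real_vimage_null:
  assumes "N \<in> sets borel" "emeasure hyp_measure N = 0"
  shows "emeasure hyp_measure (generic \<inter> Farey_real -` N) = 0"
proof -
  let ?f = "\<lambda>x::real. 1 / (1 / x - 1)" and ?g = "\<lambda>x::real. 1 / x - 1"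
  have "generic \<inter> Farey_real -` N \<subseteq> map_prod ?f ?f -` N \<union> map_prod ?g ?g -` N"
    using Farey_real_eq by (force split: if_splits)
  moreover have "map_prod ?f ?f -` N \<in> null_sets hyp_measure" "map_prod ?g ?g -` N \<in> null_sets hyp_measure"
    using assms preserves_emeasure[OF preserves_left assms(1)] preserves_emeasure[OF preserves_right assms(1)]
      preserves_vimage_sets[OF preserves_left assms(1)] preserves_vimage_sets[OF preserves_right assms(1)]
    by (auto intro!: null_setsI)
  moreover have "generic \<inter> Farey_real -` N \<in> sets hyp_measure"
    using measurable_sets[OF Farey_real_measurable assms(1)] by auto
  ultimately show ?thesis by (meson null_sets.Un null_sets_subset null_setsD1)
qed

lemma Farey_real_funpow_vimage_null:
  assumes "N \<in> sets borel" "emeasure hyp_measure N = 0"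
  shows "generic \<inter> (Farey_real ^^ n) -` N \<in> null_sets hyp_measure"
proof (induction n)
  case 0
  then show ?case using assms by (auto intro!: null_set_Int1)
next
  case (Suc n)
  have eq: "generic \<inter> (Farey_real ^^ Suc n) -` N = generic \<inter> Farey_real -` (generic \<inter> (Farey_real ^^ n) -` N)"
    using Farey_real_generic by (auto simp: funpow_swap1)
  have m: "generic \<inter> (Farey_real ^^ Suc n) -` N \<in> sets borel"
    using measurable_sets[OF Farey_real_funpow_measurable assms(1), of "Suc n"] by (intro sets.Int generic_borel) simp
  have "generic \<inter> (Farey_real ^^ n) -` N \<in> sets borel" "emeasure hyp_measure (generic \<inter> (Farey_real ^^ n) -` N) = 0"
    using Suc by auto
  from Farey_real_vimage_null[OF this] have "emeasure hyp_measure (generic \<inter> (Farey_real ^^ Suc n) -` N) = 0" unfolding eq .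
  then show ?case using m by (intro null_setsI) (simp_all only: sets_hyp)
qed

section \<open>Farey orbits that never exceed 1 / (1 + \<alpha>)\<close>

definition Farey_avoiding :: "real set" where
  "Farey_avoiding = {z. 0 < z \<and> z < 1 \<and> z \<notin> K\<alpha> \<and> (\<forall>n. (Farey_fst ^^ n) z \<le> 1 / (1 + \<alpha>))}"

lemma Farey_fst_funpow_avoiding: "z \<in> Farey_avoiding \<Longrightarrow> (Farey_fst ^^ n) z \<in> Farey_avoiding"
proof (induction n)
  case (Suc n)
  then have *: "(Farey_fst ^^ n) z \<in> Farey_avoiding" by simp
  have "(Farey_fst ^^ m) (Farey_fst ((Farey_fst ^^ n) z)) \<le> 1 / (1 + \<alpha>)" for m
  proof -
    have "(Farey_fst ^^ m) (Farey_fst ((Farey_fst ^^ n) z)) = (Farey_fst ^^ Suc m) ((Farey_fst ^^ n) z)" by (simp add: funpow_swap1)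
    then show ?thesis using * unfolding Farey_avoiding_def by (simp del: funpow.simps)
  qed
  then show ?case using * Farey_fst_bounds unfolding Farey_avoiding_def by simp
qed simp

lemma Farey_fst_funpow:
  assumes "0 < z" "real j + 1 < 1 / z"
  shows "(Farey_fst ^^ j) z = 1 / (1 / z - real j)"
  using assms(2)
proof (induction j)
  case (Suc j)
  let ?w = "1 / z - real j"
  have w: "2 < ?w" using Suc.prems by simp
  then have "1 / ?w < 1 / 2" by (simp add: field_simps)
  moreover have "1 / ?w / (1 - 1 / ?w) = 1 / (?w - 1)"
    using w by (simp add: divide_simps)
  moreover have "(Farey_fst ^^ j) z = 1 / ?w" using Suc by simp
  ultimately have "Farey_fst ((Farey_fst ^^ j) z) = 1 / (?w - 1)" by (simp only: Farey_fst_def if_True)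
  then show ?case by (simp add: algebra_simps)
qed simp

text \<open>With k the floor of 1/z, one Gauss step is k Farey steps, the last of them on the right
  branch. The point just before it is 1 / w with 1 < w < 2; that it does not exceed 1 / (1 +
  \<alpha>) means w \<ge> 1 + \<alpha>, so the Gauss image w - 1 is at least \<alpha>, and it
  differs from \<alpha> off \<open>K\<alpha>\<close>. The next digit is therefore at most 1 /
  \<alpha>.\<close>

lemma Gauss_avoiding:
  assumes "z \<in> Farey_avoiding"
  shows "1 / z - real (nat \<lfloor>1 / z\<rfloor>) \<in> Farey_avoiding" "\<alpha> < 1 / z - real (nat \<lfloor>1 / z\<rfloor>)"
    "(Farey_fst ^^ nat \<lfloor>1 / z\<rfloor>) z = 1 / z - real (nat \<lfloor>1 / z\<rfloor>)"
proof -
  have z: "0 < z" "z < 1" "z \<notin> K\<alpha>" using assms by (auto simp: Farey_avoiding_def)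
  have "1 < 1 / z" using z by simp
  define j where "j = nat \<lfloor>1 / z\<rfloor> - 1"
  have k: "nat \<lfloor>1 / z\<rfloor> = Suc j" using \<open>1 < 1 / z\<close> unfolding j_def by linarith
  have "1 / z \<noteq> real (Suc j)" using z(3) K_inverse[of z] K_consts(6)[of "Suc j"] by metis
  then have j: "real j + 1 < 1 / z" "1 / z < real j + 2" using k by linarith+
  let ?w = "1 / z - real j"
  have w: "(Farey_fst ^^ j) z = 1 / ?w" using Farey_fst_funpow[OF z(1) j(1)] .
  have "\<not> 1 / ?w < 1 / 2" using j by (simp add: field_simps)
  then have F: "(Farey_fst ^^ Suc j) z = 1 / z - real (Suc j)" by (simp add: w Farey_fst_def)
  then show eq: "(Farey_fst ^^ nat \<lfloor>1 / z\<rfloor>) z = 1 / z - real (nat \<lfloor>1 / z\<rfloor>)" unfolding k .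
  show inE: "1 / z - real (nat \<lfloor>1 / z\<rfloor>) \<in> Farey_avoiding" using Farey_fst_funpow_avoiding[OF assms, of "nat \<lfloor>1 / z\<rfloor>"] eq by simp
  have "\<forall>n. (Farey_fst ^^ n) (1 / ?w) \<le> 1 / (1 + \<alpha>)" using Farey_fst_funpow_avoiding[OF assms, of j] unfolding Farey_avoiding_def w by simp
  from spec[OF this, of 0] have "1 / ?w \<le> 1 / (1 + \<alpha>)" by simp
  then have "1 + \<alpha> \<le> ?w" using j \<alpha>_pos by (simp add: field_simps)
  moreover have "1 / z - real (nat \<lfloor>1 / z\<rfloor>) \<noteq> \<alpha>" 
    using inE K_consts(4) unfolding Farey_avoiding_def by (metis (mono_tags, lifting) mem_Collect_eq)
  ultimately show "\<alpha> < 1 / z - real (nat \<lfloor>1 / z\<rfloor>)" unfolding k by simp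
qed

lemma Farey_avoiding_borel [measurable]: "Farey_avoiding \<in> sets borel"
proof -
  have "Farey_fst ^^ n \<in> borel_measurable borel" for n by (induction n) (auto intro: measurable_comp)
  then have [measurable]: "(\<lambda>z. (Farey_fst ^^ n) z) \<in> borel_measurable borel" for n by simp
  have "{z \<in> space borel. 0 < z \<and> z < 1 \<and> z \<notin> K\<alpha> \<and> (\<forall>n. (Farey_fst ^^ n) z \<le> 1 / (1 + \<alpha>))} \<in> sets borel"
    by measurable
  then show ?thesis by (simp add: Farey_avoiding_def)
qed

text \<open>On this set only the branches \<open>(x, y) \<mapsto> (1 / x - k, 1 / y - k)\<close> with \<open>1 \<le> k \<le> N\<close> occur. They carry
  \<open>y < -1\<close> injectively into \<open>-N - 1 < y < -1\<close> and preserve a finite measure, so there is no mass on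
  \<open>y < -N - 1\<close>.\<close>

lemma Farey_avoiding_null: "emeasure lborel (Farey_avoiding \<inter> {\<alpha><..}) = 0"
proof -
  let ?M = "emeasure hyp_measure"
  \<comment> \<open>The digit is known to be bounded only after one Gauss step, hence the
    restriction to z > \<alpha>.\<close>
  define E' where "E' = Farey_avoiding \<inter> {\<alpha><..}"
  define N where "N = nat \<lceil>1 / \<alpha>\<rceil>"
  \<comment> \<open>The branch of digit k maps y < -1 into this band, since -1 < 1 / y < 0. Bands
    for different k are disjoint, so the masses of the images add up.\<close>
  define R where "R = (\<lambda>k::nat. E' \<times> {- real k - 1<..<- real k})"
  define h where "h = (\<lambda>(k::nat) (x::real). 1 / x - real k)"
  have [measurable]: "E' \<in> sets borel" by (simp add: E'_def)
  have Rm: "R k \<in> sets borel" for k unfolding R_def by (simp add: borel_prod[symmetric])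
  let ?P = "E' \<times> {..<-1::real}" and ?Q = "E' \<times> {- real N - 1<..<-1}" and ?T = "E' \<times> {..<- real N - 1}"
  have m: "?P \<in> sets borel" "?Q \<in> sets borel" "?T \<in> sets borel" by (simp_all add: borel_prod[symmetric])
  have "?P \<subseteq> (\<Union>k\<in>{1..N}. map_prod (h k) (h k) -` R k)"
  proof safe
    fix z y :: real assume z: "z \<in> E'" and y: "y < -1"
    define k where "k = nat \<lfloor>1 / z\<rfloor>"
    have "0 < z" "z < 1" "\<alpha> < z" "z \<in> Farey_avoiding" using z by (auto simp: E'_def Farey_avoiding_def)
    then have "1 < 1 / z" "1 / z < 1 / \<alpha>" using \<alpha>_pos by (simp_all add: field_simps)
    then have "1 \<le> k" "k \<le> N" unfolding k_def N_def by linarith+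
    moreover have "1 / z - real k \<in> E'"
      using Gauss_avoiding[OF \<open>z \<in> Farey_avoiding\<close>] by (simp add: E'_def k_def)
    moreover have "-1 < 1 / y" "1 / y < 0" using y by (simp_all add: field_simps)
    ultimately show "(z, y) \<in> (\<Union>k\<in>{1..N}. map_prod (h k) (h k) -` R k)"
      by (auto simp: R_def h_def intro!: bexI[of _ k])
  qed
  then have "?M ?P \<le> ?M (\<Union>k\<in>{1..N}. map_prod (h k) (h k) -` R k)"
    using preserves_vimage_sets[OF preserves_right Rm] by (intro emeasure_mono) (auto simp: h_def)
  also have "\<dots> \<le> (\<Sum>k\<in>{1..N}. ?M (map_prod (h k) (h k) -` R k))"
    using preserves_vimage_sets[OF preserves_right Rm]
    by (intro emeasure_subadditive_finite) (auto simp: h_def)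
  also have "\<dots> = (\<Sum>k\<in>{1..N}. ?M (R k))"
    using preserves_emeasure[OF preserves_right Rm] by (simp add: h_def)
  also have "\<dots> = ?M (\<Union>k\<in>{1..N}. R k)"
  proof (rule sum_emeasure)
    show "disjoint_family_on R {1..N}"
    proof (unfold disjoint_family_on_def, intro ballI impI)
      fix k l :: nat assume "k \<noteq> l"
      then have "real k + 1 \<le> real l \<or> real l + 1 \<le> real k" by linarith
      then show "R k \<inter> R l = {}" unfolding R_def by auto
    qed
  qed (use Rm in auto)
  also have "\<dots> \<le> ?M ?Q"
  proof (intro emeasure_mono)
    show "(\<Union>k\<in>{1..N}. R k) \<subseteq> ?Q"
    proof safe
      fix k z y assume k: "k \<in> {1..N}" "(z, y) \<in> R k"
      then have "1 \<le> real k" "real k \<le> real N" by auto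
      with k show "z \<in> E'" "y \<in> {- real N - 1<..<-1}" by (auto simp: R_def)
    qed
  qed (use m in auto)
  finally have PQ: "?M ?P \<le> ?M ?Q" .
  have "?P \<subseteq> {0..1} \<times> {..-1}" by (auto simp: E'_def Farey_avoiding_def)
  then have "?M ?P \<le> ?M ({0..1} \<times> {..-1})" by (intro emeasure_mono) (auto simp: borel_prod[symmetric])
  also have "\<dots> < \<infinity>" by (intro emeasure_hyp_strip_finite) simp
  finally have fin: "?M ?P < \<infinity>" .
  have "?Q \<inter> ?T = {}" by auto
  then have "?M ?Q + ?M ?T = ?M (?Q \<union> ?T)" using m by (intro plus_emeasure) auto
  also have "\<dots> \<le> ?M ?P" using m by (intro emeasure_mono) auto
  also note PQ
  finally have "?M ?Q + ?M ?T \<le> ?M ?Q" .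
  moreover have "?M ?Q < \<infinity>"
    using m by (intro le_less_trans[OF emeasure_mono fin]) auto
  ultimately have "?M ?T = 0" by (rule ennreal_add_le_imp_zero)
  then have "emeasure lborel ?T = 0"
    using m by (subst null_sets_hyp_iff[symmetric]) (auto simp: E'_def Farey_avoiding_def)
  \<comment> \<open>A null product with a half-line of positive length forces the base E' to be
    null.\<close>
  moreover have "emeasure lborel ?T = emeasure lborel E' * emeasure lborel {..<- real N - 1}"
    unfolding lborel_prod[symmetric] by (intro lborel.emeasure_pair_measure_Times) auto
  moreover have "emeasure lborel {..<- real N - 1} \<noteq> 0"
  proof -
    have "emeasure lborel {- real N - 3<..<- real N - 2} \<le> emeasure lborel {..<- real N - 1}"
      by (intro emeasure_mono) auto
    then show ?thesis by auto
  qed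
  ultimately show ?thesis by (simp add: E'_def)
qed

lemma double_lifts_null: "emeasure hyp_measure double_lifts = 0"
proof -
  \<comment> \<open>The right Farey branch followed by the positive branch of
    \<open>Gauss_ext \<alpha>\<close> of digit k.\<close>
  define \<theta> where "\<theta> = (\<lambda>(k::nat) x. 1 / (1 / x - 1) - real k)"
  define N0 where "N0 = (\<Union>k. branch_img (-1) k) \<inter> (\<Union>k. branch_img 1 k)"
  define N1 where "N1 = (\<Union>k. map_prod (\<theta> k) (\<theta> k) -` N0)"
  define N2 where "N2 = (Farey_avoiding \<inter> {\<alpha><..}) \<times> {..<0::real}"
  have N0: "N0 \<in> sets borel" "emeasure hyp_measure N0 = 0"
    using collisions_null branch_img_borel by (auto simp: N0_def)
  have \<theta>: "preserves (\<theta> k)" for k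
    unfolding \<theta>_def by (intro preserves_comp[OF preserves_diff] preserves_left)
  have "N1 \<in> null_sets hyp_measure"
    unfolding N1_def
    using preserves_vimage_sets[OF \<theta> N0(1)] preserves_emeasure[OF \<theta> N0(1)] N0(2)
    by (intro null_sets_UN null_setsI) auto
  moreover have "N2 \<in> null_sets hyp_measure"
  proof (rule null_setsI)
    have m: "N2 \<in> sets borel" unfolding N2_def by (simp add: borel_prod[symmetric])
    have "emeasure lborel N2 = emeasure lborel (Farey_avoiding \<inter> {\<alpha><..}) * emeasure lborel {..<0::real}"
      unfolding N2_def lborel_prod[symmetric] by (intro lborel.emeasure_pair_measure_Times) auto
    then have "emeasure lborel N2 = 0" by (simp add: Farey_avoiding_null)
    then show "emeasure hyp_measure N2 = 0"
      using m by (subst null_sets_hyp_iff) (auto simp: N2_def Farey_avoiding_def)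
    show "N2 \<in> sets hyp_measure" using m by simp
  qed
  ultimately have N: "N1 \<union> N2 \<in> null_sets hyp_measure" by (rule null_sets.Un)
  then have N': "N1 \<union> N2 \<in> sets borel" "emeasure hyp_measure (N1 \<union> N2) = 0" by auto
  have right: "(x, y) \<in> N1" if dl: "(x, y) \<in> double_lifts" and x: "1 / (1 + \<alpha>) < x" for x y
  proof -
    have g: "0 < x" "x < 1" "y < 0" "x \<notin> K\<alpha>" "y \<notin> K\<alpha>" "lift_pos x y" and lift_neg: "(x - 1, - 1 / (y - 1)) \<in> O\<alpha>"
      using dl by (auto simp: double_lifts_def generic_def lift_neg_def)
    define X where "X = 1 / x - 1"
    define Y where "Y = 1 / y - 1"
    have XY: "(X, - 1 / Y) \<in> O\<alpha>" unfolding X_def Y_def using lift_pos_step_right[OF g(6,4,3) x g(2)] .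
    have X: "0 < X" "X \<notin> K\<alpha>" using g by (simp_all add: X_def K_shift_one K_inverse)
    have "1 / y < 0" using g by simp
    then have Y: "Y < 0" "Y \<notin> K\<alpha>" using g by (simp_all add: Y_def K_shift_one K_inverse)
    define k where "k = nat (digit \<alpha> X)"
    have dk: "real_of_int (digit \<alpha> X) = real k"
      using digit_ge_2[of X] Omega_bounds[OF XY] X by (simp add: k_def)
    have kX: "real k - 1 + \<alpha> < 1 / X" "1 / X < real k + \<alpha>"
      using digit_bounds_strict[OF X(2)] digit_bounds(2)[of X] X(1) by (simp_all add: dk)
    have inv: "1 / (1 / X + 1) = 1 - x" "1 / (1 / Y + 1) = 1 - y" "1 / X + 1 = 1 / (1 - x)"
      using g X Y unfolding X_def Y_def by (simp_all add: divide_simps)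
    have "(X, Y) \<in> branch_dom 1 k" unfolding branch_dom_def using X Y XY kX by simp
    then have "(1 / X - real k, 1 / Y - real k) \<in> branch_img 1 k" unfolding branch_img_def by simp
    \<comment> \<open>The second predecessor is (x - 1, y - 1). Its digit is k + 1, because -1 / (x
      - 1) = 1 / X + 1, and so its image is again 1 / X - k.\<close>
    moreover have "(1 / X - real k, 1 / Y - real k) \<in> branch_img (-1) (Suc k)"
    proof -
      have "-1 / (real (Suc k) + (1 / X - real k)) = - (1 / (1 / X + 1))"
        "-1 / (real (Suc k) + (1 / Y - real k)) = - (1 / (1 / Y + 1))"
        by (simp_all add: add.commute)
      moreover have "(x - 1, y - 1) \<in> branch_dom (-1) (Suc k)"
      proof -
        have "-1 / (x - 1) = 1 / X + 1" unfolding inv(3) using g(2) by (simp add: divide_simps)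
        then show ?thesis unfolding branch_dom_def using g lift_neg kX by (simp add: K_shift_one)
      qed
      ultimately show ?thesis unfolding branch_img_def by (simp add: inv)
    qed
    ultimately have "map_prod (\<theta> k) (\<theta> k) (x, y) \<in> N0"
      unfolding N0_def by (auto simp: \<theta>_def X_def Y_def)
    then show ?thesis by (auto simp: N1_def)
  qed
  \<comment> \<open>Off \<open>N1\<close> the case x > 1 / (1 + \<alpha>) is excluded. For x < 1/2
    each of the two lifts keeps its type; for 1/2 < x < 1 / (1 + \<alpha>) the types are
    exchanged.\<close>
  have step: "Farey_real p \<in> double_lifts" if "p \<in> double_lifts" "p \<notin> N1" for p
  proof -
    obtain x y where p: "p = (x, y)" by (cases p)
    have g: "0 < x" "x < 1" "y < 0" "x \<notin> K\<alpha>" "y \<notin> K\<alpha>" "lift_pos x y" "lift_neg (x - 1) (y - 1)"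
      using that(1) by (auto simp: double_lifts_def generic_def p)
    have "x < 1 / (1 + \<alpha>)"
    proof -
      have "x \<noteq> 1 / (1 + \<alpha>)" using g(4) K_consts(5) by metis
      then show ?thesis using right[of x y] that p by force
    qed
    moreover have "x \<noteq> 1 / 2" using g(4) K_consts(3) by metis
    moreover have "Farey_real p \<in> generic" using Farey_real_generic that(1) by (auto simp: double_lifts_def)
    ultimately show ?thesis
      using lift_pos_step_left[OF g(6)] lift_pos_step_middle[OF g(6,4)] lift_neg_step_left[OF g(7,4)]
        lift_neg_step_right[OF g(7)] g unfolding p double_lifts_def by (auto simp: Farey_real_def)
  qed
  have "double_lifts \<subseteq> (\<Union>n. generic \<inter> (Farey_real ^^ n) -` (N1 \<union> N2))"
  proof
    fix p assume p: "p \<in> double_lifts"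
    then have gen: "p \<in> generic" by (auto simp: double_lifts_def)
    show "p \<in> (\<Union>n. generic \<inter> (Farey_real ^^ n) -` (N1 \<union> N2))"
    proof (rule ccontr)
      assume "\<not> ?thesis"
      then have no: "(Farey_real ^^ n) p \<notin> N1" "(Farey_real ^^ n) p \<notin> N2" for n using gen by auto
      have inZ: "(Farey_real ^^ n) p \<in> double_lifts" for n by (induction n) (use p step no in auto)
      have "(Farey_fst ^^ n) (fst p) \<le> 1 / (1 + \<alpha>)" for n
        unfolding fst_Farey_real_funpow[symmetric]
        using right[of "fst ((Farey_real ^^ n) p)" "snd ((Farey_real ^^ n) p)"] inZ[of n] no(1)[of n]
        by (metis not_le prod.collapse)
      then have av: "fst p \<in> Farey_avoiding" using gen by (auto simp: Farey_avoiding_def generic_def)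
      \<comment> \<open>After this many Farey steps one Gauss step is complete and the first
        coordinate exceeds \<alpha>, so the orbit has entered \<open>N2\<close>.\<close>
      let ?k = "nat \<lfloor>1 / fst p\<rfloor>"
      have "fst ((Farey_real ^^ ?k) p) \<in> Farey_avoiding \<inter> {\<alpha><..}"
        unfolding fst_Farey_real_funpow Gauss_avoiding(3)[OF av] using Gauss_avoiding(1,2)[OF av] by simp
      moreover have "snd ((Farey_real ^^ ?k) p) < 0" using inZ[of ?k] by (auto simp: double_lifts_def generic_def)
      ultimately show False using no(2)[of ?k] by (simp add: N2_def mem_Times_iff)
    qed
  qed
  moreover have "(\<Union>n. generic \<inter> (Farey_real ^^ n) -` (N1 \<union> N2)) \<in> null_sets hyp_measure"
    by (intro null_sets_UN Farey_real_funpow_vimage_null N')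
  ultimately have "double_lifts \<in> null_sets hyp_measure"
    using double_lifts_borel by (auto intro: null_sets_subset)
  then show ?thesis by auto
qed

text \<open>The restricted spaces in \<open>metric_isomorphism\<close> demand exact invariance, so
  every point whose orbit ever meets \<open>double_lifts\<close> is removed.\<close>

definition regular :: "(real \<times> real) set" where
  "regular = {p \<in> generic. \<forall>n. (Farey_real ^^ n) p \<notin> double_lifts}"

lemma regular_subset: "regular \<subseteq> generic - double_lifts"
proof
  fix p assume p: "p \<in> regular"
  then have "(Farey_real ^^ 0) p \<notin> double_lifts" unfolding regular_def by blast
  then show "p \<in> generic - double_lifts" using p by (simp add: regular_def)
qed

lemma Farey_real_regular: "p \<in> regular \<Longrightarrow> Farey_real p \<in> regular"
proof -
  assume p: "p \<in> regular"
  have "(Farey_real ^^ n) (Farey_real p) \<notin> double_lifts" for n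
  proof -
    have "(Farey_real ^^ Suc n) p \<notin> double_lifts" using p unfolding regular_def by blast
    then show ?thesis by (simp add: funpow_swap1)
  qed
  then show "Farey_real p \<in> regular" using p Farey_real_generic by (simp add: regular_def)
qed

lemma regular_borel [measurable]: "regular \<in> sets borel"
proof -
  have "{p \<in> space borel. p \<in> generic \<and> (\<forall>n. (Farey_real ^^ n) p \<notin> double_lifts)} \<in> sets borel" by measurable
  then show ?thesis by (simp add: regular_def)
qed

lemma generic_diff_regular_null: "emeasure hyp_measure (generic - regular) = 0"
proof -
  have "generic - regular = (\<Union>n. generic \<inter> (Farey_real ^^ n) -` double_lifts)" unfolding regular_def by blast
  also have "\<dots> \<in> null_sets hyp_measure"
    by (intro null_sets_UN Farey_real_funpow_vimage_null double_lifts_borel double_lifts_null)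
  finally show ?thesis by auto
qed

text \<open>The left branch has its image in y > -1 and the right branch in y < -1, while y = -1
  does not occur in \<open>generic\<close>. Once \<open>B\<close> is split accordingly, each piece
  of the preimage is a full preimage under one globally defined measure-preserving Moebius
  map.\<close>

lemma emeasure_Farey_real_vimage:
  assumes B: "B \<in> sets borel" "B \<subseteq> regular"
  shows "emeasure hyp_measure (regular \<inter> Farey_real -` B) = emeasure hyp_measure B"
proof -
  let ?M = "emeasure hyp_measure"
  let ?f = "\<lambda>x::real. 1 / (1 / x - 1)" and ?g = "\<lambda>x::real. 1 / x - 1"
  define U where "U = B \<inter> UNIV \<times> {-1<..}"
  define W where "W = B \<inter> UNIV \<times> {..<-1}"
  have UWm: "U \<in> sets borel" "W \<in> sets borel"
    unfolding U_def W_def using B by (auto simp: borel_prod[symmetric])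
  have inG: "p \<in> generic" if "p \<in> B" for p using that B regular_subset by blast
  have B_eq: "B = U \<union> W" "U \<inter> W = {}"
    unfolding U_def W_def using inG K_uminus[of 1] by (auto simp: generic_def not_less less_le)
  have U1: "generic \<inter> {p. fst p < 1/2} \<inter> Farey_real -` B \<subseteq> map_prod ?f ?f -` U"
  proof
    fix p assume p: "p \<in> generic \<inter> {p. fst p < 1/2} \<inter> Farey_real -` B"
    obtain x y where xy: "p = (x, y)" by (cases p)
    have "Farey_real (x, y) = (?f x, ?f y)" using p Farey_real_eq by (auto simp: xy)
    moreover have "-1 < ?f y" using p by (auto simp: xy generic_def field_simps)
    ultimately show "p \<in> map_prod ?f ?f -` U" using p by (auto simp: xy U_def)
  qed
  have U2: "map_prod ?f ?f -` U \<subseteq> generic \<inter> {p. fst p < 1/2} \<inter> Farey_real -` B"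
  proof
    fix p assume p: "p \<in> map_prod ?f ?f -` U"
    obtain x y where xy: "p = (x, y)" by (cases p)
    have f: "(?f x, ?f y) \<in> B" "-1 < ?f y" using p by (auto simp: xy U_def)
    have g: "0 < ?f x" "?f x < 1" "?f y < 0" "?f x \<notin> K\<alpha>" "?f y \<notin> K\<alpha>"
      using inG[OF f(1)] by (auto simp: generic_def)
    then have K: "x \<notin> K\<alpha>" "y \<notin> K\<alpha>" by (simp_all add: K_inverse K_shift_one)
    have "0 < 1 / x - 1" using g(1) by simp
    then have "1 < 1 / x - 1" using g(2) by (simp only: divide_less_eq_1_pos)
    then have "0 < 1 / x" "2 < 1 / x" by linarith+
    then have x: "0 < x" "x < 1/2" by (simp_all add: field_simps)
    have aux: "w < -1" if "w < 0" "-1 < 1 / w" for w :: real using that by (simp add: field_simps)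
    have "1 / y - 1 < 0" using g(3) by simp
    then have "1 / y - 1 < -1" using f(2) by (intro aux)
    then have "y < 0" by simp
    then have "(x, y) \<in> generic" using x K by (simp add: generic_def)
    then show "p \<in> generic \<inter> {p. fst p < 1/2} \<inter> Farey_real -` B" using Farey_real_eq x f(1) by (simp add: xy)
  qed
  have W1: "generic \<inter> {p. 1/2 < fst p} \<inter> Farey_real -` B \<subseteq> map_prod ?g ?g -` W"
  proof
    fix p assume p: "p \<in> generic \<inter> {p. 1/2 < fst p} \<inter> Farey_real -` B"
    obtain x y where xy: "p = (x, y)" by (cases p)
    have "Farey_real (x, y) = (?g x, ?g y)" using p Farey_real_eq by (auto simp: xy)
    moreover have "?g y < -1" using p by (auto simp: xy generic_def)
    ultimately show "p \<in> map_prod ?g ?g -` W" using p by (auto simp: xy W_def)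
  qed
  have W2: "map_prod ?g ?g -` W \<subseteq> generic \<inter> {p. 1/2 < fst p} \<inter> Farey_real -` B"
  proof
    fix p assume p: "p \<in> map_prod ?g ?g -` W"
    obtain x y where xy: "p = (x, y)" by (cases p)
    have f: "(?g x, ?g y) \<in> B" "?g y < -1" using p by (auto simp: xy W_def)
    have g: "0 < ?g x" "?g x < 1" "?g x \<notin> K\<alpha>" "?g y \<notin> K\<alpha>"
      using inG[OF f(1)] by (auto simp: generic_def)
    then have K: "x \<notin> K\<alpha>" "y \<notin> K\<alpha>" by (simp_all add: K_inverse K_shift_one)
    have "0 < 1 / x" using g(1) by linarith
    then have "0 < x" by simp
    then have x: "1/2 < x" "x < 1" using g(1,2) by (simp_all add: field_simps)
    have "y < 0" using f(2) by simp
    then have "(x, y) \<in> generic" using x K by (simp add: generic_def)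
    then show "p \<in> generic \<inter> {p. 1/2 < fst p} \<inter> Farey_real -` B" using Farey_real_eq x f(1) by (simp add: xy)
  qed
  have half: "p \<in> generic \<Longrightarrow> fst p < 1/2 \<or> 1/2 < fst p" for p
    using K_consts(3) by (metis (no_types, lifting) generic_def case_prod_beta linorder_neqE_linordered_idom mem_Collect_eq)
  note U = equalityI[OF U1 U2] and W = equalityI[OF W1 W2]
  have eq: "generic \<inter> Farey_real -` B = map_prod ?f ?f -` U \<union> map_prod ?g ?g -` W"
    unfolding U[symmetric] W[symmetric] using half by blast
  have disj: "map_prod ?f ?f -` U \<inter> map_prod ?g ?g -` W = {}"
    unfolding U[symmetric] W[symmetric] by auto
  note m = preserves_vimage_sets[OF preserves_left UWm(1)] preserves_vimage_sets[OF preserves_right UWm(2)]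
  have "?M (generic \<inter> Farey_real -` B) = ?M (map_prod ?f ?f -` U) + ?M (map_prod ?g ?g -` W)"
    unfolding eq using m disj by (intro plus_emeasure[symmetric]) auto
  also have "\<dots> = ?M U + ?M W"
    by (simp only: preserves_emeasure[OF preserves_left UWm(1)] preserves_emeasure[OF preserves_right UWm(2)])
  also have "\<dots> = ?M B" unfolding B_eq(1) using UWm B_eq(2) by (intro plus_emeasure) auto
  finally have "?M (generic \<inter> Farey_real -` B) = ?M B" .
  moreover have "regular \<inter> Farey_real -` B = generic \<inter> Farey_real -` B - (generic - regular)" by (auto simp: regular_def)
  moreover have "?M (generic \<inter> Farey_real -` B - (generic - regular)) = ?M (generic \<inter> Farey_real -` B)"
    using generic_diff_regular_null m eq by (intro emeasure_Diff_null_set null_setsI) auto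
  ultimately show ?thesis by simp
qed

section \<open>The domain of the alpha-Farey map\<close>

lemma Omega_star_ereal_iff: "(x, ereal y) \<in> Omega_star \<alpha> \<longleftrightarrow> y \<noteq> 0 \<and> (x, - 1 / y) \<in> O\<alpha>"
  by (auto simp: Omega_star_def mob_neg_inverse_ereal)

lemma Omega_star_bounds:
  assumes "(x, y) \<in> Omega_star \<alpha>"
  shows "\<alpha> - 1 \<le> x" "x \<le> \<alpha>" "y \<le> -1"
proof -
  obtain t where t: "mob 0 (-1) 1 0 y = ereal t" "(x, t) \<in> O\<alpha>"
    using assms by (auto simp: Omega_star_def)
  note b = Omega_bounds[OF t(2)]
  show "\<alpha> - 1 \<le> x" "x \<le> \<alpha>" using b by auto
  show "y \<le> -1"
  proof (cases y)
    case (real r)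
    then have "r \<noteq> 0" "t = - 1 / r" using t(1) by (auto simp: mob_neg_inverse_ereal split: if_splits)
    then have r: "r \<noteq> 0" "0 \<le> - 1 / r" "- 1 / r \<le> 1" using b by auto
    then have "r < 0" by (auto simp: zero_le_divide_iff)
    then have "r \<le> -1" using r(3) by (simp add: field_simps)
    then show ?thesis using real by (simp add: one_ereal_def)
  qed (use t(1) in \<open>auto simp: mob_def\<close>)
qed

text \<open>The two inversions cancel: t is the original coordinate of
  \<open>Omega \<alpha>\<close>, and the point of \<open>Omega_star \<alpha>\<close> at -\<infinity>
  appears as t = 0.\<close>

lemma Omega_star_neg_inverse_iff:
  "(x, mob 0 (-1) 1 0 y) \<in> Omega_star \<alpha> \<longleftrightarrow> (\<exists>t. y = ereal t \<and> (x, t) \<in> O\<alpha>)"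
  by (cases y) (auto simp: Omega_star_def mob_def)

lemma Omega_star_inverse_iff:
  "(x, mob 0 1 1 0 y) \<in> Omega_star \<alpha> \<longleftrightarrow> (\<exists>t. y = ereal (- t) \<and> (x, t) \<in> O\<alpha>)"
proof (cases y)
  case (real r)
  have "(\<exists>t. r = - t \<and> (x, t) \<in> O\<alpha>) \<longleftrightarrow> (x, - r) \<in> O\<alpha>" by (metis minus_minus)
  then show ?thesis using real by (auto simp: Omega_star_def mob_def)
qed (auto simp: Omega_star_def mob_def)

text \<open>The two defining inequalities amount to 1 / \<alpha> - \<alpha> \<le> k < 1 / \<alpha> -
  \<alpha> + 1, so the definite description has exactly one solution.\<close>

lemma k0_props: "1 / (of_int (k0 \<alpha>) + \<alpha>) \<le> \<alpha>" "\<alpha> < 1 / (of_int (k0 \<alpha>) - 1 + \<alpha>)"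
  and k0_eq: "k0 \<alpha> = \<lceil>1 / \<alpha> - \<alpha>\<rceil>" and k0_ge_2: "2 \<le> k0 \<alpha>"
proof -
  let ?P = "\<lambda>k. 1 / (real_of_int k + \<alpha>) \<le> \<alpha> \<and> \<alpha> < 1 / (real_of_int k - 1 + \<alpha>)"
  let ?c = "\<lceil>1 / \<alpha> - \<alpha>\<rceil>"
  have P_iff: "?P k \<longleftrightarrow> k = ?c" for k
  proof -
    have "2 < 1 / \<alpha>" using \<alpha>_pos \<alpha>_less_half by (simp add: field_simps)
    then have c: "2 \<le> ?c" "real_of_int ?c - 1 < 1 / \<alpha> - \<alpha>" "1 / \<alpha> - \<alpha> \<le> real_of_int ?c"
      using \<alpha>_less_half by linarith+
    have "?P k" if k: "2 \<le> k" "real_of_int k - 1 < 1 / \<alpha> - \<alpha>" "1 / \<alpha> - \<alpha> \<le> real_of_int k" for k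
    proof
      have "1 / \<alpha> \<le> of_int k + \<alpha>" "0 < of_int k + \<alpha>" using k \<alpha>_pos by linarith+
      then show "1 / (of_int k + \<alpha>) \<le> \<alpha>" using \<alpha>_pos by (simp add: field_simps)
      have "of_int k - 1 + \<alpha> < 1 / \<alpha>" "0 < of_int k - 1 + \<alpha>" using k \<alpha>_pos by linarith+
      then show "\<alpha> < 1 / (of_int k - 1 + \<alpha>)" using \<alpha>_pos by (simp add: field_simps)
    qed
    moreover have "k = ?c" if P: "?P k"
    proof -
      have "0 < 1 / (of_int k - 1 + \<alpha>)" using P \<alpha>_pos by linarith
      then have pos: "0 < of_int k - 1 + \<alpha>" by simp
      then have "of_int k - 1 + \<alpha> < 1 / \<alpha>" "1 / \<alpha> \<le> of_int k + \<alpha>"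
        using P \<alpha>_pos by (simp_all add: field_simps)
      then show ?thesis by linarith
    qed
    ultimately show ?thesis using c by blast
  qed
  show eq: "k0 \<alpha> = ?c" unfolding k0_def P_iff by simp
  show "1 / (of_int (k0 \<alpha>) + \<alpha>) \<le> \<alpha>" "\<alpha> < 1 / (of_int (k0 \<alpha>) - 1 + \<alpha>)" using P_iff eq by auto
  have "2 < 1 / \<alpha>" using \<alpha>_pos \<alpha>_less_half by (simp add: field_simps)
  then show "2 \<le> k0 \<alpha>" unfolding eq using \<alpha>_less_half by linarith
qed

lemma Upsilon_iff:
  "(x, y) \<in> Upsilon \<alpha> \<longleftrightarrow> (\<exists>j k. 1 \<le> j \<and> j + 1 \<le> k \<and>
     ((x + of_int (k - j), y + ereal (of_int (k - j))) \<in> hat_minus \<alpha> k \<or>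
      (x + of_int (k - j), y + ereal (of_int (k - j))) \<in> hat_plus \<alpha> k))"
proof -
  have "y - ereal (- c) = y + ereal c" for c by (cases y) auto
  then show ?thesis
    unfolding Upsilon_def Upsilon_level_def by (auto simp: shift_iff simp del: of_int_diff)
qed

lemma hat_minusD:
  assumes "(x, y) \<in> hat_minus \<alpha> k" "2 \<le> k"
  obtains t where "y = ereal t" "(- 1 / x, t) \<in> O\<alpha>" "1 < x" "k = 2 \<or> of_int k - 1 + \<alpha> < x"
proof -
  have star: "(- 1 / x, mob 0 (-1) 1 0 y) \<in> Omega_star \<alpha>"
    and c2: "k = 2 \<Longrightarrow> \<alpha> - 1 < - 1 / x \<and> - 1 / x \<le> - 1 / (2 + \<alpha>)"
    and c3: "k \<noteq> 2 \<Longrightarrow> - 1 / (of_int k - 1 + \<alpha>) < - 1 / x \<and> - 1 / x \<le> - 1 / (of_int k + \<alpha>)"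
    using assms(1) by (auto simp: hat_minus_def cyl_minus_def split: if_splits)
  obtain t where t: "y = ereal t" "(- 1 / x, t) \<in> O\<alpha>"
    using star unfolding Omega_star_neg_inverse_iff by blast
  have "0 < 1 / (2 + \<alpha>)" "0 < 1 / (of_int k + \<alpha>)" using \<alpha>_pos assms(2) by (simp_all add: add_pos_pos)
  moreover have "1 / (2 + \<alpha>) \<le> 1 / x \<or> 1 / (of_int k + \<alpha>) \<le> 1 / x" using c2 c3 by (cases "k = 2") auto
  ultimately have "0 < 1 / x" by linarith
  then have x: "0 < x" by simp
  have "1 < x" if "k = 2"
  proof -
    have "1 / x < 1" using c2 that \<alpha>_pos by auto
    then show ?thesis using x by (simp add: field_simps)
  qed
  moreover have "of_int k - 1 + \<alpha> < x" if "k \<noteq> 2"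
    using c3[OF that] x \<alpha>_pos assms(2) by (simp add: field_simps)
  moreover have "1 < of_int k - 1 + \<alpha>" if "k \<noteq> 2" using that assms(2) \<alpha>_pos by linarith
  ultimately have "1 < x" "k = 2 \<or> of_int k - 1 + \<alpha> < x" by force+
  then show ?thesis using t that by blast
qed

lemma hat_plusD:
  assumes "(x, y) \<in> hat_plus \<alpha> k"
  obtains t where "y = ereal (- t)" "(1 / x, t) \<in> O\<alpha>" "of_int k - 1 + \<alpha> \<le> x"
proof -
  have star: "(1 / x, mob 0 1 1 0 y) \<in> Omega_star \<alpha>" and k: "k0 \<alpha> \<le> k"
    and c0: "1 / (of_int k + \<alpha>) < 1 / x" and c1: "k = k0 \<alpha> \<Longrightarrow> 1 / x < \<alpha>"
    and c2: "k \<noteq> k0 \<alpha> \<Longrightarrow> 1 / x \<le> 1 / (of_int k - 1 + \<alpha>)"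
    using assms(1) by (auto simp: hat_plus_def cyl_plus_def split: if_splits)
  obtain t where t: "y = ereal (- t)" "(1 / x, t) \<in> O\<alpha>"
    using star unfolding Omega_star_inverse_iff by blast
  have k1: "0 < of_int k - 1 + \<alpha>" using k k0_ge_2 \<alpha>_pos by linarith
  have "0 < 1 / (of_int k + \<alpha>)" using k1 by simp
  then have "0 < 1 / x" using c0 by linarith
  then have x: "0 < x" by simp
  have "1 / x \<le> 1 / (of_int k - 1 + \<alpha>)" using c1 c2 k0_props(2) by (cases "k = k0 \<alpha>") auto
  then have "of_int k - 1 + \<alpha> \<le> x" using x k1 by (simp add: field_simps)
  then show ?thesis using t that by blast
qed

text \<open>Only the difference i = k - j survives. Positivity of x comes from the cylinder: x + i
  \<ge> k - 1 + \<alpha> gives x \<ge> j - 1 + \<alpha>, and in the exceptional negative cylinder k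
  = 2 only i = 1 is possible, where x + 1 > 1.\<close>

lemma UpsilonD:
  assumes "(x, y) \<in> Upsilon \<alpha>"
  obtains i :: nat and t where "1 \<le> i" "0 < x" "y = ereal (t - real i)" "(- 1 / (x + real i), t) \<in> O\<alpha>"
  | i :: nat and t where "1 \<le> i" "0 < x" "y = ereal (- t - real i)" "(1 / (x + real i), t) \<in> O\<alpha>"
proof -
  obtain j k where jk: "1 \<le> j" "j + 1 \<le> k" and h: "(x + of_int (k - j), y + ereal (of_int (k - j))) \<in> hat_minus \<alpha> k \<or>
      (x + of_int (k - j), y + ereal (of_int (k - j))) \<in> hat_plus \<alpha> k"
    using assms unfolding Upsilon_iff by blast
  define i where "i = nat (k - j)"
  have i: "1 \<le> i" "real_of_int (k - j) = real i" using jk unfolding i_def by auto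
  have y: "y + ereal c = ereal t \<Longrightarrow> y = ereal (t - c)" for c t by (cases y) auto
  from h consider "(x + real i, y + ereal (real i)) \<in> hat_minus \<alpha> k" | "(x + real i, y + ereal (real i)) \<in> hat_plus \<alpha> k"
    unfolding i(2) by blast
  then show ?thesis
  proof cases
    case 1
    then obtain t where t: "y + ereal (real i) = ereal t" "(- 1 / (x + real i), t) \<in> O\<alpha>"
      "1 < x + real i" "k = 2 \<or> of_int k - 1 + \<alpha> < x + real i"
      using hat_minusD[OF 1] jk by auto
    have "0 < x"
    proof (cases "k = 2")
      case True
      then have "i = 1" using jk unfolding i_def by simp
      then show ?thesis using t(3) by simp
    next
      case False
      then have "of_int k - 1 + \<alpha> < x + real i" using t(4) by blast
      moreover have "real i = of_int k - of_int j" "1 \<le> real_of_int j" using i(2) jk by simp_all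
      ultimately show ?thesis using \<alpha>_pos by linarith
    qed
    then show ?thesis using that(1)[OF i(1) _ y[OF t(1)] t(2)] by blast
  next
    case 2
    then obtain t where t: "y + ereal (real i) = ereal (- t)" "(1 / (x + real i), t) \<in> O\<alpha>"
      "of_int k - 1 + \<alpha> \<le> x + real i"
      using hat_plusD[OF 2] by blast
    moreover have "real i = of_int k - of_int j" "1 \<le> real_of_int j" using i(2) jk by simp_all
    ultimately have "0 < x" using \<alpha>_pos by linarith
    then show ?thesis using that(2)[OF i(1) _ y[OF t(1)] t(2)] by blast
  qed
qed

text \<open>Conversely x determines its level through j - 1 + \<alpha> < x < j + \<alpha>, and then
  k = i + j; the condition x > 1 ensures j \<ge> 1.\<close>

lemma Upsilon_minusI:
  assumes "1 < x" "x \<notin> K\<alpha>" "1 \<le> (i::nat)" "(- 1 / (x + real i), t) \<in> O\<alpha>"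
  shows "(x, ereal (t - real i)) \<in> Upsilon \<alpha>"
proof -
  define j where "j = \<lfloor>x + 1 - \<alpha>\<rfloor>"
  have jx: "of_int j - 1 + \<alpha> \<le> x" "x < of_int j + \<alpha>" unfolding j_def by linarith+
  have "x \<noteq> of_int j - 1 + \<alpha>" using assms(2) K_add_\<alpha>[of "j - 1"] by auto
  then have jx1: "of_int j - 1 + \<alpha> < x" using jx by simp
  have j1: "1 \<le> j" using assms(1) \<alpha>_less_half unfolding j_def by linarith
  define k where "k = j + int i"
  have k: "real_of_int k = of_int j + real i" "j + 1 \<le> k" "k - j = int i" using assms(3) by (simp_all add: k_def)
  let ?w = "x + real i"
  have w: "of_int k - 1 + \<alpha> < ?w" "?w < of_int k + \<alpha>" using jx jx1 k(1) by linarith+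
  have pos: "0 < of_int k - 1 + \<alpha>" using k(2) j1 \<alpha>_pos by linarith
  have "- 1 / ?w \<notin> K\<alpha>" using assms(2) by (simp add: K_uminus K_inverse K_add_nat)
  then have "\<alpha> - 1 < - 1 / ?w" using Omega_bounds_strict[OF assms(4)] by simp
  moreover have "- 1 / (of_int k - 1 + \<alpha>) < - 1 / ?w" "- 1 / ?w \<le> - 1 / (of_int k + \<alpha>)"
    using w pos by (simp_all add: field_simps)
  moreover have "(- 1 / ?w, mob 0 (-1) 1 0 (ereal t)) \<in> Omega_star \<alpha>"
    using assms(4) unfolding Omega_star_neg_inverse_iff by blast
  ultimately have "(?w, ereal t) \<in> hat_minus \<alpha> k"
    unfolding hat_minus_def cyl_minus_def by auto
  moreover have "(x + of_int (k - j), ereal (t - real i) + ereal (of_int (k - j))) = (?w, ereal t)"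
    using k(3) by simp
  ultimately show ?thesis unfolding Upsilon_iff using j1 k(2) by metis
qed

lemma Upsilon_plusI:
  assumes "1 < x" "x \<notin> K\<alpha>" "1 \<le> (i::nat)" "(1 / (x + real i), t) \<in> O\<alpha>"
  shows "(x, ereal (- t - real i)) \<in> Upsilon \<alpha>"
proof -
  define j where "j = \<lfloor>x + 1 - \<alpha>\<rfloor>"
  have jx: "of_int j - 1 + \<alpha> \<le> x" "x < of_int j + \<alpha>" unfolding j_def by linarith+
  have "x \<noteq> of_int j - 1 + \<alpha>" using assms(2) K_add_\<alpha>[of "j - 1"] by auto
  then have jx1: "of_int j - 1 + \<alpha> < x" using jx by simp
  have j1: "1 \<le> j" using assms(1) \<alpha>_less_half unfolding j_def by linarith
  define k where "k = j + int i"
  have k: "real_of_int k = of_int j + real i" "j + 1 \<le> k" "k - j = int i" using assms(3) by (simp_all add: k_def)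
  let ?w = "x + real i"
  have w: "of_int k - 1 + \<alpha> < ?w" "?w < of_int k + \<alpha>" using jx jx1 k(1) by linarith+
  have pos: "0 < of_int k - 1 + \<alpha>" using k(2) j1 \<alpha>_pos by linarith
  have w0: "0 < ?w" using assms(1) by simp
  have "1 / ?w \<notin> K\<alpha>" using assms(2) by (simp add: K_inverse K_add_nat)
  \<comment> \<open>The strict bound gives \<open>k0 \<alpha> \<le> k\<close> and also the open
    right end of the cylinder k = k0.\<close>
  then have lt: "1 / ?w < \<alpha>" using Omega_bounds_strict[OF assms(4)] by simp
  then have "1 / \<alpha> < ?w" using w0 \<alpha>_pos by (simp add: field_simps)
  then have "k0 \<alpha> \<le> k" unfolding k0_eq ceiling_le_iff using w by linarith
  moreover have "1 / (of_int k + \<alpha>) < 1 / ?w" "1 / ?w \<le> 1 / (of_int k - 1 + \<alpha>)"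
    using w w0 pos by (simp_all add: field_simps)
  moreover have "(1 / ?w, mob 0 1 1 0 (ereal (- t))) \<in> Omega_star \<alpha>"
    using assms(4) unfolding Omega_star_inverse_iff by blast
  ultimately have "(?w, ereal (- t)) \<in> hat_plus \<alpha> k"
    unfolding hat_plus_def cyl_plus_def using lt by auto
  moreover have "(x + of_int (k - j), ereal (- t - real i) + ereal (of_int (k - j))) = (?w, ereal (- t))"
    using k(3) by simp
  ultimately show ?thesis unfolding Upsilon_iff using j1 k(2) by metis
qed

lemma Upsilon_inv_bounds:
  assumes "(x, y) \<in> Upsilon_inv \<alpha>"
  shows "0 < x" "y \<le> 0"
proof -
  have U: "(1 / x, mob 0 1 1 0 y) \<in> Upsilon \<alpha>" using assms by (simp add: Upsilon_inv_def)
  then have "0 < 1 / x \<and> (\<exists>c. mob 0 1 1 0 y = ereal c \<and> c \<le> 0)"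
  proof (cases rule: UpsilonD)
    case (1 i t)
    then show ?thesis using Omega_bounds[of _ t] by (intro conjI exI[of _ "t - real i"]) force+
  next
    case (2 i t)
    then show ?thesis using Omega_bounds[of _ t] by (intro conjI exI[of _ "- t - real i"]) force+
  qed
  then obtain c where c: "0 < 1 / x" "mob 0 1 1 0 y = ereal c" "c \<le> 0" by blast
  then show "0 < x" by simp
  show "y \<le> 0"
    using c(2,3) by (cases y) (auto simp: mob_def divide_le_0_iff split: if_splits)
qed

text \<open>\<open>Upsilon_inv \<alpha>\<close> lies entirely over x > 0.\<close>

lemma V_minus_iff_Omega_star: "(x, y) \<in> V_minus \<alpha> \<longleftrightarrow> x < 0 \<and> (x, y) \<in> Omega_star \<alpha>"
  using Upsilon_inv_bounds(1)[of x y] by (auto simp: V_minus_def V_flat_def V_def)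

lemma V_minus_iff: "y \<noteq> 0 \<Longrightarrow> (x, ereal y) \<in> V_minus \<alpha> \<longleftrightarrow> lift_neg x y"
  by (simp add: V_minus_iff_Omega_star Omega_star_ereal_iff lift_neg_def)

text \<open>The index 0 corresponds to \<open>Omega_star \<alpha>\<close> and the indices i \<ge> 1
  to \<open>Upsilon_inv \<alpha>\<close>; x < 1 makes 1 / x > 1, as the introduction rules for
  \<open>Upsilon \<alpha>\<close> demand.\<close>

lemma V_plus_iff:
  assumes "(x, y) \<in> generic"
  shows "(x, ereal y) \<in> V_plus \<alpha> \<longleftrightarrow> lift_pos x y"
proof
  have g: "0 < x" "x < 1" "y < 0" "x \<notin> K\<alpha>" using assms by (auto simp: generic_def)
  have m: "mob 0 1 1 0 (ereal y) = ereal (1 / y)" using g by (simp add: mob_inverse_ereal)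
  show "lift_pos x y" if "(x, ereal y) \<in> V_plus \<alpha>"
  proof -
    from that consider "(x, ereal y) \<in> Omega_star \<alpha>" | "(x, ereal y) \<in> Upsilon_inv \<alpha>"
      by (auto simp: V_plus_def V_flat_def V_def)
    then show ?thesis
    proof cases
      case 1
      then show ?thesis using lift_posI_Omega by (simp add: Omega_star_ereal_iff)
    next
      case 2
      then have "(1 / x, ereal (1 / y)) \<in> Upsilon \<alpha>" by (simp add: Upsilon_inv_def m)
      then show ?thesis
      proof (cases rule: UpsilonD)
        case (1 i t)
        then have "t = real i + 1 / y" by simp
        then show ?thesis using lift_posI_minus[OF 1(1)] 1(4) by blast
      next
        case (2 i t)
        then have "t = - 1 / y - real i" by simp
        then show ?thesis using lift_posI_plus 2(4) by blast
      qed
    qed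
  qed
  show "(x, ereal y) \<in> V_plus \<alpha>" if "lift_pos x y"
  proof -
    have x: "1 < 1 / x" "1 / x \<notin> K\<alpha>" using g by (simp_all add: K_inverse)
    from that consider i :: nat where "(1::nat) \<le> i" "(- 1 / (1 / x + real i), real i + 1 / y) \<in> O\<alpha>"
      | i :: nat where "(1 / (1 / x + real i), - 1 / y - real i) \<in> O\<alpha>"
      unfolding lift_pos_def by blast
    then have "(x, ereal y) \<in> V \<alpha>"
    proof cases
      case 1
      then have "(1 / x, ereal (1 / y)) \<in> Upsilon \<alpha>" using Upsilon_minusI[OF x 1] by simp
      then show ?thesis by (simp add: V_def Upsilon_inv_def m)
    next
      case 2
      show ?thesis
      proof (cases "i = 0")
        case True
        then show ?thesis using 2 g by (simp add: V_def Omega_star_ereal_iff)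
      next
        case False
        then have "(1 / x, ereal (1 / y)) \<in> Upsilon \<alpha>" using Upsilon_plusI[OF x _ 2] by simp
        then show ?thesis by (simp add: V_def Upsilon_inv_def m)
      qed
    qed
    then show ?thesis using g by (simp add: V_plus_def V_flat_def)
  qed
qed

lemma D1_iff: "(x, y) \<in> D1 \<alpha> \<longleftrightarrow> (x - 1, y - 1) \<in> V_minus \<alpha>"
  by (simp add: D1_def shift_iff one_ereal_def)

lemma D1_iff_lift_neg: "y < 0 \<Longrightarrow> (x, ereal y) \<in> D1 \<alpha> \<longleftrightarrow> lift_neg (x - 1) (y - 1)"
  using V_minus_iff[of "y - 1" "x - 1"] by (simp add: D1_iff one_ereal_def)

lemma V_plus_subset_V1: "V_plus \<alpha> \<subseteq> V1"
  using Omega_star_bounds(3) Upsilon_inv_bounds(2)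
  by (force simp: V_plus_def V_flat_def V_def V1_def intro: order_trans)

lemma D1_subset_V1: "D1 \<alpha> \<subseteq> V1"
proof
  fix p assume p: "p \<in> D1 \<alpha>"
  obtain x y where xy: "p = (x, y)" by (cases p)
  have "x - 1 < 0" "(x - 1, y - 1) \<in> Omega_star \<alpha>" using p by (auto simp: xy D1_iff V_minus_iff_Omega_star)
  then show "p \<in> V1" using Omega_star_bounds[of "x - 1" "y - 1"] \<alpha>_pos
    by (cases y) (auto simp: xy V1_def one_ereal_def)
qed

lemma D_subset_V1: "D \<alpha> \<subseteq> V1"
  using V_plus_subset_V1 D1_subset_V1 by (auto simp: D_def D2_def)

section \<open>Borel measurability of the sets in the statement\<close>

lemma pair_borel_ereal: "sets (borel \<Otimes>\<^sub>M borel) = sets (borel :: (real \<times> ereal) measure)"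
  by (simp only: borel_prod)

lemma vimage_pair_borel:
  assumes "S \<in> sets (borel :: (real \<times> ereal) measure)" "f \<in> borel_measurable borel" "g \<in> borel_measurable borel"
  shows "{(x, y). (f x, g y) \<in> S} \<in> sets (borel :: (real \<times> ereal) measure)"
proof -
  note [measurable] = assms(2,3)
  have [measurable]: "S \<in> sets (borel \<Otimes>\<^sub>M borel)" using assms(1) by (simp only: pair_borel_ereal)
  have "{p \<in> space (borel \<Otimes>\<^sub>M borel). (f (fst p), g (snd p)) \<in> S} \<in> sets (borel \<Otimes>\<^sub>M borel)" (is "?S \<in> _")
    by measurable
  moreover have "?S = {(x, y). (f x, g y) \<in> S}" by (auto simp: space_pair_measure)
  ultimately show ?thesis by (simp only: pair_borel_ereal)
qed

lemma restrict_fst_borel: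
  assumes "S \<in> sets (borel :: (real \<times> ereal) measure)" "T \<in> sets borel"
  shows "{(x, y) \<in> S. x \<in> T} \<in> sets (borel :: (real \<times> ereal) measure)"
proof -
  have "{(x, y) \<in> S. x \<in> T} = S \<inter> T \<times> UNIV" by auto
  moreover have "T \<times> UNIV \<in> sets (borel \<Otimes>\<^sub>M (borel :: ereal measure))" using assms(2) by auto
  ultimately show ?thesis using assms(1) by (simp only: pair_borel_ereal sets.Int)
qed

lemma Omega_star_borel: "Omega_star \<alpha> \<in> sets borel"
proof -
  have [measurable]: "O\<alpha> \<in> sets (borel \<Otimes>\<^sub>M borel)" using Omega_borel unfolding pair_borel_eq .
  have "{p \<in> space (borel \<Otimes>\<^sub>M borel). \<bar>mob 0 (-1) 1 0 (snd p)\<bar> \<noteq> \<infinity> \<and>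
      (fst p, real_of_ereal (mob 0 (-1) 1 0 (snd p))) \<in> O\<alpha>} \<in> sets (borel \<Otimes>\<^sub>M (borel :: ereal measure))" (is "?S \<in> _")
    by measurable
  moreover have "?S = Omega_star \<alpha>"
  proof -
    have "(\<bar>z\<bar> \<noteq> \<infinity> \<and> (x, real_of_ereal z) \<in> O\<alpha>) \<longleftrightarrow> (\<exists>t. z = ereal t \<and> (x, t) \<in> O\<alpha>)" for x z
      by (cases z) auto
    then show ?thesis by (auto simp: space_pair_measure Omega_star_def)
  qed
  ultimately show ?thesis by (simp only: pair_borel_ereal)
qed

lemma cyl_borel: "cyl_minus \<alpha> k \<in> sets borel" "cyl_plus \<alpha> k \<in> sets borel"
proof -
  note r = restrict_fst_borel[OF Omega_star_borel]
  have "{(x, y) \<in> Omega_star \<alpha>. a < x \<and> x \<le> b} \<in> sets borel" "{(x, y) \<in> Omega_star \<alpha>. a < x \<and> x < b} \<in> sets borel"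
    for a b
    using r[of "{a<..b}"] r[of "{a<..<b}"] by simp_all
  then show "cyl_minus \<alpha> k \<in> sets borel" "cyl_plus \<alpha> k \<in> sets borel"
    by (simp_all add: cyl_minus_def cyl_plus_def)
qed

lemma shift_borel:
  assumes "S \<in> sets borel"
  shows "shift c S \<in> sets borel"
proof -
  have "shift c S = {(x, y). (x - c, y - ereal c) \<in> S}" by (auto simp: shift_iff)
  then show ?thesis using assms by (simp add: vimage_pair_borel)
qed

lemma V_flat_borel: "V_flat \<alpha> \<in> sets borel"
proof -
  have "hat_minus \<alpha> k \<in> sets borel" "hat_plus \<alpha> k \<in> sets borel" for k
    unfolding hat_minus_def hat_plus_def by (intro vimage_pair_borel cyl_borel; measurable)+
  then have "Upsilon \<alpha> \<in> sets borel"
    unfolding Upsilon_def Upsilon_level_def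
    by (intro sets.countable_UN'' sets.Un shift_borel) auto
  then have "Upsilon_inv \<alpha> \<in> sets borel"
    unfolding Upsilon_inv_def by (rule vimage_pair_borel) (rule borel_measurable_divide borel_measurable_const measurable_ident_sets borel_mob refl)+
  then have "V \<alpha> \<in> sets borel" unfolding V_def using Omega_star_borel by blast
  from restrict_fst_borel[OF this, of "{..1}"] show ?thesis unfolding V_flat_def by simp
qed

lemma V_pm_borel: "V_minus \<alpha> \<in> sets borel" "V_plus \<alpha> \<in> sets borel"
  using restrict_fst_borel[OF V_flat_borel, of "{..<0}"] restrict_fst_borel[OF V_flat_borel, of "{0..}"]
  unfolding V_minus_def V_plus_def by simp_all

lemma D_borel: "D1 \<alpha> \<in> sets borel" "D \<alpha> \<in> sets borel"
  using shift_borel V_pm_borel by (auto simp: D1_def D2_def D_def)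

section \<open>The isomorphism\<close>

text \<open>This set and its image \<open>regular_flat\<close> serve as the invariant sets
  \<open>X\<close> and \<open>Y\<close> of \<open>metric_isomorphism\<close>.\<close>

definition regular_ext :: "(real \<times> ereal) set" where
  "regular_ext = emb ` regular"

definition regular_flat :: "(real \<times> ereal) set" where
  "regular_flat = psi \<alpha> ` regular_ext"

lemma emb_vimage_regular_ext: "emb -` regular_ext = regular"
  unfolding regular_ext_def by (intro inj_vimage_image_eq) (auto simp: inj_def)

lemma regular_generic: "(x, y) \<in> regular \<Longrightarrow> 0 < x \<and> x < 1 \<and> y < 0 \<and> x \<notin> K\<alpha> \<and> y \<notin> K\<alpha>"
  using regular_subset by (auto simp: generic_def)

lemma regular_ext_borel: "regular_ext \<in> sets borel"
proof -
  have [measurable]: "regular \<in> sets (borel \<Otimes>\<^sub>M borel)" using regular_borel unfolding pair_borel_eq .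
  have "{p \<in> space (borel \<Otimes>\<^sub>M borel). \<bar>snd p\<bar> \<noteq> \<infinity> \<and> (fst p, real_of_ereal (snd p)) \<in> regular} \<in> sets (borel \<Otimes>\<^sub>M (borel :: ereal measure))"
    (is "?S \<in> _") by measurable
  moreover have "?S = regular_ext"
  proof (intro set_eqI iffI)
    fix p assume p: "p \<in> ?S"
    then have "p = emb (fst p, real_of_ereal (snd p))" by (cases p) (auto simp: ereal_real)
    then show "p \<in> regular_ext" using p unfolding regular_ext_def by blast
  qed (auto simp: regular_ext_def space_pair_measure)
  ultimately show ?thesis by (simp only: pair_borel_ereal)
qed

lemma regular_ext_subset_V1: "regular_ext \<subseteq> V1"
  using regular_generic by (force simp: regular_ext_def V1_def)

text \<open>Existence of a lift is \<open>lifts_all\<close>; uniqueness is absence from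
  \<open>double_lifts\<close>.\<close>

lemma lifts_regular:
  assumes "(x, y) \<in> regular"
  shows "lift_pos x y \<longleftrightarrow> \<not> lift_neg (x - 1) (y - 1)"
proof -
  have g: "0 < x" "x < 1" "y < 0" "x \<notin> K\<alpha>" "y \<notin> K\<alpha>" using regular_generic[OF assms] by auto
  have "lifts x (- y)" using g by (intro lifts_all) (simp_all add: K_uminus)
  moreover have "(x, y) \<in> generic" "(x, y) \<notin> double_lifts" using regular_subset assms by auto
  ultimately show ?thesis by (auto simp: lifts_def double_lifts_def)
qed

lemma psi_emb:
  assumes "(x, y) \<in> regular"
  shows "psi \<alpha> (x, ereal y) = (if lift_neg (x - 1) (y - 1) then (x - 1, ereal (y - 1)) else (x, ereal y))"
  using regular_generic[OF assms] by (simp add: psi_def D1_iff_lift_neg one_ereal_def)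

lemma regular_ext_subset_D: "regular_ext \<subseteq> D \<alpha>"
proof
  fix p assume "p \<in> regular_ext"
  then obtain x y where p: "p = (x, ereal y)" "(x, y) \<in> regular" by (auto simp: regular_ext_def)
  have "(x, y) \<in> generic" "y < 0" using regular_subset regular_generic p(2) by blast+
  then show "p \<in> D \<alpha>"
    using lifts_regular[OF p(2)] V_plus_iff[of x y] D1_iff_lift_neg[of y x] by (auto simp: p(1) D_def D2_def)
qed

text \<open>Points of \<open>D1 \<alpha>\<close> have x < 1 and points of
  \<open>V_plus \<alpha>\<close> have x \<ge> 0, so the sign of the first coordinate of
  \<open>psi \<alpha> p\<close> reveals which case of \<open>psi\<close> was applied.\<close>

lemma psi_D:
  assumes "p \<in> D \<alpha>"
  shows "psi \<alpha> p \<in> V_flat \<alpha>" "unlift (psi \<alpha> p) = p"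
proof -
  obtain x y where p: "p = (x, y)" by (cases p)
  have "psi \<alpha> p \<in> V_flat \<alpha> \<and> unlift (psi \<alpha> p) = p"
  proof (cases "p \<in> D1 \<alpha>")
    case True
    then have "(x - 1, y - 1) \<in> V_minus \<alpha>" by (simp add: p D1_iff)
    then show ?thesis using True by (cases y) (auto simp: p psi_def unlift_def V_minus_def one_ereal_def)
  next
    case False
    then have "p \<in> V_plus \<alpha>" using assms by (simp add: D_def D2_def)
    then show ?thesis using False by (auto simp: p psi_def unlift_def V_plus_def)
  qed
  then show "psi \<alpha> p \<in> V_flat \<alpha>" "unlift (psi \<alpha> p) = p" by auto
qed

lemma psi_inj: "inj_on (psi \<alpha>) (D \<alpha>)"
  using psi_D(2) by (rule inj_on_inverseI)

text \<open>Uniqueness of lifts enters when x \<ge> 0: if q also belonged to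
  \<open>D1 \<alpha>\<close>, then \<open>psi \<alpha>\<close> would send it to its other lift. When
  x < 0 the preference of \<open>psi\<close> for \<open>D1 \<alpha>\<close> suffices.\<close>

lemma psi_unlift:
  assumes "q \<in> V_flat \<alpha>" "unlift q \<in> regular_ext"
  shows "psi \<alpha> (unlift q) = q"
proof -
  obtain x y where q: "q = (x, y)" by (cases q)
  show ?thesis
  proof (cases "x < 0")
    case True
    have "(x + 1, y + 1) \<in> D1 \<alpha>"
      using True assms(1) by (cases y) (auto simp: q D1_iff V_minus_def one_ereal_def)
    then show ?thesis using True by (cases y) (auto simp: q unlift_def psi_def one_ereal_def)
  next
    case False
    then have u: "unlift q = q" by (simp add: q unlift_def)
    then obtain r where r: "y = ereal r" "(x, r) \<in> regular" using assms(2) by (auto simp: q regular_ext_def)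
    have "lift_pos x r"
      using V_plus_iff[of x r] regular_subset r False assms(1) by (auto simp: q V_plus_def)
    then show ?thesis using lifts_regular[OF r(2)] psi_emb[OF r(2)] u by (simp add: q r)
  qed
qed

lemma regular_flat_eq: "regular_flat = {q \<in> V_flat \<alpha>. unlift q \<in> regular_ext}"
proof (intro set_eqI iffI)
  fix q assume "q \<in> regular_flat"
  then show "q \<in> {q \<in> V_flat \<alpha>. unlift q \<in> regular_ext}"
    using psi_D regular_ext_subset_D by (auto simp: regular_flat_def)
next
  fix q assume "q \<in> {q \<in> V_flat \<alpha>. unlift q \<in> regular_ext}"
  then show "q \<in> regular_flat" unfolding regular_flat_def using psi_unlift by (metis (mono_tags, lifting) image_eqI mem_Collect_eq)
qed

lemma regular_flat_borel: "regular_flat \<in> sets borel"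
proof -
  have "regular_flat = V_flat \<alpha> \<inter> unlift -` regular_ext" by (auto simp: regular_flat_eq)
  then show ?thesis using V_flat_borel measurable_sets[OF unlift_measurable regular_ext_borel] by auto
qed

lemma psi_regular_flat: "p \<in> regular_ext \<Longrightarrow> psi \<alpha> p \<in> regular_flat"
  unfolding regular_flat_def by (rule imageI)

lemma unlift_regular_ext: "q \<in> regular_flat \<Longrightarrow> unlift q \<in> regular_ext"
  and psi_unlift_regular_flat: "q \<in> regular_flat \<Longrightarrow> psi \<alpha> (unlift q) = q"
  unfolding regular_flat_eq using psi_unlift by blast+

lemma unlift_psi_regular_ext: "p \<in> regular_ext \<Longrightarrow> unlift (psi \<alpha> p) = p"
  using psi_D(2) regular_ext_subset_D by blast

lemma Farey_emb:
  assumes "(x, y) \<in> generic"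
  shows "Farey (x, ereal y) = emb (Farey_real (x, y))"
proof -
  have g: "0 < x" "x < 1" "y < 0" using assms by (auto simp: generic_def)
  then have "(1 - x) / x = 1 / x - 1" "(- y + 1) / y = 1 / y - 1" by (simp_all add: field_simps)
  then show ?thesis using g by (auto simp: Farey_def Farey_real_def mob_def)
qed

lemma Farey_regular_ext:
  assumes "p \<in> regular_ext"
  shows "Farey p \<in> regular_ext"
proof -
  obtain x y where p: "p = (x, ereal y)" "(x, y) \<in> regular" using assms by (auto simp: regular_ext_def)
  have "(x, y) \<in> generic" using regular_subset p(2) by blast
  then show ?thesis using Farey_real_regular[OF p(2)] by (auto simp: p(1) Farey_emb regular_ext_def)
qed

text \<open>In each of the five branches of \<open>Farey_flat \<alpha>\<close> a step lemma exhibits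
  one lift of \<open>Farey p\<close>. As \<open>Farey p\<close> is regular it has no other lift, so
  this is the one chosen by \<open>psi \<alpha>\<close>.\<close>

lemma conjugacy:
  assumes "p \<in> regular_ext"
  shows "psi \<alpha> (Farey p) = Farey_flat \<alpha> (psi \<alpha> p)"
proof -
  obtain x y where p: "p = (x, ereal y)" and reg: "(x, y) \<in> regular" using assms by (auto simp: regular_ext_def)
  have g: "0 < x" "x < 1" "y < 0" "x \<notin> K\<alpha>" "y \<notin> K\<alpha>" using regular_generic[OF reg] by auto
  have gen: "(x, y) \<in> generic" using regular_subset reg by blast
  have FX: "Farey_real (x, y) \<in> regular" using Farey_real_regular[OF reg] .
  have ne: "x \<noteq> 1 / 2" "x \<noteq> 1 / (1 + \<alpha>)" using g(4) K_consts(3,5) by metis+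
  have half: "1 / 2 < 1 / (1 + \<alpha>)" using \<alpha>_pos \<alpha>_less_half by (simp add: field_simps)
  show ?thesis
  proof (cases "x < 1 / 2")
    case True
    have Farey_real: "Farey_real (x, y) = (x / (1 - x), y / (1 - y))" using True by (simp add: Farey_real_def)
    have FX': "(x / (1 - x), y / (1 - y)) \<in> regular" using FX by (simp add: Farey_real)
    show ?thesis
    proof (cases "lift_neg (x - 1) (y - 1)")
      case lift_neg: True
      have eq: "- (1 + 2 * (x - 1)) / (x - 1) = x / (1 - x) - 1"
        "(-2 * (y - 1) + -1) / (y - 1) = y / (1 - y) - 1"
        using g(2,3) by (simp_all add: divide_simps) (simp_all add: algebra_simps)
      have "Farey_flat \<alpha> (x - 1, ereal (y - 1)) = (x / (1 - x) - 1, ereal (y / (1 - y) - 1))"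
        using True g(3) eq by (simp add: Farey_flat_def mob_def)
      moreover have "lift_neg (x / (1 - x) - 1) (y / (1 - y) - 1)" using lift_neg_step_left[OF lift_neg g(4,3,1) True] .
      ultimately show ?thesis
        using psi_emb[OF reg] psi_emb[OF FX'] lift_neg by (simp add: p Farey_emb[OF gen] Farey_real)
    next
      case False
      then have "lift_pos (x / (1 - x)) (y / (1 - y))" using lift_pos_step_left[of x y] lifts_regular[OF reg] g by simp
      moreover have "Farey_flat \<alpha> (x, ereal y) = (x / (1 - x), ereal (y / (1 - y)))"
        using True g by (simp add: Farey_flat_def mob_def)
      ultimately show ?thesis
        using psi_emb[OF reg] psi_emb[OF FX'] False lifts_regular[OF FX'] by (simp add: p Farey_emb[OF gen] Farey_real)
    qed
  next
    case False
    then have x: "1 / 2 < x" using ne by simp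
    have Farey_real: "Farey_real (x, y) = (1 / x - 1, 1 / y - 1)" using False by (simp add: Farey_real_def)
    have FX': "(1 / x - 1, 1 / y - 1) \<in> regular" using FX by (simp add: Farey_real)
    show ?thesis
    proof (cases "lift_neg (x - 1) (y - 1)")
      case lift_neg: True
      have "Farey_flat \<alpha> (x - 1, ereal (y - 1)) = (1 / x - 1, ereal (1 / y - 1))"
        using x g by (simp add: Farey_flat_def mob_def) (simp add: field_simps)
      moreover have "lift_pos (1 / x - 1) (1 / y - 1)" using lift_neg_step_right[OF lift_neg g(3,1,2)] .
      ultimately show ?thesis
        using psi_emb[OF reg] psi_emb[OF FX'] lifts_regular[OF FX'] lift_neg by (simp add: p Farey_emb[OF gen] Farey_real)
    next
      case nVm: False
      then have lift_pos: "lift_pos x y" using lifts_regular[OF reg] by simp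
      show ?thesis
      proof (cases "x < 1 / (1 + \<alpha>)")
        case True
        have "Farey_flat \<alpha> (x, ereal y) = (1 / x - 1 - 1, ereal (1 / y - 1 - 1))"
          using x g True by (simp add: Farey_flat_def mob_def) (simp add: field_simps)
        moreover have "lift_neg (1 / x - 1 - 1) (1 / y - 1 - 1)" using lift_pos_step_middle[OF lift_pos g(4,3) x True] .
        ultimately show ?thesis
          using psi_emb[OF reg] psi_emb[OF FX'] nVm by (simp add: p Farey_emb[OF gen] Farey_real)
      next
        case False
        then have r: "1 / (1 + \<alpha>) < x" using ne by simp
        have "Farey_flat \<alpha> (x, ereal y) = (1 / x - 1, ereal (1 / y - 1))"
          using x g r by (simp add: Farey_flat_def mob_def) (simp add: field_simps)
        moreover have "lift_pos (1 / x - 1) (1 / y - 1)" using lift_posI_Omega[OF lift_pos_step_right[OF lift_pos g(4,3) r g(2)]] .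
        ultimately show ?thesis
          using psi_emb[OF reg] psi_emb[OF FX'] nVm lifts_regular[OF FX'] by (simp add: p Farey_emb[OF gen] Farey_real)
      qed
    qed
  qed
qed

text \<open>The boundary lines of \<open>V1\<close> at finite distance lie over 0 and 1, which
  belong to \<open>K\<alpha>\<close>; the line at -\<infinity> is not in the range of
  \<open>emb\<close>.\<close>

lemma V1_diff_regular_ext_lborel_null: "emeasure lborel (emb -` (V1 - regular_ext)) = 0"
proof -
  have "emb -` (V1 - regular_ext) \<subseteq> (generic - regular) \<union> K\<alpha> \<times> UNIV \<union> UNIV \<times> K\<alpha>"
  proof
    fix p assume p: "p \<in> emb -` (V1 - regular_ext)"
    obtain x y where xy: "p = (x, y)" by (cases p)
    have "(x, y) \<notin> regular" using p unfolding emb_vimage_regular_ext[symmetric] by (simp add: xy)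
    moreover have "0 \<le> x" "x \<le> 1" "y \<le> 0" using p by (auto simp: xy V1_def)
    moreover have "0 \<in> K\<alpha>" "1 \<in> K\<alpha>" by simp_all
    ultimately show "p \<in> (generic - regular) \<union> K\<alpha> \<times> UNIV \<union> UNIV \<times> K\<alpha>"
      unfolding xy generic_def by (cases "x = 0"; cases "x = 1"; cases "y = 0") auto
  qed
  moreover have "generic - regular \<in> null_sets lborel"
  proof -
    have "x \<noteq> y" if "(x, y) \<in> generic - regular" for x y using that by (auto simp: generic_def)
    then have "emeasure lborel (generic - regular) = 0"
      using generic_diff_regular_null by (subst null_sets_hyp_iff[symmetric]) auto
    then show ?thesis by (auto intro!: null_setsI)
  qed
  moreover have "K\<alpha> \<times> UNIV \<in> null_sets (lborel :: (real \<times> real) measure)"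
    "UNIV \<times> K\<alpha> \<in> null_sets (lborel :: (real \<times> real) measure)"
  proof -
    have "emeasure lborel K\<alpha> = 0" using countable_K by (rule emeasure_lborel_countable)
    then show "K\<alpha> \<times> UNIV \<in> null_sets (lborel :: (real \<times> real) measure)"
      "UNIV \<times> K\<alpha> \<in> null_sets (lborel :: (real \<times> real) measure)"
      unfolding lborel_prod[symmetric] by (intro null_setsI; simp add: lborel.emeasure_pair_measure_Times)+
  qed
  moreover have "emb -` (V1 - regular_ext) \<in> sets lborel"
    using vimage_emb_sets[of "V1 - regular_ext"] V1_borel regular_ext_borel by auto
  ultimately have "emb -` (V1 - regular_ext) \<in> null_sets lborel"
    by (meson null_sets.Un null_sets_subset)
  then show ?thesis by auto
qed

lemma V1_diff_regular_ext_null: "emeasure hyp_measure (emb -` (V1 - regular_ext)) = 0"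
  using V1_diff_regular_ext_lborel_null vimage_emb_sets[of "V1 - regular_ext"] V1_borel regular_ext_borel
  by (intro hyp_null_if_lborel_null) auto

text \<open>On each of the halves x < 0 and x \<ge> 0 the map \<open>unlift\<close> is a translation
  or the identity, so a null set in \<open>V1\<close> pulls back to a null set.\<close>

lemma V_flat_diff_regular_flat_null: "emeasure hyp_measure (emb -` (V_flat \<alpha> - regular_flat)) = 0"
proof -
  let ?N = "emb -` (V1 - regular_ext)" and ?f = "\<lambda>x::real. x + 1"
  have N: "?N \<in> sets borel" "emeasure hyp_measure ?N = 0"
    using vimage_emb_sets[of "V1 - regular_ext"] V1_borel regular_ext_borel V1_diff_regular_ext_null by auto
  have "emb -` (V_flat \<alpha> - regular_flat) \<subseteq> ?N \<union> map_prod ?f ?f -` ?N"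
  proof
    fix q assume q: "q \<in> emb -` (V_flat \<alpha> - regular_flat)"
    obtain a b where ab: "q = (a, b)" by (cases q)
    have V: "(a, ereal b) \<in> V_flat \<alpha>" "unlift (a, ereal b) \<notin> regular_ext" using q by (auto simp: ab regular_flat_eq)
    show "q \<in> ?N \<union> map_prod ?f ?f -` ?N"
    proof (cases "a < 0")
      case True
      then have "(a + 1, ereal (b + 1)) \<in> D1 \<alpha>" using V(1) by (simp add: D1_iff V_minus_def one_ereal_def)
      then have "(a + 1, ereal (b + 1)) \<in> V1" using D1_subset_V1 by blast
      then show ?thesis using V(2) True by (simp add: ab unlift_def one_ereal_def)
    next
      case False
      then have "(a, ereal b) \<in> V1" using V(1) V_plus_subset_V1 by (auto simp: V_plus_def)
      then show ?thesis using V(2) False by (simp add: ab unlift_def)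
    qed
  qed
  moreover have "?N \<union> map_prod ?f ?f -` ?N \<in> null_sets hyp_measure"
    using N preserves_vimage_sets[OF preserves_add N(1)] preserves_emeasure[OF preserves_add N(1)]
    by (intro null_sets.Un null_setsI) auto
  moreover have "emb -` (V_flat \<alpha> - regular_flat) \<in> sets hyp_measure"
    using vimage_emb_sets[of "V_flat \<alpha> - regular_flat"] V_flat_borel regular_flat_borel by auto
  ultimately show ?thesis by (meson null_sets_subset null_setsD1)
qed

section \<open>Preservation of measure by the maps of the isomorphism\<close>

lemma emeasure_Farey_vimage:
  assumes "B \<in> sets borel" "B \<subseteq> regular_ext"
  shows "emeasure hyp_measure (emb -` (regular_ext \<inter> Farey -` B)) = emeasure hyp_measure (emb -` B)"
proof -
  have "emb -` (regular_ext \<inter> Farey -` B) = regular \<inter> Farey_real -` (emb -` B)"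
  proof (intro set_eqI)
    fix p :: "real \<times> real"
    show "p \<in> emb -` (regular_ext \<inter> Farey -` B) \<longleftrightarrow> p \<in> regular \<inter> Farey_real -` (emb -` B)"
      using emb_vimage_regular_ext regular_subset Farey_emb[of "fst p" "snd p"] by (cases p) auto
  qed
  moreover have "emb -` B \<subseteq> regular" using assms(2) emb_vimage_regular_ext by auto
  ultimately show ?thesis using emeasure_Farey_real_vimage[OF vimage_emb_sets[OF assms(1)]] by simp
qed

text \<open>\<open>B\<close> is cut at x = 0, and its negative part is translated back. For 0 \<le>
  x < 1 the set \<open>regular_flat\<close> contains at most one of (x, y) and (x - 1, y - 1), so
  the two pieces of the preimage are disjoint.\<close>

lemma emeasure_psi_vimage:
  assumes B: "B \<in> sets borel" "B \<subseteq> regular_flat"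
  shows "emeasure hyp_measure (emb -` (regular_ext \<inter> psi \<alpha> -` B)) = emeasure hyp_measure (emb -` B)"
proof -
  let ?f = "\<lambda>x::real. x - 1"
  define U where "U = emb -` B \<inter> {..<0} \<times> UNIV"
  define W where "W = emb -` B \<inter> {0..} \<times> UNIV"
  have m: "U \<in> sets borel" "W \<in> sets borel"
    using vimage_emb_sets[OF B(1)] unfolding U_def W_def by (auto simp: borel_prod[symmetric])
  have mU: "map_prod ?f ?f -` U \<in> sets borel" using preserves_vimage_sets[OF preserves_diff m(1)] .
  have eq: "emb -` (regular_ext \<inter> psi \<alpha> -` B) = map_prod ?f ?f -` U \<union> W"
  proof (intro set_eqI iffI)
    fix p assume p: "p \<in> emb -` (regular_ext \<inter> psi \<alpha> -` B)"
    obtain x y where xy: "p = (x, y)" by (cases p)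
    have "(x, y) \<in> regular" "psi \<alpha> (x, ereal y) \<in> B" using p emb_vimage_regular_ext by (auto simp: xy)
    then show "p \<in> map_prod ?f ?f -` U \<union> W"
      using psi_emb[of x y] regular_generic[of x y] by (auto simp: xy U_def W_def split: if_splits)
  next
    fix p assume p: "p \<in> map_prod ?f ?f -` U \<union> W"
    obtain x y where xy: "p = (x, y)" by (cases p)
    from p consider "(x - 1, ereal (y - 1)) \<in> B" "x < 1" | "(x, ereal y) \<in> B" "0 \<le> x"
      by (auto simp: xy U_def W_def)
    then show "p \<in> emb -` (regular_ext \<inter> psi \<alpha> -` B)"
    proof cases
      case 1
      then have Y: "(x - 1, ereal (y - 1)) \<in> regular_flat" using B by blast
      show ?thesis using unlift_regular_ext[OF Y] psi_unlift_regular_flat[OF Y] 1 by (simp add: xy unlift_def one_ereal_def)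
    next
      case 2
      then have Y: "(x, ereal y) \<in> regular_flat" using B by blast
      show ?thesis using unlift_regular_ext[OF Y] psi_unlift_regular_flat[OF Y] 2 by (simp add: xy unlift_def)
    qed
  qed
  have disj: "map_prod ?f ?f -` U \<inter> W = {}"
  proof (rule ccontr)
    assume "\<not> ?thesis"
    then obtain x y where "(x - 1, ereal (y - 1)) \<in> B" "x < 1" "(x, ereal y) \<in> B" "0 \<le> x"
      by (auto simp: U_def W_def)
    then have Y: "(x - 1, ereal (y - 1)) \<in> regular_flat" "x < 1" "(x, ereal y) \<in> regular_flat" "0 \<le> x" using B by blast+
    show False using psi_unlift_regular_flat[OF Y(1)] psi_unlift_regular_flat[OF Y(3)] Y(2,4) by (simp add: unlift_def one_ereal_def)
  qed
  have "emeasure hyp_measure (emb -` (regular_ext \<inter> psi \<alpha> -` B)) =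
      emeasure hyp_measure (map_prod ?f ?f -` U) + emeasure hyp_measure W"
    unfolding eq using m mU disj by (intro plus_emeasure[symmetric]) auto
  also have "\<dots> = emeasure hyp_measure U + emeasure hyp_measure W"
    by (simp only: preserves_emeasure[OF preserves_diff m(1)])
  also have "\<dots> = emeasure hyp_measure (U \<union> W)"
    using m by (intro plus_emeasure) (auto simp: U_def W_def)
  also have "U \<union> W = emb -` B" by (auto simp: U_def W_def)
  finally show ?thesis .
qed

lemma psi_measurable: "psi \<alpha> \<in> borel \<rightarrow>\<^sub>M borel"
proof -
  have [measurable]: "D1 \<alpha> \<in> sets (borel \<Otimes>\<^sub>M borel)" using D_borel(1) by (simp only: pair_borel_ereal)
  show ?thesis unfolding psi_def borel_prod[symmetric] by measurable
qed

lemma Farey_flat_regular_flat: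
  assumes "q \<in> regular_flat"
  shows "Farey_flat \<alpha> q \<in> regular_flat"
  using conjugacy[OF unlift_regular_ext[OF assms]] psi_regular_flat[OF Farey_regular_ext[OF unlift_regular_ext[OF assms]]]
  by (simp add: psi_unlift_regular_flat[OF assms])

lemma emeasure_unlift_vimage:
  assumes B: "B \<in> sets borel" "B \<subseteq> regular_ext"
  shows "emeasure hyp_measure (emb -` (regular_flat \<inter> unlift -` B)) = emeasure hyp_measure (emb -` B)"
proof -
  have "regular_flat \<inter> unlift -` B \<in> sets borel" using regular_flat_borel measurable_sets[OF unlift_measurable B(1)] by auto
  moreover have "regular_ext \<inter> psi \<alpha> -` (regular_flat \<inter> unlift -` B) = B"
  proof (intro set_eqI)
    show "p \<in> regular_ext \<inter> psi \<alpha> -` (regular_flat \<inter> unlift -` B) \<longleftrightarrow> p \<in> B" for p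
      using B(2) psi_regular_flat[of p] unlift_psi_regular_ext[of p] by auto
  qed
  ultimately show ?thesis using emeasure_psi_vimage[of "regular_flat \<inter> unlift -` B"] by simp
qed

text \<open>On \<open>regular_flat\<close> the map \<open>Farey_flat \<alpha>\<close> is
  \<open>unlift\<close> followed by \<open>Farey\<close> and \<open>psi \<alpha>\<close>, and each
  of the three preserves the measure.\<close>

lemma emeasure_Farey_flat_vimage:
  assumes B: "B \<in> sets borel" "B \<subseteq> regular_flat"
  shows "emeasure hyp_measure (emb -` (regular_flat \<inter> Farey_flat \<alpha> -` B)) = emeasure hyp_measure (emb -` B)"
proof -
  let ?B1 = "regular_ext \<inter> psi \<alpha> -` B"
  let ?B2 = "regular_ext \<inter> Farey -` ?B1"
  have m: "?B1 \<in> sets borel" using regular_ext_borel measurable_sets[OF psi_measurable B(1)] by auto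
  then have m2: "?B2 \<in> sets borel" using regular_ext_borel measurable_sets[OF Farey_measurable m] by auto
  have "regular_flat \<inter> Farey_flat \<alpha> -` B = regular_flat \<inter> unlift -` ?B2"
  proof (intro set_eqI)
    fix q
    show "q \<in> regular_flat \<inter> Farey_flat \<alpha> -` B \<longleftrightarrow> q \<in> regular_flat \<inter> unlift -` ?B2"
      using conjugacy[of "unlift q"] unlift_regular_ext[of q] psi_unlift_regular_flat[of q] Farey_regular_ext[of "unlift q"] by auto
  qed
  then show ?thesis
    using emeasure_unlift_vimage[OF m2] emeasure_Farey_vimage[OF m] emeasure_psi_vimage[OF B] by simp
qed

lemma V1_diff_D_null: "V1 - D \<alpha> \<in> null_sets plane_lborel"
  and V1_diff_regular_ext_plane_null: "V1 - regular_ext \<in> null_sets plane_lborel"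
proof -
  show "V1 - regular_ext \<in> null_sets plane_lborel"
    using V1_diff_regular_ext_lborel_null V1_borel regular_ext_borel by (intro null_setsI) (auto simp: emeasure_plane)
  then show "V1 - D \<alpha> \<in> null_sets plane_lborel"
    by (rule null_sets_subset) (use regular_ext_subset_D V1_borel D_borel(2) in auto)
qed

lemma metric_isomorphism_psi:
  "metric_isomorphism (mu_hat V1) Farey (mu_hat (V_flat \<alpha>)) (Farey_flat \<alpha>) (psi \<alpha>)"
  unfolding metric_isomorphism_def
proof (intro exI conjI ballI)
  have Y: "regular_flat \<subseteq> V_flat \<alpha>" by (auto simp: regular_flat_eq)
  have inj: "inj_on (psi \<alpha>) regular_ext" using psi_inj regular_ext_subset_D by (rule inj_on_subset)
  have inv: "inv_into regular_ext (psi \<alpha>) q = unlift q" if "q \<in> regular_flat" for q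
    using inv_into_f_f[OF inj unlift_regular_ext[OF that]] by (simp add: psi_unlift_regular_flat[OF that])
  show "regular_ext \<in> sets (mu_hat V1)" using V1_borel regular_ext_borel regular_ext_subset_V1 by (simp add: sets_mu_hat_iff)
  show "regular_flat \<in> sets (mu_hat (V_flat \<alpha>))" using V_flat_borel regular_flat_borel Y by (simp add: sets_mu_hat_iff)
  show "space (mu_hat V1) - regular_ext \<in> null_sets (mu_hat V1)"
    using V1_borel regular_ext_borel V1_diff_regular_ext_null by (intro null_setsI) (auto simp: sets_mu_hat_iff emeasure_mu_hat)
  show "space (mu_hat (V_flat \<alpha>)) - regular_flat \<in> null_sets (mu_hat (V_flat \<alpha>))"
    using V_flat_borel regular_flat_borel V_flat_diff_regular_flat_null
    by (intro null_setsI) (auto simp: sets_mu_hat_iff emeasure_mu_hat)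
  show "measure_preserving_map (restrict_space (mu_hat V1) regular_ext) (restrict_space (mu_hat V1) regular_ext) Farey"
    using V1_borel regular_ext_borel regular_ext_subset_V1 Farey_measurable Farey_regular_ext emeasure_Farey_vimage
    by (intro measure_preserving_mapI) auto
  show "measure_preserving_map (restrict_space (mu_hat (V_flat \<alpha>)) regular_flat) (restrict_space (mu_hat (V_flat \<alpha>)) regular_flat)
      (Farey_flat \<alpha>)"
    using V_flat_borel regular_flat_borel Y Farey_flat_measurable Farey_flat_regular_flat emeasure_Farey_flat_vimage
    by (intro measure_preserving_mapI) auto
  show "bij_betw (psi \<alpha>) regular_ext regular_flat" using inj by (simp add: bij_betw_def regular_flat_def)
  show "measure_preserving_map (restrict_space (mu_hat V1) regular_ext) (restrict_space (mu_hat (V_flat \<alpha>)) regular_flat) (psi \<alpha>)"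
    using V1_borel regular_ext_borel regular_ext_subset_V1 V_flat_borel regular_flat_borel Y psi_measurable psi_regular_flat emeasure_psi_vimage
    by (intro measure_preserving_mapI) auto
  show "measure_preserving_map (restrict_space (mu_hat (V_flat \<alpha>)) regular_flat) (restrict_space (mu_hat V1) regular_ext)
      (inv_into regular_ext (psi \<alpha>))"
  proof (rule measure_preserving_mapI[OF V_flat_borel regular_flat_borel Y V1_borel regular_ext_borel regular_ext_subset_V1 unlift_measurable])
    show "inv_into regular_ext (psi \<alpha>) q = unlift q" "inv_into regular_ext (psi \<alpha>) q \<in> regular_ext" if "q \<in> regular_flat" for q
      using inv[OF that] unlift_regular_ext[OF that] by simp_all
    fix B assume B: "B \<in> sets borel" "B \<subseteq> regular_ext"
    have "regular_flat \<inter> inv_into regular_ext (psi \<alpha>) -` B = regular_flat \<inter> unlift -` B" using inv by auto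
    then show "emeasure hyp_measure (emb -` (regular_flat \<inter> inv_into regular_ext (psi \<alpha>) -` B)) = emeasure hyp_measure (emb -` B)"
      using emeasure_unlift_vimage[OF B] by simp
  qed
  show "psi \<alpha> (Farey p) = Farey_flat \<alpha> (psi \<alpha> p)" if "p \<in> regular_ext" for p using conjugacy[OF that] .
qed

lemma conjugacy_AE:
  "AE p in plane_lborel. p \<in> V1 \<longrightarrow>
     p \<in> D \<alpha> \<and> Farey_flat \<alpha> (psi \<alpha> p) \<in> psi \<alpha> ` D \<alpha> \<and>
     inv_into (D \<alpha>) (psi \<alpha>) (Farey_flat \<alpha> (psi \<alpha> p)) = Farey p"
proof (rule AE_mp[OF AE_not_in[OF V1_diff_regular_ext_plane_null]], rule AE_I2, intro impI)
  fix p assume "p \<notin> V1 - regular_ext" "p \<in> V1"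
  then have p: "p \<in> regular_ext" by blast
  have FD: "Farey p \<in> D \<alpha>" using Farey_regular_ext[OF p] regular_ext_subset_D by blast
  show "p \<in> D \<alpha> \<and> Farey_flat \<alpha> (psi \<alpha> p) \<in> psi \<alpha> ` D \<alpha> \<and>
     inv_into (D \<alpha>) (psi \<alpha>) (Farey_flat \<alpha> (psi \<alpha> p)) = Farey p"
    unfolding conjugacy[OF p, symmetric] using p regular_ext_subset_D FD inv_into_f_f[OF psi_inj FD] by auto
qed

end

theorem theorem3:
  fixes \<alpha> :: real
  assumes "0 < \<alpha>" and "\<alpha> < 1/2"
  shows "(D \<alpha> \<subseteq> V1 \<and> V1 - D \<alpha> \<in> null_sets plane_lborel)
    \<and> (AE p in plane_lborel. p \<in> V1 \<longrightarrow>
         p \<in> D \<alpha> \<and> Farey_flat \<alpha> (psi \<alpha> p) \<in> psi \<alpha> ` D \<alpha> \<and>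
         inv_into (D \<alpha>) (psi \<alpha>) (Farey_flat \<alpha> (psi \<alpha> p)) = Farey p)
    \<and> metric_isomorphism (mu_hat V1) Farey (mu_hat (V_flat \<alpha>)) (Farey_flat \<alpha>) (psi \<alpha>)"
proof -
  interpret alpha_cf \<alpha> by unfold_locales (use assms in auto)
  show ?thesis
    using D_subset_V1 V1_diff_D_null conjugacy_AE metric_isomorphism_psi by blast
qed

end
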